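(* Let $p$ be a prime and let $F$ be a finitely generated free group. Then every finitely generated submodule of the left $\mathbb{F}_p[F]$-module $\mathbb{F}_p[[\widehat{F}]]$ is free.
   Context: $\widehat{F}$ is the profinite completion of $F$, and $\mathbb{F}_p[[\widehat{F}]]=\varprojlim_N\mathbb{F}_p[F/N]$ is the completed group ring, where $N$ ranges over the normal subgroups of finite index in $F$; it is a left $\mathbb{F}_p[F]$-module via the natural map $\mathbb{F}_p[F]\to\mathbb{F}_p[[\widehat{F}]]$. *)

theory Defs
  imports "HOL-Algebra.Generated_Groups" "HOL-Algebra.Module" "HOL-Number_Theory.Residues"
begin

section \<open>Free groups\<close>

text \<open>
  A word over \<open>X\<close> is a list of letters \<open>(x, e)\<close> with \<open>x \<in> X\<close>, where \<open>(x, True)\<close> stands for \<open>x\<close>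
  and \<open>(x, False)\<close> for the formal inverse of \<open>x\<close>.
\<close>

definition reduced_words :: "'a set \<Rightarrow> ('a \<times> bool) list set"
  where "reduced_words X =
    {w. fst ` set w \<subseteq> X \<and> successively (\<lambda>(x, e) (y, d). \<not> (x = y \<and> e \<noteq> d)) w}"

definition eval_word :: "('a, 'b) monoid_scheme \<Rightarrow> ('a \<times> bool) list \<Rightarrow> 'a"
  where "eval_word G w =
    foldr (\<lambda>(x, e) g. (if e then x else inv\<^bsub>G\<^esub> x) \<otimes>\<^bsub>G\<^esub> g) w \<one>\<^bsub>G\<^esub>"

definition free_group :: "('a, 'b) monoid_scheme \<Rightarrow> bool"
  where "free_group G \<longleftrightarrow> group G \<and>
    (\<exists>X \<subseteq> carrier G. bij_betw (eval_word G) (reduced_words X) (carrier G))"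

definition finitely_generated_group :: "('a, 'b) monoid_scheme \<Rightarrow> bool"
  where "finitely_generated_group G \<longleftrightarrow> group G \<and>
    (\<exists>S \<subseteq> carrier G. finite S \<and> generate G S = carrier G)"


section \<open>Left modules over a not necessarily commutative ring\<close>

text \<open>
  The locale \<open>module\<close> of HOL-Algebra requires the scalars to be commutative. Its record of operations
  and its locale \<open>submodule\<close> do not, and are reused here.
\<close>

locale left_module = R?: ring R + M?: abelian_group M
  for R :: "('r, 's) ring_scheme" (structure)
    and M :: "('r, 'm, 'n) module_scheme" (structure) +
  assumes smult_closed:
      "\<lbrakk>a \<in> carrier R; x \<in> carrier M\<rbrakk> \<Longrightarrow> a \<odot>\<^bsub>M\<^esub> x \<in> carrier M"
    and smult_l_distr:
      "\<lbrakk>a \<in> carrier R; b \<in> carrier R; x \<in> carrier M\<rbrakk> \<Longrightarrow>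
        (a \<oplus>\<^bsub>R\<^esub> b) \<odot>\<^bsub>M\<^esub> x = a \<odot>\<^bsub>M\<^esub> x \<oplus>\<^bsub>M\<^esub> b \<odot>\<^bsub>M\<^esub> x"
    and smult_r_distr:
      "\<lbrakk>a \<in> carrier R; x \<in> carrier M; y \<in> carrier M\<rbrakk> \<Longrightarrow>
        a \<odot>\<^bsub>M\<^esub> (x \<oplus>\<^bsub>M\<^esub> y) = a \<odot>\<^bsub>M\<^esub> x \<oplus>\<^bsub>M\<^esub> a \<odot>\<^bsub>M\<^esub> y"
    and smult_assoc1:
      "\<lbrakk>a \<in> carrier R; b \<in> carrier R; x \<in> carrier M\<rbrakk> \<Longrightarrow>
        (a \<otimes>\<^bsub>R\<^esub> b) \<odot>\<^bsub>M\<^esub> x = a \<odot>\<^bsub>M\<^esub> (b \<odot>\<^bsub>M\<^esub> x)"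
    and smult_one:
      "x \<in> carrier M \<Longrightarrow> \<one>\<^bsub>R\<^esub> \<odot>\<^bsub>M\<^esub> x = x"

definition module_span :: "('r, 's) ring_scheme \<Rightarrow> ('r, 'm, 'n) module_scheme \<Rightarrow> 'm set \<Rightarrow> 'm set"
  where "module_span R M S = \<Inter> {H. submodule H R M \<and> S \<subseteq> H}"

definition finitely_generated_submodule ::
    "('r, 's) ring_scheme \<Rightarrow> ('r, 'm, 'n) module_scheme \<Rightarrow> 'm set \<Rightarrow> bool"
  where "finitely_generated_submodule R M W \<longleftrightarrow>
    submodule W R M \<and> (\<exists>S \<subseteq> carrier M. finite S \<and> W = module_span R M S)"

definition module_basis :: "('r, 's) ring_scheme \<Rightarrow> ('r, 'm, 'n) module_scheme \<Rightarrow> 'm set \<Rightarrow> bool"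
  where "module_basis R M B \<longleftrightarrow>
    B \<subseteq> carrier M \<and> module_span R M B = carrier M \<and>
    (\<forall>A c. finite A \<and> A \<subseteq> B \<and> c \<in> A \<rightarrow> carrier R \<and>
        (\<Oplus>\<^bsub>M\<^esub>b\<in>A. c b \<odot>\<^bsub>M\<^esub> b) = \<zero>\<^bsub>M\<^esub> \<longrightarrow> (\<forall>b\<in>A. c b = \<zero>\<^bsub>R\<^esub>))"

definition free_left_module :: "('r, 's) ring_scheme \<Rightarrow> ('r, 'm, 'n) module_scheme \<Rightarrow> bool"
  where "free_left_module R M \<longleftrightarrow> left_module R M \<and> (\<exists>B. module_basis R M B)"


section \<open>Group rings\<close>

text \<open>
  Elements of \<open>R[G]\<close> are the finitely supported functions from \<open>carrier G\<close> to \<open>carrier R\<close>, made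
  extensional so that equality of elements is equality of functions.
\<close>

definition group_ring_support ::
    "('r, 's) ring_scheme \<Rightarrow> ('g, 'h) monoid_scheme \<Rightarrow> ('g \<Rightarrow> 'r) \<Rightarrow> 'g set"
  where "group_ring_support R G f = {g \<in> carrier G. f g \<noteq> \<zero>\<^bsub>R\<^esub>}"

definition group_ring :: "('r, 's) ring_scheme \<Rightarrow> ('g, 'h) monoid_scheme \<Rightarrow> ('g \<Rightarrow> 'r) ring"
  where "group_ring R G =
    \<lparr>carrier = {f \<in> carrier G \<rightarrow>\<^sub>E carrier R. finite (group_ring_support R G f)},
     monoid.mult = \<lambda>f h. \<lambda>x\<in>carrier G.
       (\<Oplus>\<^bsub>R\<^esub>g\<in>group_ring_support R G f. f g \<otimes>\<^bsub>R\<^esub> h (inv\<^bsub>G\<^esub> g \<otimes>\<^bsub>G\<^esub> x)),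
     monoid.one = \<lambda>x\<in>carrier G. if x = \<one>\<^bsub>G\<^esub> then \<one>\<^bsub>R\<^esub> else \<zero>\<^bsub>R\<^esub>,
     ring.zero = \<lambda>x\<in>carrier G. \<zero>\<^bsub>R\<^esub>,
     ring.add = \<lambda>f h. \<lambda>x\<in>carrier G. f x \<oplus>\<^bsub>R\<^esub> h x\<rparr>"

text \<open>The map \<open>R[G] \<rightarrow> R[H]\<close> that extends a group homomorphism \<open>\<phi> : G \<rightarrow> H\<close> linearly.\<close>

definition group_ring_map ::
    "('r, 's) ring_scheme \<Rightarrow> ('g, 'h) monoid_scheme \<Rightarrow> ('k, 'l) monoid_scheme \<Rightarrow> ('g \<Rightarrow> 'k) \<Rightarrow>
      ('g \<Rightarrow> 'r) \<Rightarrow> ('k \<Rightarrow> 'r)"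
  where "group_ring_map R G H \<phi> f =
    (\<lambda>y\<in>carrier H. \<Oplus>\<^bsub>R\<^esub>g\<in>{g \<in> group_ring_support R G f. \<phi> g = y}. f g)"


section \<open>Completed group rings\<close>

definition finite_index_normals :: "('g, 'h) monoid_scheme \<Rightarrow> 'g set set"
  where "finite_index_normals F = {N. N \<lhd> F \<and> finite (rcosets\<^bsub>F\<^esub> N)}"

text \<open>
  The inverse limit of the rings \<open>R[F/N]\<close>: compatible families, with componentwise operations.
  For \<open>N \<subseteq> N'\<close> the projection \<open>F/N \<rightarrow> F/N'\<close> sends the coset \<open>C = N g\<close> to \<open>N' C = N' g\<close>.
\<close>

definition completed_group_ring ::
    "('r, 's) ring_scheme \<Rightarrow> ('g, 'h) monoid_scheme \<Rightarrow> ('g set \<Rightarrow> 'g set \<Rightarrow> 'r) ring"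
  where "completed_group_ring R F =
    \<lparr>carrier = {x \<in> \<Pi>\<^sub>E N\<in>finite_index_normals F. carrier (group_ring R (F Mod N)).
       \<forall>N\<in>finite_index_normals F. \<forall>N'\<in>finite_index_normals F. N \<subseteq> N' \<longrightarrow>
         group_ring_map R (F Mod N) (F Mod N') (\<lambda>C. N' <#>\<^bsub>F\<^esub> C) (x N) = x N'},
     monoid.mult = \<lambda>x y. \<lambda>N\<in>finite_index_normals F. x N \<otimes>\<^bsub>group_ring R (F Mod N)\<^esub> y N,
     monoid.one = \<lambda>N\<in>finite_index_normals F. \<one>\<^bsub>group_ring R (F Mod N)\<^esub>,
     ring.zero = \<lambda>N\<in>finite_index_normals F. \<zero>\<^bsub>group_ring R (F Mod N)\<^esub>,
     ring.add = \<lambda>x y. \<lambda>N\<in>finite_index_normals F. x N \<oplus>\<^bsub>group_ring R (F Mod N)\<^esub> y N\<rparr>"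

definition completion_map ::
    "('r, 's) ring_scheme \<Rightarrow> ('g, 'h) monoid_scheme \<Rightarrow> ('g \<Rightarrow> 'r) \<Rightarrow> ('g set \<Rightarrow> 'g set \<Rightarrow> 'r)"
  where "completion_map R F a =
    (\<lambda>N\<in>finite_index_normals F. group_ring_map R F (F Mod N) (\<lambda>g. N #>\<^bsub>F\<^esub> g) a)"

text \<open>The completed group ring as a left \<open>R[F]\<close>-module, by restriction of scalars.\<close>

definition completed_group_ring_module ::
    "('r, 's) ring_scheme \<Rightarrow> ('g, 'h) monoid_scheme \<Rightarrow>
      ('g \<Rightarrow> 'r, 'g set \<Rightarrow> 'g set \<Rightarrow> 'r) module"
  where "completed_group_ring_module R F =
    \<lparr>carrier = carrier (completed_group_ring R F),
     monoid.mult = monoid.mult (completed_group_ring R F),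
     monoid.one = monoid.one (completed_group_ring R F),
     ring.zero = ring.zero (completed_group_ring R F),
     ring.add = ring.add (completed_group_ring R F),
     module.smult = \<lambda>a x. completion_map R F a \<otimes>\<^bsub>completed_group_ring R F\<^esub> x\<rparr>"

end

theory Submission
  imports Defs
begin

text \<open>
  Let \<open>k = \<F>\<^sub>p\<close>, let \<open>X\<close> be a finite free basis of \<open>F\<close>, let \<open>M\<close> be the completed group algebra and let
  \<open>V \<subseteq> M\<close> be a \<open>k\<close>-subspace of finite dimension. Such a \<open>V\<close> is a finite set, so dimensions can be
  read off from cardinalities, \<open>card V = p ^ dim V\<close>. The proof compares \<open>V\<close> with its translates
  through the number \<open>\<chi>(V) = dim V - (\<Sum>x\<in>X. dim (V \<inter> x V))\<close>. It has three steps.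

  The module \<open>M\<close> is acyclic (\<open>coord_acyclic\<close>): if \<open>F\<close> acts on a finite set \<open>K\<close> and functions
  \<open>u\<^sub>x : K \<rightarrow> M\<close> satisfy \<open>(\<Sum>x. u\<^sub>x(r)) = (\<Sum>x. x\<inverse> u\<^sub>x(x r))\<close> for all \<open>r\<close>, then they vanish; in other
  words, the first homology of \<open>F\<close> with coefficients in \<open>k[K] \<otimes> M\<close> is zero. At the finite level \<open>N\<close> the
  \<open>u\<^sub>x\<close> form a 1-cycle on the Cayley graph of \<open>F/N\<close>, twisted by \<open>K\<close>. Given an edge, the free group acts
  on the covering of the graph with fibre \<open>\<int>/p\<close> in which only that edge changes the sheet. Let \<open>N'\<close> be
  the kernel of this action. At level \<open>N'\<close> the sheet number is a function whose coboundary is the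
  indicator function of the edges above the given one. A cycle pairs to zero with a coboundary, so
  the sum of the cycle over these edges is zero; by compatibility this sum is the value of the
  cycle at level \<open>N\<close> on the given edge.

  The submodule generated by \<open>V\<close> has at most \<open>\<chi>(V)\<close> generators (\<open>few_generators\<close>). As long as
  possible, \<open>V\<close> is replaced by a hyperplane, at the cost of one generator or of one dimension of one
  intersection \<open>V \<inter> x V\<close>. When this is no longer possible, \<open>V\<close> is the sum of the intersections \<open>V \<inter>
  s V\<close>, with \<open>s\<close> a letter or the inverse of one, and every vector of each of these occurs in a
  linear relation between vectors of all of them. Each relation can be continued across every edge
  of the Cayley graph, and since the set of relations is finite, the continuations can be chosen to
  form an action of \<open>F\<close> on it. This is a cycle as above, so acyclicity yields \<open>V = 0\<close>.

  Let \<open>n\<close> be the least number of generators of the submodule \<open>W\<close>, and let \<open>V\<close> be spanned by \<open>n\<close> generators. If \<open>S\<close> is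
  a finite connected set of vertices of the Cayley graph, then \<open>V\<^sub>S = (\<Sum>g\<in>S. g V)\<close> generates \<open>W\<close>, so
  \<open>\<chi>(V\<^sub>S) \<ge> n\<close>. Suppose that the sum is direct over \<open>S\<close> but not over \<open>S\<close> and a neighbouring vertex. Then
  some \<open>V\<^sub>S \<inter> x V\<^sub>S\<close> is larger than what the at least \<open>|S| - 1\<close> edges inside \<open>S\<close> account for, and
  \<open>\<chi>(V\<^sub>S) < n\<close>, a contradiction. Hence all sums are direct and the \<open>n\<close> generators form a basis
  (\<open>free_basis_exists\<close>).
\<close>

section \<open>Elementary abelian groups and finite sums of subgroups\<close>

lemma (in group) int_pow_mod_exponent:
  assumes "x \<in> carrier G" and "x [^] p = \<one>" and "0 < (p::nat)"
  shows "x [^] (i::int) = x [^] (i mod int p)"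
proof -
  have "x [^] i = x [^] (int p * (i div int p)) \<otimes> x [^] (i mod int p)"
    using assms(1) by (subst int_pow_mult [symmetric]) auto
  also have "x [^] (int p * (i div int p)) = \<one>"
    using int_pow_pow[OF assms(1), of "int p" "i div int p"] assms(1,2)
    by (simp add: int_pow_int)
  finally show ?thesis using assms(1) by simp
qed

lemma (in group) subgroup_int_pow_closed:
  assumes "subgroup H G" "x \<in> H"
  shows "x [^] (i::int) \<in> H"
proof -
  have "x [^] (n::nat) \<in> H" for n
    using assms by (induction n) (auto simp: subgroup.one_closed subgroup.m_closed)
  then show ?thesis
    using assms by (cases i rule: int_cases2)
      (auto simp: int_pow_int int_pow_neg_int[OF subgroup.mem_carrier[OF assms]] subgroup.m_inv_closed)
qed

lemma (in group) root_mem_subgroup: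
  assumes "subgroup H G" and "x \<in> carrier G" and "x [^] p = \<one>" and "prime (p::nat)"
    and "x [^] (i::int) \<in> H" and "\<not> int p dvd i"
  shows "x \<in> H"
proof -
  have "coprime i (int p)"
    using prime_imp_coprime[of "int p" i] assms(4,6) by (simp add: coprime_commute)
  then obtain j where j: "[i * j = 1] (mod int p)"
    using cong_solve_coprime_int by blast
  have "x [^] (1::int) = x [^] (i * j)"
    using int_pow_mod_exponent[OF assms(2,3) prime_gt_0_nat[OF assms(4)]] j unfolding cong_def by metis
  also have "\<dots> = (x [^] i) [^] j"
    using assms(2) by (simp add: int_pow_pow)
  finally have eq: "x [^] (1::int) = (x [^] i) [^] j" .
  have "x [^] (1::int) \<in> H"
    unfolding eq by (rule subgroup_int_pow_closed[OF assms(1,5)])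
  then show ?thesis using assms(2) by simp
qed

text \<open>
  In vector space terms \<open>U\<close> is a hyperplane of \<open>V\<close> that contains \<open>H\<close> and misses \<open>v\<close>. A subgroup that is
  maximal with these properties is a hyperplane: if \<open>w \<notin> U\<close>, then \<open>U\<close> and \<open>w\<close> generate \<open>v\<close>, say
  \<open>v = a \<otimes> w [^] i\<close> with \<open>a \<in> U\<close>, and since \<open>i\<close> is invertible modulo \<open>p\<close>, this can be solved for \<open>w\<close>
  modulo \<open>U\<close>. The last conclusion says that the powers of \<open>v\<close> lie in different cosets of \<open>U\<close>.
\<close>

lemma (in comm_group) maximal_subgroup_avoiding:
  assumes "prime (p::nat)" and exponent: "\<And>x. x \<in> V \<Longrightarrow> x [^] p = \<one>"
    and V: "subgroup V G" "finite V" and H: "subgroup H G" "H \<subseteq> V" and v: "v \<in> V" "v \<notin> H"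
  obtains U where "subgroup U G" "H \<subseteq> U" "U \<subseteq> V" "v \<notin> U"
    "\<And>w. w \<in> V \<Longrightarrow> \<exists>i\<in>{0..<int p}. w \<otimes> v [^] i \<in> U"
    "p * card U \<le> card V"
proof -
  have p0: "0 < p" using assms(1) by (simp add: prime_gt_0_nat)
  have VG: "x \<in> carrier G" if "x \<in> V" for x using that V(1) subgroup.mem_carrier by metis
  let ?P = "\<lambda>U. subgroup U G \<and> H \<subseteq> U \<and> U \<subseteq> V \<and> v \<notin> U"
  have "\<exists>U. ?P U \<and> (\<forall>U'. ?P U' \<longrightarrow> card U' \<le> card U)"
  proof (rule ex_has_greatest_nat[of ?P H card "Suc (card V)"])
    show "?P H" using H v by simp
    show "\<forall>U. ?P U \<longrightarrow> card U < Suc (card V)" using V by (auto simp: less_Suc_eq_le card_mono)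
  qed
  then obtain U where U: "?P U" and Umax: "\<And>U'. ?P U' \<Longrightarrow> card U' \<le> card U" by blast
  have UG: "x \<in> carrier G" if "x \<in> U" for x using that U VG by blast
  have vG: "v \<in> carrier G" and vp: "v [^] p = \<one>" using v VG exponent by auto
  have cover: "\<exists>i\<in>{0..<int p}. w \<otimes> v [^] i \<in> U" if w: "w \<in> V" for w
  proof (cases "w \<in> U")
    case True
    then show ?thesis using p0 UG by (intro bexI[of _ 0]) auto
  next
    case False
    have wG: "w \<in> carrier G" and wp: "w [^] p = \<one>" using w VG exponent by auto
    let ?U' = "{a \<otimes> w [^] (i::int) |a i. a \<in> U}"
    have sub: "subgroup ?U' G"
    proof (rule subgroupI)
      show "?U' \<subseteq> carrier G" using UG wG by auto
      show "?U' \<noteq> {}" using U subgroup.one_closed by blast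
      fix x assume "x \<in> ?U'"
      then obtain a i where x: "x = a \<otimes> w [^] (i::int)" "a \<in> U" by auto
      have "inv x = inv a \<otimes> w [^] (- i)"
        using x UG wG by (simp add: inv_mult int_pow_neg)
      moreover have "inv a \<in> U" using x U subgroup.m_inv_closed by metis
      ultimately show "inv x \<in> ?U'" by blast
      fix y assume "y \<in> ?U'"
      then obtain b j where y: "y = b \<otimes> w [^] (j::int)" "b \<in> U" by auto
      have "x \<otimes> y = (a \<otimes> b) \<otimes> w [^] (i + j)"
        using x y UG wG by (simp add: int_pow_mult m_ac)
      moreover have "a \<otimes> b \<in> U" using x y U subgroup.m_closed by metis
      ultimately show "x \<otimes> y \<in> ?U'" by blast
    qed
    have UU': "U \<subseteq> ?U'"
    proof
      fix a assume "a \<in> U"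
      then have "a = a \<otimes> w [^] (0::int)" using UG by simp
      then show "a \<in> ?U'" using \<open>a \<in> U\<close> by blast
    qed
    have U'V: "?U' \<subseteq> V"
    proof clarify
      fix a i assume "a \<in> U"
      then have "a \<in> V" using U by blast
      moreover have "w [^] (i::int) \<in> V" by (rule subgroup_int_pow_closed[OF V(1) w])
      ultimately show "a \<otimes> w [^] i \<in> V" by (rule subgroup.m_closed[OF V(1)])
    qed
    have "w = \<one> \<otimes> w [^] (1::int)" using wG by simp
    then have "w \<in> ?U'" using U subgroup.one_closed by blast
    then have "card U < card ?U'"
      using False UU' U'V V(2) by (metis (no_types, lifting) finite_subset psubsetI psubset_card_mono)
    moreover have "H \<subseteq> ?U'" using U UU' by (meson order_trans)
    ultimately have "v \<in> ?U'"
      using Umax[of ?U'] sub U'V by (meson not_le)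
    then obtain a i where ai: "v = a \<otimes> w [^] (i::int)" "a \<in> U" by auto
    have "\<not> int p dvd i"
    proof
      assume "int p dvd i"
      then have "w [^] i = \<one>"
        using int_pow_mod_exponent[OF wG wp p0, of i] by (simp add: dvd_eq_mod_eq_0)
      then show False using ai U UG by auto
    qed
    then have "coprime i (int p)"
      using prime_imp_coprime[of "int p" i] assms(1) by (simp add: coprime_commute)
    then obtain j where j: "[i * j = 1] (mod int p)"
      using cong_solve_coprime_int by blast
    let ?k = "(- j) mod int p"
    have aj: "a [^] (-j) \<in> U" using ai(2) U subgroup_int_pow_closed by metis
    have "v [^] ?k = v [^] (- j)"
      using int_pow_mod_exponent[OF vG vp p0] by metis
    also have "\<dots> = a [^] (- j) \<otimes> w [^] (i * (- j))"
      unfolding ai(1) using UG[OF ai(2)] wG by (simp add: int_pow_distrib int_pow_pow del: mult_minus_right)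
    also have "w [^] (i * (- j)) = inv (w [^] (i * j))"
      using wG by (simp add: int_pow_neg)
    also have "w [^] (i * j) = w [^] (1::int)"
      using int_pow_mod_exponent[OF wG wp p0] j unfolding cong_def by metis
    finally have "w \<otimes> v [^] ?k = a [^] (- j)"
      using wG UG[OF aj] by (simp add: m_lcomm[of w "a [^] (-j)"])
    then show ?thesis
      using aj p0 by (intro bexI[of _ ?k]) auto
  qed
  have inj: "inj_on (\<lambda>(a, i). a \<otimes> v [^] i) (U \<times> {0..<int p})"
  proof (rule inj_onI, clarify)
    fix a i b j
    assume a: "a \<in> U" "b \<in> U" and ij: "i \<in> {0..<int p}" "j \<in> {0..<int p}"
      and eq: "a \<otimes> v [^] i = b \<otimes> v [^] j"
    have "v [^] (i - j) = v [^] i \<otimes> inv (v [^] j)" using vG by (simp add: int_pow_diff)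
    also have "\<dots> = inv a \<otimes> (a \<otimes> v [^] i) \<otimes> inv (v [^] j)"
      using a UG vG by (simp add: m_assoc [symmetric])
    also have "\<dots> = inv a \<otimes> b"
      unfolding eq using a UG vG by (simp add: m_assoc)
    finally have mem: "v [^] (i - j) \<in> U"
      using a U by (simp add: subgroup.m_closed subgroup.m_inv_closed)
    have "int p dvd i - j"
      using root_mem_subgroup[OF _ vG vp assms(1) mem] U by blast
    then have "i = j" using ij by (simp add: mod_eq_dvd_iff [symmetric])
    then show "a = b \<and> i = j" using eq a UG vG by simp
  qed
  have "card (U \<times> {0..<int p}) \<le> card V"
  proof (rule card_inj_on_le[OF inj _ V(2)])
    show "(\<lambda>(a, i). a \<otimes> v [^] i) ` (U \<times> {0..<int p}) \<subseteq> V"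
    proof clarify
      fix a i assume "a \<in> U"
      then have "a \<in> V" using U by blast
      moreover have "v [^] (i::int) \<in> V" by (rule subgroup_int_pow_closed[OF V(1) v(1)])
      ultimately show "a \<otimes> v [^] i \<in> V" by (rule subgroup.m_closed[OF V(1)])
    qed
  qed
  then have "p * card U \<le> card V"
    by (simp add: card_cartesian_product mult.commute)
  then show ?thesis using that U cover by blast
qed


text \<open>
  The sum of a family of subgroups, given by explicit products, because linear relations between
  the members of the family are extracted from it.
\<close>

definition (in comm_group) subgroup_join :: "'t set \<Rightarrow> ('t \<Rightarrow> 'a set) \<Rightarrow> 'a set"
  where "subgroup_join T H = {finprod G r T |r. r \<in> (\<Pi> t\<in>T. H t)}"

lemma (in comm_group) subgroup_subgroup_join:
  assumes "\<And>t. t \<in> T \<Longrightarrow> subgroup (H t) G"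
  shows "subgroup (subgroup_join T H) G"
proof (rule subgroupI)
  have HG: "r \<in> T \<rightarrow> carrier G" if "r \<in> (\<Pi> t\<in>T. H t)" for r
    using that assms subgroup.mem_carrier by fastforce
  show "subgroup_join T H \<subseteq> carrier G"
    unfolding subgroup_join_def using HG by (auto intro: finprod_closed)
  have "(\<lambda>_. \<one>) \<in> (\<Pi> t\<in>T. H t)" using assms subgroup.one_closed by blast
  then show "subgroup_join T H \<noteq> {}" unfolding subgroup_join_def by blast
  fix x assume "x \<in> subgroup_join T H"
  then obtain r where r: "x = finprod G r T" "r \<in> (\<Pi> t\<in>T. H t)"
    unfolding subgroup_join_def by blast
  have "finprod G (\<lambda>t. inv (r t)) T \<otimes> x = finprod G (\<lambda>t. inv (r t) \<otimes> r t) T"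
    unfolding r(1) using HG[OF r(2)] by (subst finprod_multf) (auto simp: Pi_iff)
  also have "\<dots> = \<one>" using HG[OF r(2)] by (intro finprod_one_eqI) (auto simp: Pi_iff)
  finally have "inv x = finprod G (\<lambda>t. inv (r t)) T"
    unfolding r(1) using HG[OF r(2)] by (intro inv_equality) (auto intro!: finprod_closed)
  moreover have "(\<lambda>t. inv (r t)) \<in> (\<Pi> t\<in>T. H t)"
    using r(2) assms subgroup.m_inv_closed by fastforce
  ultimately show "inv x \<in> subgroup_join T H" unfolding subgroup_join_def by blast
  fix y assume "y \<in> subgroup_join T H"
  then obtain \<mu> where \<mu>: "y = finprod G \<mu> T" "\<mu> \<in> (\<Pi> t\<in>T. H t)"
    unfolding subgroup_join_def by blast
  have "x \<otimes> y = finprod G (\<lambda>t. r t \<otimes> \<mu> t) T"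
    unfolding r(1) \<mu>(1) using HG r(2) \<mu>(2) by (simp add: finprod_multf)
  moreover have "(\<lambda>t. r t \<otimes> \<mu> t) \<in> (\<Pi> t\<in>T. H t)"
    using r(2) \<mu>(2) assms by (simp add: Pi_iff subgroup.m_closed)
  ultimately show "x \<otimes> y \<in> subgroup_join T H" unfolding subgroup_join_def by blast
qed

lemma (in comm_group) subset_subgroup_join:
  assumes "finite T" "t \<in> T" and H: "\<And>t. t \<in> T \<Longrightarrow> subgroup (H t) G"
  shows "H t \<subseteq> subgroup_join T H"
proof
  fix x assume x: "x \<in> H t"
  then have xG: "x \<in> carrier G" using H assms(2) subgroup.mem_carrier by metis
  let ?r = "\<lambda>s. if t = s then x else \<one>"
  have "x = finprod G ?r T"
    using finprod_singleton[OF assms(2,1), of "\<lambda>_. x"] xG by simp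
  moreover have "?r \<in> (\<Pi> t\<in>T. H t)" using x H subgroup.one_closed by (auto simp: Pi_iff)
  ultimately show "x \<in> subgroup_join T H" unfolding subgroup_join_def by (intro CollectI exI[of _ ?r] conjI)
qed

lemma (in comm_group) subgroup_join_subset:
  assumes "subgroup V G" "\<And>t. t \<in> T \<Longrightarrow> H t \<subseteq> V"
  shows "subgroup_join T H \<subseteq> V"
proof -
  have "finprod G r T \<in> V" if "r \<in> (\<Pi> t\<in>T. H t)" for r
  proof (cases "finite T")
    case True
    have "finprod G r T' \<in> V" if "finite T'" "T' \<subseteq> T" for T'
      using that
    proof (induction T')
      case empty
      then show ?case using assms(1) subgroup.one_closed by simp
    next
      case (insert t T')
      have rV: "r s \<in> V" if "s \<in> T" for s using that \<open>r \<in> _\<close> assms(2) by blast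
      have "finprod G r (insert t T') = r t \<otimes> finprod G r T'"
        using insert rV assms(1) subgroup.mem_carrier by (intro finprod_insert) fastforce+
      then show ?case using insert rV assms(1) by (simp add: subgroup.m_closed)
    qed
    then show ?thesis using True by blast
  next
    case False
    then show ?thesis using assms(1) subgroup.one_closed by simp
  qed
  then show ?thesis unfolding subgroup_join_def by blast
qed

text \<open>
  This turns the existence of a continuation across an edge into a permutation of the finite set
  of all relations.
\<close>

lemma bij_betw_with_equal_fibres:
  assumes "finite K"
    and fibres: "\<And>v. card {k \<in> K. \<alpha> k = v} = card {k \<in> K. \<beta> k = v}"
  obtains \<sigma> where "bij_betw \<sigma> K K" "\<And>k. k \<in> K \<Longrightarrow> \<beta> (\<sigma> k) = \<alpha> k"
proof -
have "\<exists>h. bij_betw h {k \<in> K. \<alpha> k = v} {k \<in> K. \<beta> k = v}" for v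
    using fibres assms(1) by (intro finite_same_card_bij) auto
  then obtain h where h: "\<And>v. bij_betw (h v) {k \<in> K. \<alpha> k = v} {k \<in> K. \<beta> k = v}"
    by metis
  let ?\<sigma> = "\<lambda>k. h (\<alpha> k) k"
  have mem: "?\<sigma> k \<in> K" "\<beta> (?\<sigma> k) = \<alpha> k" if "k \<in> K" for k
    using bij_betw_apply[OF h[of "\<alpha> k"], of k] that by auto
  have "inj_on ?\<sigma> K"
  proof (rule inj_onI)
    fix k l assume kl: "k \<in> K" "l \<in> K" "?\<sigma> k = ?\<sigma> l"
    then have "\<alpha> k = \<alpha> l" using mem by metis
    then show "k = l"
      using kl bij_betw_imp_inj_on[OF h[of "\<alpha> k"]] by (auto dest: inj_onD)
  qed
  moreover from this have "?\<sigma> ` K = K"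
    using mem(1) by (intro endo_inj_surj[OF assms(1)]) auto
  ultimately have "bij_betw ?\<sigma> K K" unfolding bij_betw_def by blast
  then show ?thesis using that mem(2) by blast
qed

lemma (in comm_group) subgroup_finprod_closed:
  assumes "subgroup V G" "\<And>t. t \<in> T \<Longrightarrow> f t \<in> V"
  shows "finprod G f T \<in> V"
  using assms(2)
proof (induction T rule: infinite_finite_induct)
  case (insert t T)
  then have "f \<in> T \<rightarrow> carrier G" "f t \<in> carrier G"
    using assms(1) subgroup.mem_carrier by fastforce+
  then show ?case using insert assms(1) by (simp add: subgroup.m_closed)
qed (use assms(1) subgroup.one_closed in auto)

lemma prod_strict_mono_nat:
  fixes f g :: "'i \<Rightarrow> nat"
  assumes "finite A" "\<And>i. i \<in> A \<Longrightarrow> 0 < f i \<and> f i \<le> g i" "j \<in> A" "f j < g j"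
  shows "prod f A < prod g A"
proof -
  have "prod f A = f j * prod f (A - {j})" "prod g A = g j * prod g (A - {j})"
    using assms(1,3) by (simp_all add: prod.remove)
  moreover have "prod f (A - {j}) \<le> prod g (A - {j})"
    using assms(2) by (intro prod_mono) auto
  moreover have "0 < prod f (A - {j})" using assms(2) by (intro prod_pos) auto
  ultimately show ?thesis using assms(4)
    by (metis less_le_trans mult_le_mono2 mult_less_mono1)
qed

section \<open>Acyclic actions: the case without removable hyperplanes\<close>

definition letter_value :: "('f, 'h) monoid_scheme \<Rightarrow> 'f \<times> bool \<Rightarrow> 'f"
  where "letter_value F l = (if snd l then fst l else inv\<^bsub>F\<^esub> (fst l))"

definition opposite :: "'f \<times> bool \<Rightarrow> 'f \<times> bool"
  where "opposite l = (fst l, \<not> snd l)"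

lemma eval_word_Nil [simp]: "eval_word F [] = \<one>\<^bsub>F\<^esub>"
  by (simp add: eval_word_def)

lemma eval_word_Cons [simp]: "eval_word F (l # w) = letter_value F l \<otimes>\<^bsub>F\<^esub> eval_word F w"
  by (simp add: eval_word_def letter_value_def split: prod.split)

text \<open>
  An elementary abelian \<open>p\<close>-group, written multiplicatively, on which \<open>F\<close> acts by automorphisms. The
  last assumption is the vanishing of twisted cycles. The permutations \<open>\<sigma> x\<close> are
  arbitrary, as for an action on \<open>K\<close> of the free group with basis \<open>X\<close>; the elements of \<open>K\<close> are families of group elements indexed by letters
  because the assumption will be applied to a set of relations between such families.
\<close>

locale acyclic_action = comm_group G + F: group F
  for G :: "('m, 'n) monoid_scheme" (structure) and F :: "('f, 'h) monoid_scheme" +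
  fixes p :: nat and X :: "'f set" and act :: "'f \<Rightarrow> 'm \<Rightarrow> 'm"
  assumes prime_p: "prime p"
    and exponent_p: "x \<in> carrier G \<Longrightarrow> x [^] p = \<one>"
    and act_closed: "\<lbrakk>g \<in> carrier F; x \<in> carrier G\<rbrakk> \<Longrightarrow> act g x \<in> carrier G"
    and act_mult:
      "\<lbrakk>g \<in> carrier F; x \<in> carrier G; y \<in> carrier G\<rbrakk> \<Longrightarrow> act g (x \<otimes> y) = act g x \<otimes> act g y"
    and act_comp:
      "\<lbrakk>g \<in> carrier F; h \<in> carrier F; x \<in> carrier G\<rbrakk> \<Longrightarrow> act (g \<otimes>\<^bsub>F\<^esub> h) x = act g (act h x)"
    and act_one: "x \<in> carrier G \<Longrightarrow> act \<one>\<^bsub>F\<^esub> x = x"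
    and X_subset: "X \<subseteq> carrier F"
    and finite_X: "finite X"
    and words: "g \<in> carrier F \<Longrightarrow> \<exists>w. fst ` set w \<subseteq> X \<and> eval_word F w = g"
    and acyclic: "\<And>(K :: ('f \<times> bool \<Rightarrow> 'm) set) \<sigma> u x r.
      \<lbrakk>finite K; \<And>x. x \<in> X \<Longrightarrow> bij_betw (\<sigma> x) K K;
       \<And>x r. \<lbrakk>x \<in> X; r \<in> K\<rbrakk> \<Longrightarrow> u x r \<in> carrier G;
       \<And>r. r \<in> K \<Longrightarrow>
         finprod G (\<lambda>x. u x r) X = finprod G (\<lambda>x. act (inv\<^bsub>F\<^esub> x) (u x (\<sigma> x r))) X;
       x \<in> X; r \<in> K\<rbrakk> \<Longrightarrow> u x r = \<one>"
begin

abbreviation letters :: "('f \<times> bool) set"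
  where "letters \<equiv> X \<times> UNIV"

abbreviation val :: "'f \<times> bool \<Rightarrow> 'f"
  where "val \<equiv> letter_value F"

abbreviation ival :: "'f \<times> bool \<Rightarrow> 'f"
  where "ival l \<equiv> inv\<^bsub>F\<^esub> (val l)"

abbreviation F_mult :: "'f \<Rightarrow> 'f \<Rightarrow> 'f"  (infixl "\<bullet>" 70)
  where "g \<bullet> h \<equiv> g \<otimes>\<^bsub>F\<^esub> h"

text \<open>
  This is \<open>V \<inter> l V\<close>, where \<open>l\<close> is a letter.
\<close>

definition overlap :: "'m set \<Rightarrow> 'f \<times> bool \<Rightarrow> 'm set"
  where "overlap V l = {w \<in> V. act (ival l) w \<in> V}"

definition act_span :: "'m set \<Rightarrow> 'm set"
  where "act_span S = generate G (\<Union>g\<in>carrier F. act g ` S)"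

lemma val_closed: "l \<in> letters \<Longrightarrow> val l \<in> carrier F"
  using X_subset by (auto simp: letter_value_def)

lemma inv_val: "l \<in> letters \<Longrightarrow> ival l = val (opposite l)"
  using X_subset by (auto simp: letter_value_def opposite_def)

lemma opposite_in_letters: "l \<in> letters \<Longrightarrow> opposite l \<in> letters"
  by (auto simp: opposite_def)

lemma opposite_opposite [simp]: "opposite (opposite l) = l"
  by (simp add: opposite_def)

lemma opposite_neq [simp]: "opposite l \<noteq> l" "l \<noteq> opposite l"
  by (simp_all add: opposite_def prod_eq_iff)

lemma group_hom_act: "g \<in> carrier F \<Longrightarrow> group_hom G G (act g)"
  unfolding group_hom_def group_hom_axioms_def hom_def
  using is_group act_closed act_mult by auto

lemma act_inv_act: "\<lbrakk>g \<in> carrier F; x \<in> carrier G\<rbrakk> \<Longrightarrow> act (inv\<^bsub>F\<^esub> g) (act g x) = x"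
  by (simp add: act_comp [symmetric] act_one)

lemma act_act_inv: "\<lbrakk>g \<in> carrier F; x \<in> carrier G\<rbrakk> \<Longrightarrow> act g (act (inv\<^bsub>F\<^esub> g) x) = x"
  by (simp add: act_comp [symmetric] act_one)

lemma act_unit: "g \<in> carrier F \<Longrightarrow> act g \<one> = \<one>"
  using group_hom.hom_one[OF group_hom_act] by simp

lemma act_inv: "\<lbrakk>g \<in> carrier F; x \<in> carrier G\<rbrakk> \<Longrightarrow> act g (inv x) = inv (act g x)"
  using group_hom.hom_inv[OF group_hom_act] by simp

lemma act_finprod:
  assumes "g \<in> carrier F" "f \<in> A \<rightarrow> carrier G"
  shows "act g (finprod G f A) = finprod G (\<lambda>a. act g (f a)) A"
  using assms(2)
proof (induction A rule: infinite_finite_induct)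
  case (insert a A)
  then have "f \<in> A \<rightarrow> carrier G" "f a \<in> carrier G" by auto
  moreover from this have "(\<lambda>a. act g (f a)) \<in> A \<rightarrow> carrier G"
    using assms(1) act_closed by auto
  ultimately show ?case
    using insert assms(1) by (simp add: act_mult act_closed)
qed (use assms(1) in \<open>simp_all add: act_unit\<close>)

lemma inj_on_act:
  assumes "g \<in> carrier F" "V \<subseteq> carrier G"
  shows "inj_on (act g) V"
  using assms act_inv_act by (metis inj_on_inverseI subsetD)

lemma overlap_subset: "overlap V l \<subseteq> V"
  by (auto simp: overlap_def)

lemma subgroup_overlap:
  assumes "l \<in> letters" and V: "subgroup V G"
  shows "subgroup (overlap V l) G"
proof -
  have g: "ival l \<in> carrier F" using assms(1) val_closed by simp
  have VG: "x \<in> carrier G" if "x \<in> V" for x using that V subgroup.mem_carrier by metis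
  show ?thesis
  proof (rule subgroupI)
    show "overlap V l \<subseteq> carrier G" using VG by (auto simp: overlap_def)
    have "\<one> \<in> overlap V l"
      using V g by (simp add: overlap_def act_unit subgroup.one_closed)
    then show "overlap V l \<noteq> {}" by blast
  qed (use V g VG in \<open>auto simp: overlap_def act_inv act_mult subgroup.m_inv_closed subgroup.m_closed\<close>)
qed

lemma act_overlap:
  assumes "l \<in> letters" "V \<subseteq> carrier G"
  shows "act (ival l) ` overlap V l = overlap V (opposite l)"
proof (intro equalityI subsetI)
  fix y assume "y \<in> act (ival l) ` overlap V l"
  then obtain w where w: "w \<in> V" "y = act (ival l) w" "y \<in> V"
    by (auto simp: overlap_def)
  have "act (ival (opposite l)) y = w"
    using w assms val_closed inv_val[OF opposite_in_letters[OF assms(1)]] act_act_inv by auto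
  then show "y \<in> overlap V (opposite l)" using w by (simp add: overlap_def)
next
  fix y assume y: "y \<in> overlap V (opposite l)"
  have i: "ival (opposite l) = val l"
    using inv_val[OF opposite_in_letters[OF assms(1)]] by simp
  have "act (ival l) (act (val l) y) = y"
    using y assms val_closed by (auto simp: overlap_def intro!: act_inv_act)
  moreover have "act (val l) y \<in> overlap V l"
    using y calculation by (auto simp: overlap_def i)
  ultimately show "y \<in> act (ival l) ` overlap V l" by (metis image_eqI)
qed

lemma card_overlap_opposite:
  assumes "l \<in> letters" "V \<subseteq> carrier G"
  shows "card (overlap V (opposite l)) = card (overlap V l)"
proof -
  have "inj_on (act (ival l)) (overlap V l)"
    using assms overlap_subset[of V l] val_closed by (intro inj_on_act) auto
  then show ?thesis using act_overlap[OF assms] card_image by metis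
qed

text \<open>
  The final case of the reduction to hyperplanes: \<open>V\<close> is the sum of its intersections with its
  neighbouring translates, and each of these intersections is contained in the sum of the others.
  Let \<open>K\<close> be the set of linear relations \<open>r\<close> with one summand \<open>r l\<close> in each \<open>V \<inter> l V\<close>. By
  redundancy every vector of \<open>V \<inter> l V\<close> is the summand of some relation, and by linearity the
  number of such relations does not depend on the vector. Translation by \<open>x\<inverse>\<close> maps \<open>V \<inter> x V\<close> to \<open>V \<inter> x\<inverse> V\<close>, so there is
  a permutation of \<open>K\<close> that matches the summand at \<open>x\<inverse>\<close> of each relation with the translate of minus
  the summand at \<open>x\<close> of its image. Then the summands at \<open>X\<close> form a cycle, and vanish.
\<close>

lemma trivial_if_overlaps_redundant:
  assumes V: "subgroup V G" "finite V"
    and total: "V \<subseteq> subgroup_join letters (overlap V)"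
    and redundant: "\<And>l. l \<in> letters \<Longrightarrow> overlap V l \<subseteq> subgroup_join (letters - {l}) (overlap V)"
  shows "V = {\<one>}"
proof -
  have VG: "V \<subseteq> carrier G" using V(1) subgroup.subset by blast
  have finL: "finite letters" using finite_X by simp
  have ovG: "overlap V l \<subseteq> carrier G" for l using VG overlap_subset by blast
  \<comment> \<open>The relations, written multiplicatively.\<close>
  define K where "K = {r \<in> (\<Pi>\<^sub>E l\<in>letters. overlap V l). finprod G r letters = \<one>}"
  have KV: "r l \<in> overlap V l" if "r \<in> K" "l \<in> letters" for r l
    using that by (auto simp: K_def)
  have finov: "finite (overlap V l)" for l
    using V(2) overlap_subset by (rule finite_subset[rotated])
  have KG1: "r l \<in> carrier G" if "r \<in> K" "l \<in> letters" for r l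
    using KV[OF that] ovG by blast
  have KG: "r \<in> A \<rightarrow> carrier G" if "r \<in> K" "A \<subseteq> letters" for r A
    using KV[OF that(1)] ovG that(2) by blast
  have finK: "finite K"
  proof (rule finite_subset)
    show "K \<subseteq> (\<Pi>\<^sub>E l\<in>letters. overlap V l)" by (auto simp: K_def)
    show "finite (\<Pi>\<^sub>E l\<in>letters. overlap V l)"
      using finL finov by (intro finite_PiE)
  qed
  \<comment> \<open>The vector \<open>inv v\<close> is a sum of vectors of the other intersections.\<close>
  have surj: "\<exists>r\<in>K. r l = v" if l: "l \<in> letters" and v: "v \<in> overlap V l" for l v
  proof -
    have sub: "subgroup (overlap V l) G" using subgroup_overlap[OF l V(1)] .
    have vG: "v \<in> carrier G" using v ovG by blast
    have "inv v \<in> overlap V l" using sub v by (rule subgroup.m_inv_closed)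
    then obtain \<mu> where \<mu>: "inv v = finprod G \<mu> (letters - {l})"
        "\<mu> \<in> (\<Pi> t\<in>letters - {l}. overlap V t)"
      using redundant[OF l] unfolding subgroup_join_def by blast
    define r where "r = (\<lambda>t\<in>letters. if t = l then v else \<mu> t)"
    have r1: "r \<in> (\<Pi>\<^sub>E t\<in>letters. overlap V t)"
      using \<mu>(2) v by (auto simp: r_def)
    have \<mu>G: "\<mu> \<in> letters - {l} \<rightarrow> carrier G" using \<mu>(2) ovG by blast
    have "finprod G r letters = finprod G r (insert l (letters - {l}))"
      using l by (simp add: insert_absorb)
    also have "\<dots> = r l \<otimes> finprod G r (letters - {l})"
    proof (rule finprod_insert)
      have "r t \<in> carrier G" if "t \<in> letters" for t using PiE_mem[OF r1 that] ovG by blast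
      then show "r \<in> letters - {l} \<rightarrow> carrier G" "r l \<in> carrier G" using l by blast+
    qed (use finL in auto)
    also have "finprod G r (letters - {l}) = finprod G \<mu> (letters - {l})"
      using \<mu>G by (intro finprod_cong') (auto simp: r_def)
    also have "r l \<otimes> \<dots> = \<one>"
      using vG l by (simp add: \<mu>(1) [symmetric] r_def)
    finally have "r \<in> K" using r1 by (simp add: K_def)
    then show ?thesis using l by (intro bexI[of _ r]) (auto simp: r_def)
  qed
  have shift: "(\<lambda>t\<in>letters. r t \<otimes> \<mu> t) \<in> K" if "r \<in> K" "\<mu> \<in> K" for r \<mu>
  proof -
    have "finprod G (\<lambda>t\<in>letters. r t \<otimes> \<mu> t) letters = finprod G (\<lambda>t. r t \<otimes> \<mu> t) letters"
      using KG1[OF that(1)] KG1[OF that(2)] by (intro finprod_cong') auto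
    also have "\<dots> = \<one>"
      using KG that by (subst finprod_multf) (auto simp: K_def)
    finally show ?thesis
      using KV that subgroup_overlap[OF _ V(1)] subgroup.m_closed by (fastforce simp: K_def)
  qed
  \<comment> \<open>Multiplication by a relation with summand \<open>inv a \<otimes> b\<close> at \<open>l\<close> maps the fibre over \<open>a\<close> to that over \<open>b\<close>.\<close>
  have fibre: "card {r \<in> K. r l = v} = card {r \<in> K. r l = \<one>}"
    if l: "l \<in> letters" and v: "v \<in> overlap V l" for l v
  proof -
    have le: "card {r \<in> K. r l = a} \<le> card {r \<in> K. r l = b}"
      if a: "a \<in> overlap V l" and b: "b \<in> overlap V l" for a b
    proof -
      have aG: "a \<in> carrier G" "b \<in> carrier G" using a b ovG by blast+
      have "inv a \<otimes> b \<in> overlap V l"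
        using a b subgroup_overlap[OF l V(1)] by (simp add: subgroup.m_closed subgroup.m_inv_closed)
      then obtain \<mu> where \<mu>: "\<mu> \<in> K" "\<mu> l = inv a \<otimes> b" using surj[OF l] by blast
      let ?f = "\<lambda>r. \<lambda>t\<in>letters. r t \<otimes> \<mu> t"
      show ?thesis
      proof (rule card_inj_on_le[of ?f])
        show "inj_on ?f {r \<in> K. r l = a}"
        proof (rule inj_onI)
          fix r r' assume k: "r \<in> {r \<in> K. r l = a}" "r' \<in> {r \<in> K. r l = a}" "?f r = ?f r'"
          have "r t = r' t" if t: "t \<in> letters" for t
          proof -
            have "r t \<otimes> \<mu> t = r' t \<otimes> \<mu> t" using fun_cong[OF k(3), of t] t by simp
            moreover have "r t \<in> carrier G" "r' t \<in> carrier G" "\<mu> t \<in> carrier G"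
              using k(1,2) \<mu>(1) KV[OF _ t] ovG by blast+
            ultimately show ?thesis by simp
          qed
          then show "r = r'"
            using k(1,2) by (intro PiE_ext[of r letters "overlap V" r']) (auto simp: K_def)
        qed
        show "?f ` {r \<in> K. r l = a} \<subseteq> {r \<in> K. r l = b}"
        proof clarify
          fix r assume k: "r \<in> K" "a = r l"
          have "a \<otimes> (inv a \<otimes> b) = b" using aG by (simp add: m_assoc [symmetric])
          then show "?f r \<in> K \<and> ?f r l = b" using shift[OF k(1) \<mu>(1)] l k \<mu>(2) by auto
        qed
        show "finite {r \<in> K. r l = b}" using finK by simp
      qed
    qed
    have "\<one> \<in> overlap V l" using subgroup_overlap[OF l V(1)] by (rule subgroup.one_closed)
    then show ?thesis using le v by (meson le_antisym)
  qed
  \<comment> \<open>The summand that the edge \<open>x\<close> prescribes at the letter \<open>(x, False)\<close> of the relation at its other end.\<close>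
  let ?\<beta> = "\<lambda>x r. inv (act (inv\<^bsub>F\<^esub> x) (r (x, True)))"
  have "\<exists>\<sigma>. bij_betw \<sigma> K K \<and> (\<forall>r\<in>K. ?\<beta> x (\<sigma> r) = r (x, False))" if x: "x \<in> X" for x
  proof -
    have lT: "(x, True) \<in> letters" and lF: "(x, False) \<in> letters" using x by auto
    have xF: "x \<in> carrier F" using x X_subset by blast
    have vT: "val (x, True) = x" by (simp add: letter_value_def)
    have oT: "opposite (x, True) = (x, False)" by (simp add: opposite_def)
    have im: "act (inv\<^bsub>F\<^esub> x) ` overlap V (x, True) = overlap V (x, False)"
      using act_overlap[OF lT VG] by (simp add: vT oT)
    have one: "\<one> \<in> overlap V l" if "l \<in> letters" for l
      using subgroup_overlap[OF that V(1)] by (rule subgroup.one_closed)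
    have card_one: "card {r \<in> K. r l = \<one>} * card (overlap V l) = card K" if l: "l \<in> letters" for l
    proof -
      have "K = (\<Union>v\<in>overlap V l. {r \<in> K. r l = v})" using KV[OF _ l] by auto
      moreover have "card (\<Union>v\<in>overlap V l. {r \<in> K. r l = v}) = (\<Sum>v\<in>overlap V l. card {r \<in> K. r l = v})"
        using finK finov by (intro card_UN_disjoint) auto
      ultimately show ?thesis using fibre[OF l] by (simp add: mult.commute)
    qed
    have card_fibres: "card {r \<in> K. r (x, True) = \<one>} = card {r \<in> K. r (x, False) = \<one>}"
    proof -
      have eq: "card (overlap V (x, False)) = card (overlap V (x, True))"
        using card_overlap_opposite[OF lT VG] by (simp add: oT)
      have "card (overlap V (x, True)) > 0"
        using one[OF lT] finov by (auto simp: card_gt_0_iff)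
      moreover have "card {r \<in> K. r (x, True) = \<one>} * card (overlap V (x, True))
        = card {r \<in> K. r (x, False) = \<one>} * card (overlap V (x, True))"
        using card_one[OF lT] card_one[OF lF] by (simp only: eq)
      ultimately show ?thesis by simp
    qed
    have inverts: "?\<beta> x r = v \<longleftrightarrow> r (x, True) = inv (act x v)" if "r \<in> K" "v \<in> carrier G" for r v
    proof -
      have "r (x, True) \<in> carrier G" using KV[OF that(1) lT] ovG by blast
      then have "?\<beta> x r = act (inv\<^bsub>F\<^esub> x) (inv (r (x, True)))" "inv (r (x, True)) \<in> carrier G"
        using xF by (simp_all add: act_inv)
      moreover have "act (inv\<^bsub>F\<^esub> x) a = v \<longleftrightarrow> a = act x v" if "a \<in> carrier G" for a
        using act_act_inv[OF xF that] act_inv_act[OF xF \<open>v \<in> carrier G\<close>] by auto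
      moreover have "inv a = act x v \<longleftrightarrow> a = inv (act x v)" if "a \<in> carrier G" for a
        using that act_closed[OF xF \<open>v \<in> carrier G\<close>] by (metis inv_inv)
      ultimately show ?thesis using \<open>r (x, True) \<in> carrier G\<close> by auto
    qed
    have "card {r \<in> K. r (x, False) = v} = card {r \<in> K. ?\<beta> x r = v}" for v
    proof (cases "v \<in> overlap V (x, False)")
      case True
      have vG: "v \<in> carrier G" using True ovG by blast
      have "act x v \<in> overlap V (x, True)"
        using True ovG xF act_act_inv im [symmetric] by (auto simp: subset_iff)
      then have "inv (act x v) \<in> overlap V (x, True)"
        using subgroup_overlap[OF lT V(1)] by (simp add: subgroup.m_inv_closed)
      then have "card {r \<in> K. r (x, True) = inv (act x v)} = card {r \<in> K. r (x, True) = \<one>}"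
        by (rule fibre[OF lT])
      moreover have "{r \<in> K. ?\<beta> x r = v} = {r \<in> K. r (x, True) = inv (act x v)}"
        using inverts[OF _ vG] by blast
      ultimately show ?thesis using card_fibres fibre[OF lF True] by simp
    next
      case False
      have "r (x, False) \<noteq> v" if "r \<in> K" for r using KV[OF that lF] False by blast
      moreover have "?\<beta> x r \<noteq> v" if "r \<in> K" for r
      proof -
        have "act (inv\<^bsub>F\<^esub> x) (r (x, True)) \<in> overlap V (x, False)" using im KV[OF that lT] by blast
        then show ?thesis
          using False subgroup_overlap[OF lF V(1)] by (metis subgroup.m_inv_closed)
      qed
      ultimately have "{r \<in> K. r (x, False) = v} = {}" "{r \<in> K. ?\<beta> x r = v} = {}" by blast+
      then show ?thesis by (simp only:)
    qed
    then obtain \<sigma> where "bij_betw \<sigma> K K" "\<And>r. r \<in> K \<Longrightarrow> ?\<beta> x (\<sigma> r) = r (x, False)"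
      using bij_betw_with_equal_fibres[OF finK, of "\<lambda>r. r (x, False)" "?\<beta> x"] by blast
    then show ?thesis by blast
  qed
  then obtain \<sigma> where \<sigma>: "\<And>x. x \<in> X \<Longrightarrow> bij_betw (\<sigma> x) K K"
    "\<And>x r. \<lbrakk>x \<in> X; r \<in> K\<rbrakk> \<Longrightarrow> ?\<beta> x (\<sigma> x r) = r (x, False)"
    by metis
  have cycle: "finprod G (\<lambda>x. r (x, True)) X = finprod G (\<lambda>x. act (inv\<^bsub>F\<^esub> x) (\<sigma> x r (x, True))) X"
    if k: "r \<in> K" for r
  proof -
    have sk: "\<sigma> x r \<in> K" if "x \<in> X" for x using \<sigma>(1)[OF that] k by (rule bij_betw_apply)
    have clT: "(\<lambda>x. r (x, True)) \<in> X \<rightarrow> carrier G" using KV[OF k] ovG by blast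
    have clF: "(\<lambda>x. r (x, False)) \<in> X \<rightarrow> carrier G" using KV[OF k] ovG by blast
    have cl\<sigma>: "(\<lambda>x. act (inv\<^bsub>F\<^esub> x) (\<sigma> x r (x, True))) \<in> X \<rightarrow> carrier G"
    proof
      fix x assume x: "x \<in> X"
      have "\<sigma> x r (x, True) \<in> carrier G" using KV[OF sk[OF x], of "(x, True)"] ovG x by blast
      then show "act (inv\<^bsub>F\<^esub> x) (\<sigma> x r (x, True)) \<in> carrier G"
        using x X_subset by (auto intro!: act_closed)
    qed
    have "letters = (\<lambda>x. (x, True)) ` X \<union> (\<lambda>x. (x, False)) ` X" by (auto simp: image_iff)
    then have "\<one> = finprod G r ((\<lambda>x. (x, True)) ` X \<union> (\<lambda>x. (x, False)) ` X)"
      using k by (simp add: K_def)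
    also have "\<dots> = finprod G r ((\<lambda>x. (x, True)) ` X) \<otimes> finprod G r ((\<lambda>x. (x, False)) ` X)"
      using finite_X clT clF by (intro finprod_Un_disjoint) auto
    also have "finprod G r ((\<lambda>x. (x, True)) ` X) = finprod G (\<lambda>x. r (x, True)) X"
      using clT by (intro finprod_reindex) (auto simp: inj_on_def)
    also have "finprod G r ((\<lambda>x. (x, False)) ` X) = finprod G (\<lambda>x. r (x, False)) X"
      using clF by (intro finprod_reindex) (auto simp: inj_on_def)
    finally have z: "finprod G (\<lambda>x. r (x, True)) X \<otimes> finprod G (\<lambda>x. r (x, False)) X = \<one>" by simp
    have "finprod G (\<lambda>x. r (x, False)) X \<otimes> finprod G (\<lambda>x. act (inv\<^bsub>F\<^esub> x) (\<sigma> x r (x, True))) X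
      = finprod G (\<lambda>x. r (x, False) \<otimes> act (inv\<^bsub>F\<^esub> x) (\<sigma> x r (x, True))) X"
      using clF cl\<sigma> by (simp add: finprod_multf)
    also have "\<dots> = \<one>"
    proof (rule finprod_one_eqI)
      fix x assume x: "x \<in> X"
      have "act (inv\<^bsub>F\<^esub> x) (\<sigma> x r (x, True)) \<in> carrier G" using cl\<sigma> x by blast
      then show "r (x, False) \<otimes> act (inv\<^bsub>F\<^esub> x) (\<sigma> x r (x, True)) = \<one>"
        using \<sigma>(2)[OF x k] by (simp flip: \<sigma>(2)[OF x k])
    qed
    finally have z': "finprod G (\<lambda>x. r (x, False)) X \<otimes> finprod G (\<lambda>x. act (inv\<^bsub>F\<^esub> x) (\<sigma> x r (x, True))) X = \<one>" .
    show ?thesis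
      using inv_unique[OF z z'] clT clF cl\<sigma> by simp
  qed
  have trivT: "overlap V (x, True) \<subseteq> {\<one>}" if x: "x \<in> X" for x
  proof
    fix v assume "v \<in> overlap V (x, True)"
    then obtain r where r: "r \<in> K" "r (x, True) = v" using surj[of "(x, True)"] x by blast
    have "r (x, True) = \<one>"
    proof (rule acyclic[OF finK, where u = "\<lambda>x r. r (x, True)"])
      show "bij_betw (\<sigma> x) K K" if "x \<in> X" for x using \<sigma>(1) that .
      show "r (x, True) \<in> carrier G" if "x \<in> X" "r \<in> K" for x r
        using KV[OF that(2), of "(x, True)"] that(1) ovG by blast
    qed (use cycle x r in auto)
    then show "v \<in> {\<one>}" using r(2) by simp
  qed
  \<comment> \<open>For an inverse letter, the intersection is a translate of the one for the letter.\<close>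
  have triv: "overlap V l \<subseteq> {\<one>}" if l: "l \<in> letters" for l
  proof (cases "snd l")
    case True
    then show ?thesis using trivT l by (cases l) auto
  next
    case False
    then have "l = opposite (fst l, True)" "(fst l, True) \<in> letters"
      using l by (auto simp: opposite_def prod_eq_iff)
    moreover have "act (ival (fst l, True)) ` overlap V (fst l, True) \<subseteq> {\<one>}"
      using trivT[of "fst l"] calculation(2) val_closed[OF calculation(2)] by (auto simp: act_unit)
    ultimately show ?thesis using act_overlap[OF _ VG] by metis
  qed
  have "subgroup_join letters (overlap V) \<subseteq> {\<one>}"
    using triv by (intro subgroup_join_subset triv_subgroup)
  then show ?thesis
    using total subgroup.one_closed[OF V(1)] by auto
qed


section \<open>The bound on the number of generators\<close>

lemma act_orbit_subset: "S \<subseteq> carrier G \<Longrightarrow> (\<Union>g\<in>carrier F. act g ` S) \<subseteq> carrier G"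
  using act_closed by auto

lemma subgroup_act_span: "S \<subseteq> carrier G \<Longrightarrow> subgroup (act_span S) G"
  unfolding act_span_def by (intro generate_is_subgroup act_orbit_subset)

lemma act_span_superset:
  assumes "S \<subseteq> carrier G"
  shows "S \<subseteq> act_span S"
proof
  fix s assume s: "s \<in> S"
  then have "s \<in> act \<one>\<^bsub>F\<^esub> ` S" using assms act_one by (metis image_eqI subsetD)
  then show "s \<in> act_span S" unfolding act_span_def by (intro generate.incl) auto
qed

lemma act_span_least:
  assumes "subgroup U G" "S \<subseteq> U" "\<And>g x. \<lbrakk>g \<in> carrier F; x \<in> U\<rbrakk> \<Longrightarrow> act g x \<in> U"
  shows "act_span S \<subseteq> U"
  unfolding act_span_def using assms by (intro generate_subgroup_incl) auto

lemma act_in_act_span: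
  assumes "S \<subseteq> carrier G" "g \<in> carrier F" "x \<in> act_span S"
  shows "act g x \<in> act_span S"
  using assms(3) unfolding act_span_def
proof (induction rule: generate.induct)
  case one
  then show ?case using assms(2) by (simp add: act_unit generate.one)
next
  case (incl h)
  then obtain k s where k: "k \<in> carrier F" "s \<in> S" "h = act k s" by blast
  then have "act g h = act (g \<bullet> k) s" using assms(1,2) act_comp by auto
  then show ?case using k assms(2) by (intro generate.incl) auto
next
  case (inv h)
  then obtain k s where k: "k \<in> carrier F" "s \<in> S" "h = act k s" by blast
  then have "act g (inv h) = inv (act (g \<bullet> k) s)"
    using assms(1,2) act_comp act_inv act_closed by auto
  then show ?case using k assms(2) by (auto intro!: generate.inv)
next
  case (eng h1 h2)
  have "h1 \<in> carrier G" "h2 \<in> carrier G"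
    using eng(1,2) generate_in_carrier[OF act_orbit_subset[OF assms(1)]] by blast+
  then show ?case using eng assms(2) by (simp add: act_mult generate.eng)
qed

lemma act_span_mono_span:
  assumes "S \<subseteq> carrier G" "T \<subseteq> act_span S"
  shows "act_span T \<subseteq> act_span S"
  using assms subgroup_act_span act_in_act_span by (intro act_span_least) auto

text \<open>
  The inequality says that the number of generators is at most \<open>dim V - (\<Sum>x\<in>X. dim (V \<inter> x V))\<close>. By
  \<open>trivial_if_overlaps_redundant\<close> a nontrivial \<open>V\<close> has a vector \<open>v\<close> of one of two kinds. If \<open>v\<close> lies outside the sum of
  all \<open>V \<inter> l V\<close>, then a hyperplane \<open>U\<close> that contains this sum has the same intersections with its
  translates, and \<open>v\<close> becomes a generator. If \<open>v\<close> lies in \<open>V \<inter> l V\<close> but outside the sum of the others,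
  then a hyperplane \<open>U\<close> that contains the others still generates \<open>v\<close>, because \<open>U\<close> contains \<open>l\<inverse> v\<close>, and
  only the intersections for \<open>l\<close> and its opposite lose a dimension.
\<close>

theorem few_generators:
  assumes "subgroup V G" "finite V"
  shows "\<exists>B\<subseteq>V. V \<subseteq> act_span B \<and>
    p ^ card B * (\<Prod>x\<in>X. card (overlap V (x, True))) \<le> card V"
  using assms
proof (induction "card V" arbitrary: V rule: less_induct)
  case less
  note V = less.prems
  have VG: "V \<subseteq> carrier G" using V(1) subgroup.subset by blast
  have exponent_V: "x [^] p = \<one>" if "x \<in> V" for x using that VG exponent_p by blast
  have ov: "subgroup (overlap V l) G" if "l \<in> letters" for l using subgroup_overlap[OF that V(1)] .
  have finov: "finite (overlap U l)" if "finite U" for U l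
    using that overlap_subset by (rule finite_subset[rotated])
  have covered: "V \<subseteq> H"
    if H: "subgroup H G" "U \<subseteq> H" and v: "v \<in> H" "v \<in> V"
      and U: "\<And>w. w \<in> V \<Longrightarrow> \<exists>i\<in>{0..<int p}. w \<otimes> v [^] i \<in> U" for H U v
  proof
    fix w assume w: "w \<in> V"
    then obtain i where i: "w \<otimes> v [^] (i::int) \<in> H" using U H(2) by blast
    have "inv (v [^] i) \<in> H"
      by (intro subgroup.m_inv_closed[OF H(1)] subgroup_int_pow_closed[OF H(1)] v(1))
    moreover have "w = w \<otimes> v [^] i \<otimes> inv (v [^] i)"
      using subsetD[OF VG w] subsetD[OF VG v(2)] by (simp add: m_assoc)
    ultimately show "w \<in> H" using subgroup.m_closed[OF H(1) i] by metis
  qed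
  show ?case
  proof (cases "V = {\<one>}")
    case True
    have "(\<Prod>x\<in>X. card (overlap V (x, True))) \<le> 1"
    proof (rule prod_le_1)
      fix x assume "x \<in> X"
      have "card (overlap V (x, True)) \<le> card {\<one>}"
        using overlap_subset[of V] True by (intro card_mono) auto
      then show "0 \<le> card (overlap V (x, True)) \<and> card (overlap V (x, True)) \<le> 1" by simp
    qed
    moreover have "V \<subseteq> act_span {}"
      using subgroup_act_span[of "{}"] subgroup.one_closed True by auto
    ultimately show ?thesis using True by (intro exI[of _ "{}"]) auto
  next
    case False
    then consider (new) "\<not> V \<subseteq> subgroup_join letters (overlap V)"
      | (redundant) l where "l \<in> letters"
          "\<not> overlap V l \<subseteq> subgroup_join (letters - {l}) (overlap V)"
      using trivial_if_overlaps_redundant[OF V] by blast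
    then show ?thesis
    proof cases
      case new
      let ?H = "subgroup_join letters (overlap V)"
      obtain v where v: "v \<in> V" "v \<notin> ?H" using new by blast
      have H: "subgroup ?H G" "?H \<subseteq> V"
        using ov by (intro subgroup_subgroup_join subgroup_join_subset[OF V(1)] overlap_subset; simp)+
      obtain U where U: "subgroup U G" "?H \<subseteq> U" "U \<subseteq> V" "v \<notin> U"
        "\<And>w. w \<in> V \<Longrightarrow> \<exists>i\<in>{0..<int p}. w \<otimes> v [^] i \<in> U" "p * card U \<le> card V"
        using maximal_subgroup_avoiding[OF prime_p exponent_V V H v] by metis
      have finU: "finite U" using U(3) V(2) by (rule finite_subset)
      have "card U < card V" using U(3,4) v(1) V(2) by (intro psubset_card_mono) auto
      then obtain B where B: "B \<subseteq> U" "U \<subseteq> act_span B"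
        "p ^ card B * (\<Prod>x\<in>X. card (overlap U (x, True))) \<le> card U"
        using less.hyps[OF _ U(1) finU] by blast
      have BG: "insert v B \<subseteq> carrier G" using B(1) U(3) VG v(1) by blast
      have ovU: "overlap V l \<subseteq> U" if "l \<in> letters" for l
      proof -
        have "overlap V l \<subseteq> ?H" using that ov finite_X by (intro subset_subgroup_join) auto
        then show ?thesis using U(2) by blast
      qed
      have le: "card (overlap V (x, True)) \<le> card (overlap U (x, True))" if x: "x \<in> X" for x
      proof (rule card_mono[OF finov[OF finU]], rule subsetI)
        fix w assume w: "w \<in> overlap V (x, True)"
        have l: "(x, True) \<in> letters" using x by simp
        have "act (ival (x, True)) w \<in> overlap V (opposite (x, True))"
          using act_overlap[OF l VG] w by blast
        then show "w \<in> overlap U (x, True)"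
          using w ovU[OF l] ovU[OF opposite_in_letters[OF l]] unfolding overlap_def by blast
      qed
      have "v \<notin> B" using B(1) U(4) by blast
      then have "p ^ card (insert v B) * (\<Prod>x\<in>X. card (overlap V (x, True)))
        = p * (p ^ card B * (\<Prod>x\<in>X. card (overlap V (x, True))))"
        using B(1) finU finite_subset by (subst card_insert_disjoint) auto
      also have "\<dots> \<le> p * (p ^ card B * (\<Prod>x\<in>X. card (overlap U (x, True))))"
        using le by (intro mult_le_mono2 prod_mono) auto
      also have "\<dots> \<le> card V" using B(3) U(6) by (meson le_trans mult_le_mono2)
      finally have bound: "p ^ card (insert v B) * (\<Prod>x\<in>X. card (overlap V (x, True))) \<le> card V" .
      have "U \<subseteq> act_span (insert v B)"
        using B(2) act_span_mono_span[OF BG, of B] act_span_superset[OF BG] by blast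
      then have span: "V \<subseteq> act_span (insert v B)"
        using act_span_superset[OF BG] v(1) U(5) by (intro covered[OF subgroup_act_span[OF BG]]) auto
      show ?thesis using B(1) U(3) v(1) bound span by (intro exI[of _ "insert v B"]) auto
    next
      case (redundant l)
      let ?H = "subgroup_join (letters - {l}) (overlap V)"
      obtain v where v: "v \<in> overlap V l" "v \<notin> ?H" using redundant(2) by blast
      have vV: "v \<in> V" using v(1) overlap_subset by blast
      have H: "subgroup ?H G" "?H \<subseteq> V"
        using ov by (intro subgroup_subgroup_join subgroup_join_subset[OF V(1)] overlap_subset; simp)+
      obtain U where U: "subgroup U G" "?H \<subseteq> U" "U \<subseteq> V" "v \<notin> U"
        "\<And>w. w \<in> V \<Longrightarrow> \<exists>i\<in>{0..<int p}. w \<otimes> v [^] i \<in> U" "p * card U \<le> card V"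
        using maximal_subgroup_avoiding[OF prime_p exponent_V V H vV v(2)] by metis
      have finU: "finite U" using U(3) V(2) by (rule finite_subset)
      have UG: "U \<subseteq> carrier G" using U(3) VG by blast
      have "card U < card V" using U(3,4) vV V(2) by (intro psubset_card_mono) auto
      then obtain B where B: "B \<subseteq> U" "U \<subseteq> act_span B"
        "p ^ card B * (\<Prod>x\<in>X. card (overlap U (x, True))) \<le> card U"
        using less.hyps[OF _ U(1) finU] by blast
      have BG: "B \<subseteq> carrier G" using B(1) UG by blast
      have ovU: "overlap V t \<subseteq> U" if "t \<in> letters" "t \<noteq> l" for t
        using subset_subgroup_join[of "letters - {l}" t "overlap V"] that ov finite_X U(2) by auto
      have acts: "act (ival t) w \<in> overlap V (opposite t)"
        if "t \<in> letters" "w \<in> overlap V t" for t w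
        using act_overlap[OF that(1) VG] that(2) by blast
      have le: "card (overlap V t) \<le> card (overlap U t)"
        if t: "t \<in> letters" "t \<noteq> l" "t \<noteq> opposite l" for t
      proof (rule card_mono[OF finov[OF finU]], rule subsetI)
        fix w assume w: "w \<in> overlap V t"
        have "opposite t \<noteq> l" using t(3) by (metis opposite_opposite)
        then show "w \<in> overlap U t"
          using w ovU[OF t(1,2)] ovU[OF opposite_in_letters[OF t(1)]] acts[OF t(1) w]
          unfolding overlap_def by blast
      qed
      \<comment> \<open>Since \<open>v\<close> itself lies in the intersection, correcting a vector by powers of \<open>v\<close> stays inside it.\<close>
      have le_l: "card (overlap V l) \<le> p * card (overlap U l)"
      proof -
        have "overlap V l \<subseteq> (\<lambda>(w, i). w \<otimes> inv (v [^] i)) ` (overlap U l \<times> {0..<int p})"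
        proof
          fix w assume w: "w \<in> overlap V l"
          then obtain i where i: "i \<in> {0..<int p}" "w \<otimes> v [^] i \<in> U"
            using U(5) overlap_subset by blast
          have "v [^] i \<in> overlap V l"
            using v(1) by (rule subgroup_int_pow_closed[OF ov[OF redundant(1)]])
          then have "w \<otimes> v [^] i \<in> overlap V l"
            using w ov[OF redundant(1)] by (simp add: subgroup.m_closed)
          then have "act (ival l) (w \<otimes> v [^] i) \<in> U"
            using acts[OF redundant(1)] ovU[OF opposite_in_letters[OF redundant(1)]] by auto
          then have 1: "w \<otimes> v [^] i \<in> overlap U l" using i(2) by (simp add: overlap_def)
          have "w \<in> carrier G" "v \<in> carrier G" using w vV VG overlap_subset by blast+
          then have "w = w \<otimes> v [^] i \<otimes> inv (v [^] i)" by (simp add: m_assoc)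
          then show "w \<in> (\<lambda>(w, i). w \<otimes> inv (v [^] i)) ` (overlap U l \<times> {0..<int p})"
            using 1 i(1) by (intro image_eqI[of _ _ "(w \<otimes> v [^] i, i)"]) auto
        qed
        then have "card (overlap V l) \<le> card (overlap U l \<times> {0..<int p})"
          using finov[OF finU] by (intro surj_card_le) auto
        then show ?thesis by (simp add: card_cartesian_product mult.commute)
      qed
      have fl: "fst l \<in> X" using redundant(1) by auto
      have card_T: "card (overlap Y (fst l, True)) = card (overlap Y l)" if "Y \<subseteq> carrier G" for Y
      proof (cases "snd l")
        case True
        then show ?thesis by (metis prod.collapse)
      next
        case False
        then have "(fst l, True) = opposite l" by (simp add: opposite_def)
        then show ?thesis using card_overlap_opposite[OF redundant(1) that] by simp
      qed
      have "(\<Prod>x\<in>X. card (overlap V (x, True)))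
        \<le> (\<Prod>x\<in>X. (if x = fst l then p else 1) * card (overlap U (x, True)))"
      proof (rule prod_mono, intro conjI)
        fix x assume x: "x \<in> X"
        show "card (overlap V (x, True)) \<le> (if x = fst l then p else 1) * card (overlap U (x, True))"
          using le[of "(x, True)"] x le_l card_T[OF VG] card_T[OF UG]
          by (auto simp: opposite_def prod_eq_iff)
      qed simp
      also have "\<dots> = p * (\<Prod>x\<in>X. card (overlap U (x, True)))"
        using fl finite_X by (simp add: prod.distrib prod.delta)
      finally have "p ^ card B * (\<Prod>x\<in>X. card (overlap V (x, True)))
        \<le> p * (p ^ card B * (\<Prod>x\<in>X. card (overlap U (x, True))))"
        by (metis mult_le_mono2 mult.left_commute)
      also have "\<dots> \<le> card V" using B(3) U(6) by (meson le_trans mult_le_mono2)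
      finally have bound: "p ^ card B * (\<Prod>x\<in>X. card (overlap V (x, True))) \<le> card V" .
      have "act (ival l) v \<in> act_span B"
        using acts[OF redundant(1) v(1)] ovU[OF opposite_in_letters[OF redundant(1)]] B(2) by auto
      then have "act (val l) (act (ival l) v) \<in> act_span B"
        by (rule act_in_act_span[OF BG val_closed[OF redundant(1)]])
      then have "v \<in> act_span B"
        using act_act_inv[OF val_closed[OF redundant(1)]] vV VG by auto
      then have span: "V \<subseteq> act_span B"
        using covered[OF subgroup_act_span[OF BG] B(2) _ vV U(5)] by blast
      show ?thesis using B(1) U(3) bound span by (intro exI[of _ B]) auto
    qed
  qed
qed


section \<open>Minimal generating sets are free\<close>

text \<open>
  The edges with label \<open>l\<close> of the Cayley graph that have both ends in \<open>S\<close>; the edge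
  from \<open>l\<inverse> g\<close> to \<open>g\<close> is represented by \<open>g\<close>.
  Neighbours are obtained by left multiplication, so that the action of the letter maps the
  translate \<open>l\<inverse> g V\<close> at one end of an edge to the translate \<open>g V\<close> at the other.
\<close>

definition edges :: "'f set \<Rightarrow> 'f \<times> bool \<Rightarrow> 'f set"
  where "edges S l = {g \<in> S. ival l \<bullet> g \<in> S}"

definition independent_over :: "'m set \<Rightarrow> 'f set \<Rightarrow> bool"
  where "independent_over V S \<longleftrightarrow>
    (\<forall>v \<in> S \<rightarrow> V. finprod G (\<lambda>g. act g (v g)) S = \<one> \<longrightarrow> (\<forall>g\<in>S. v g = \<one>))"

definition translate_sum :: "'m set \<Rightarrow> 'f set \<Rightarrow> 'm set"
  where "translate_sum V S = (\<lambda>v. finprod G (\<lambda>g. act g (v g)) S) ` (S \<rightarrow>\<^sub>E V)"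

text \<open>
  The finite connected sets of vertices of the Cayley graph that contain the identity, built by
  adding neighbours.
\<close>

inductive connected_set :: "'f set \<Rightarrow> bool"
  where root: "connected_set {\<one>\<^bsub>F\<^esub>}"
  | grow: "\<lbrakk>connected_set S; w \<in> S; l \<in> letters; val l \<bullet> w \<notin> S\<rbrakk> \<Longrightarrow>
      connected_set (insert (val l \<bullet> w) S)"

lemma connected_set_finite: "connected_set S \<Longrightarrow> finite S"
  by (induction rule: connected_set.induct) auto

lemma connected_set_closed: "connected_set S \<Longrightarrow> S \<subseteq> carrier F"
proof (induction rule: connected_set.induct)
  case (grow S w l)
  then show ?case using val_closed[OF grow(3)] by auto
qed auto

lemma connected_set_one: "connected_set S \<Longrightarrow> \<one>\<^bsub>F\<^esub> \<in> S"
  by (induction rule: connected_set.induct) auto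

lemma connected_set_extend:
  assumes "connected_set S" "fst ` set w \<subseteq> X"
  shows "\<exists>S'. connected_set S' \<and> S \<subseteq> S' \<and> eval_word F w \<in> S'"
  using assms(2)
proof (induction w)
  case Nil
  then show ?case using assms(1) connected_set_one by auto
next
  case (Cons l w)
  then obtain S' where S': "connected_set S'" "S \<subseteq> S'" "eval_word F w \<in> S'" by auto
  have l: "l \<in> letters" using Cons.prems by (cases l) auto
  show ?case
  proof (cases "val l \<bullet> eval_word F w \<in> S'")
    case True
    then show ?thesis using S' by auto
  next
    case False
    then show ?thesis using connected_set.grow[OF S'(1,3) l] S'(2) by auto
  qed
qed

lemma finite_subset_connected_set:
  assumes "finite T" "T \<subseteq> carrier F"
  shows "\<exists>S. connected_set S \<and> T \<subseteq> S"
  using assms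
proof (induction T)
  case empty
  then show ?case using root by blast
next
  case (insert g T)
  then obtain S where S: "connected_set S" "T \<subseteq> S" by auto
  obtain w where w: "fst ` set w \<subseteq> X" "eval_word F w = g" using words insert.prems by blast
  then show ?case using connected_set_extend[OF S(1) w(1)] S(2) by blast
qed

text \<open>
  A connected graph has at least as many edges as a spanning tree: each new vertex brings a new
  edge.
\<close>

lemma connected_set_edge_count:
  assumes "connected_set S"
  shows "card S \<le> Suc (\<Sum>x\<in>X. card (edges S (x, True)))"
  using assms
proof (induction rule: connected_set.induct)
  case root
  then show ?case by simp
next
  case (grow S w l)
  let ?h = "val l \<bullet> w" let ?S' = "insert ?h S"
  have finS: "finite S" and SF: "S \<subseteq> carrier F"
    using grow(1) connected_set_finite connected_set_closed by auto
  have wF: "w \<in> carrier F" using SF grow(2) by blast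
  have lF: "fst l \<in> X" "fst l \<in> carrier F" using grow(3) X_subset by auto
  have finE: "finite (edges ?S' t)" for t using finS by (simp add: edges_def)
  have sub: "edges S t \<subseteq> edges ?S' t" for t by (auto simp: edges_def)
  have "(\<Sum>x\<in>X. card (edges S (x, True))) < (\<Sum>x\<in>X. card (edges ?S' (x, True)))"
  proof (rule sum_strict_mono_ex1[OF finite_X])
    show "\<forall>x\<in>X. card (edges S (x, True)) \<le> card (edges ?S' (x, True))"
      using sub finE card_mono by blast
    have "\<exists>e. e \<in> edges ?S' (fst l, True) \<and> e \<notin> edges S (fst l, True)"
    proof (cases "snd l")
      case True
      then have "inv\<^bsub>F\<^esub> (fst l) \<bullet> ?h = w"
        using lF wF by (simp add: letter_value_def F.m_assoc [symmetric])
      then have "?h \<in> edges ?S' (fst l, True)" "?h \<notin> edges S (fst l, True)"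
        using grow(2,4) by (simp_all add: edges_def letter_value_def)
      then show ?thesis by blast
    next
      case False
      then have "w \<in> edges ?S' (fst l, True)" "w \<notin> edges S (fst l, True)"
        using grow(2,4) by (simp_all add: edges_def letter_value_def)
      then show ?thesis by blast
    qed
    then have "edges S (fst l, True) \<subset> edges ?S' (fst l, True)" using sub by blast
    then show "\<exists>x\<in>X. card (edges S (x, True)) < card (edges ?S' (x, True))"
      using lF(1) finE psubset_card_mono by blast
  qed
  moreover have "card ?S' = Suc (card S)" using finS grow(4) by simp
  ultimately show ?case using grow.IH by simp
qed

lemma card_edges_opposite:
  assumes "l \<in> letters" "S \<subseteq> carrier F"
  shows "card (edges S (opposite l)) = card (edges S l)"
proof (rule bij_betw_same_card[symmetric], rule bij_betwI)
  have vl: "val l \<in> carrier F" and io: "ival (opposite l) = val l"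
    using assms(1) val_closed inv_val[OF opposite_in_letters[OF assms(1)]] by auto
  have SF: "g \<in> carrier F" if "g \<in> S" for g using that assms(2) by blast
  show "(\<lambda>g. ival l \<bullet> g) \<in> edges S l \<rightarrow> edges S (opposite l)"
    using vl SF by (auto simp: edges_def io F.m_assoc [symmetric])
  show "(\<lambda>g. val l \<bullet> g) \<in> edges S (opposite l) \<rightarrow> edges S l"
    using vl SF by (auto simp: edges_def io F.m_assoc [symmetric])
  show "val l \<bullet> (ival l \<bullet> g) = g" if "g \<in> edges S l" for g
    using that vl SF by (auto simp: edges_def F.m_assoc [symmetric])
  show "ival l \<bullet> (val l \<bullet> g) = g" if "g \<in> edges S (opposite l)" for g
    using that vl SF by (auto simp: edges_def F.m_assoc [symmetric])
qed

lemma independent_overD: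
  assumes "independent_over V S" "v \<in> S \<rightarrow> V" "finprod G (\<lambda>g. act g (v g)) S = \<one>" "g \<in> S"
  shows "v g = \<one>"
proof -
  have "finprod G (\<lambda>g. act g (v g)) S = \<one> \<longrightarrow> (\<forall>g\<in>S. v g = \<one>)"
    using assms(1,2) unfolding independent_over_def by (rule bspec)
  then show ?thesis using assms(3,4) by blast
qed

lemma independent_over_subset:
  assumes "independent_over V S" "T \<subseteq> S" "finite S" "S \<subseteq> carrier F" "subgroup V G"
  shows "independent_over V T"
  unfolding independent_over_def
proof (intro ballI impI)
  fix v g assume v: "v \<in> T \<rightarrow> V" "finprod G (\<lambda>g. act g (v g)) T = \<one>" and g: "g \<in> T"
  let ?u = "\<lambda>g. if g \<in> T then v g else \<one>"
  have u: "?u \<in> S \<rightarrow> V" using v(1) subgroup.one_closed[OF assms(5)] by auto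
  have VG: "x \<in> carrier G" if "x \<in> V" for x using that assms(5) subgroup.mem_carrier by metis
  have cl: "act g (?u g) \<in> carrier G" if "g \<in> S" for g
    using that u VG assms(4) act_closed by blast
  have "finprod G (\<lambda>g. act g (v g)) T = finprod G (\<lambda>g. act g (?u g)) S"
    using assms(2,3,4) cl by (intro finprod_mono_neutral_cong_left) (auto simp: act_unit subset_iff)
  then have "finprod G (\<lambda>g. act g (?u g)) S = \<one>" using v(2) by simp
  then have "?u g = \<one>"
    by (rule independent_overD[OF assms(1) u]) (use g assms(2) in blast)
  then show "v g = \<one>" using g by simp
qed

lemma independent_over_translate:
  assumes "independent_over V S" "S \<subseteq> carrier F" "a \<in> carrier F" "subgroup V G"
  shows "independent_over V ((\<lambda>g. a \<bullet> g) ` S)"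
  unfolding independent_over_def
proof (intro ballI impI)
  fix v g
  assume v: "v \<in> (\<lambda>g. a \<bullet> g) ` S \<rightarrow> V"
    and one: "finprod G (\<lambda>g. act g (v g)) ((\<lambda>g. a \<bullet> g) ` S) = \<one>"
    and g: "g \<in> (\<lambda>g. a \<bullet> g) ` S"
  let ?u = "\<lambda>g. v (a \<bullet> g)"
  have VG: "x \<in> carrier G" if "x \<in> V" for x using that assms(4) subgroup.mem_carrier by metis
  have u: "?u \<in> S \<rightarrow> V" using v by auto
  have cl: "(\<lambda>g. act g (?u g)) \<in> S \<rightarrow> carrier G" using u VG assms(2) act_closed by blast
  have "act a (finprod G (\<lambda>g. act g (?u g)) S) = finprod G (\<lambda>g. act a (act g (?u g))) S"
    using act_finprod[OF assms(3) cl] .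
  also have "\<dots> = finprod G (\<lambda>g. act (a \<bullet> g) (?u g)) S"
  proof (rule finprod_cong')
    show "(\<lambda>g. act (a \<bullet> g) (?u g)) \<in> S \<rightarrow> carrier G"
      using u VG assms(2,3) by (auto intro!: act_closed)
    show "act a (act g (?u g)) = act (a \<bullet> g) (?u g)" if "g \<in> S" for g
      using that u VG assms(2,3) by (intro act_comp [symmetric]) auto
  qed simp
  also have "\<dots> = \<one>"
  proof -
    have "inj_on (\<lambda>g. a \<bullet> g) S"
      using assms(2,3) by (intro inj_onI) (auto simp: subset_iff)
    moreover have "(\<lambda>g. act g (v g)) \<in> (\<lambda>g. a \<bullet> g) ` S \<rightarrow> carrier G"
      using v VG assms(2,3) by (intro Pi_I act_closed) auto
    ultimately show ?thesis using one by (simp add: finprod_reindex)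
  qed
  finally have "act a (finprod G (\<lambda>g. act g (?u g)) S) = act a \<one>"
    using assms(3) by (simp add: act_unit)
  then have "finprod G (\<lambda>g. act g (?u g)) S = \<one>"
    using inj_on_act[OF assms(3) subset_refl] cl by (auto dest!: inj_onD intro: finprod_closed)
  then have "\<forall>g\<in>S. ?u g = \<one>" using independent_overD[OF assms(1) u] by simp
  then show "v g = \<one>" using g by auto
qed

lemma subgroup_translate_sum:
  assumes "subgroup V G" "S \<subseteq> carrier F"
  shows "subgroup (translate_sum V S) G" and "\<And>g. finite S \<Longrightarrow> g \<in> S \<Longrightarrow> act g ` V \<subseteq> translate_sum V S"
proof -
  have sub: "subgroup (act g ` V) G" if "g \<in> S" for g
    using group_hom.subgroup_img_is_subgroup[OF group_hom_act assms(1)] that assms(2) by blast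
  have eq: "translate_sum V S = subgroup_join S (\<lambda>g. act g ` V)"
  proof (intro equalityI subsetI)
    fix y assume "y \<in> translate_sum V S"
    then obtain v where "v \<in> S \<rightarrow>\<^sub>E V" "y = finprod G (\<lambda>g. act g (v g)) S"
      by (auto simp: translate_sum_def)
    then show "y \<in> subgroup_join S (\<lambda>g. act g ` V)"
      unfolding subgroup_join_def by (intro CollectI exI[of _ "\<lambda>g. act g (v g)"]) auto
  next
    fix y assume "y \<in> subgroup_join S (\<lambda>g. act g ` V)"
    then obtain r where r: "y = finprod G r S" "r \<in> (\<Pi> g\<in>S. act g ` V)"
      unfolding subgroup_join_def by blast
    then have "\<forall>g\<in>S. \<exists>x\<in>V. r g = act g x" by auto
    then obtain v where v: "\<And>g. g \<in> S \<Longrightarrow> v g \<in> V \<and> r g = act g (v g)" by metis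
    have "y = finprod G (\<lambda>g. act g (restrict v S g)) S"
      unfolding r(1)
    proof (rule finprod_cong')
      show "(\<lambda>g. act g (restrict v S g)) \<in> S \<rightarrow> carrier G"
        using v sub subgroup.mem_carrier by fastforce
    qed (use v in auto)
    moreover have "restrict v S \<in> S \<rightarrow>\<^sub>E V" using v by auto
    ultimately show "y \<in> translate_sum V S" unfolding translate_sum_def by (rule image_eqI)
  qed
  show "subgroup (translate_sum V S) G" unfolding eq using sub by (rule subgroup_subgroup_join)
  show "act g ` V \<subseteq> translate_sum V S" if "finite S" "g \<in> S" for g
    unfolding eq using subset_subgroup_join[of S g "\<lambda>g. act g ` V"] that sub by blast
qed

lemma card_translate_sum_independent:
  assumes "independent_over V S" "S \<subseteq> carrier F" "subgroup V G" "finite S"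
  shows "card (translate_sum V S) = card V ^ card S"
proof -
  have VG: "x \<in> carrier G" if "x \<in> V" for x using that assms(3) subgroup.mem_carrier by metis
  have "inj_on (\<lambda>v. finprod G (\<lambda>g. act g (v g)) S) (S \<rightarrow>\<^sub>E V)"
  proof (rule inj_onI)
    fix u v assume u: "u \<in> S \<rightarrow>\<^sub>E V" and v: "v \<in> S \<rightarrow>\<^sub>E V"
      and eq: "finprod G (\<lambda>g. act g (u g)) S = finprod G (\<lambda>g. act g (v g)) S"
    have cl: "(\<lambda>g. act g (w g)) \<in> S \<rightarrow> carrier G" if "w \<in> S \<rightarrow> V" for w
      using that VG assms(2) by (intro Pi_I act_closed) auto
    have uV: "u \<in> S \<rightarrow> V" and vV: "v \<in> S \<rightarrow> V" and viV: "(\<lambda>g. inv (v g)) \<in> S \<rightarrow> V"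
      and dV: "(\<lambda>g. u g \<otimes> inv (v g)) \<in> S \<rightarrow> V"
      using u v assms(3) by (auto simp: PiE_iff subgroup.m_inv_closed subgroup.m_closed)
    have "finprod G (\<lambda>g. act g (v g)) S \<otimes> finprod G (\<lambda>g. act g (u g \<otimes> inv (v g))) S
      = finprod G (\<lambda>g. act g (v g) \<otimes> act g (u g \<otimes> inv (v g))) S"
      using cl[OF vV] cl[OF dV] by (simp add: finprod_multf)
    also have "\<dots> = finprod G (\<lambda>g. act g (u g)) S"
    proof (rule finprod_cong')
      fix g assume g: "g \<in> S"
      have "g \<in> carrier F" "u g \<in> carrier G" "v g \<in> carrier G"
        using g assms(2) uV vV VG by auto
      then have "act g (v g) \<otimes> act g (u g \<otimes> inv (v g)) = act g (v g \<otimes> (u g \<otimes> inv (v g)))"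
        by (simp add: act_mult)
      also have "v g \<otimes> (u g \<otimes> inv (v g)) = u g"
        using \<open>u g \<in> carrier G\<close> \<open>v g \<in> carrier G\<close> by (simp add: m_lcomm[of "v g"])
      finally show "act g (v g) \<otimes> act g (u g \<otimes> inv (v g)) = act g (u g)" .
    qed (use cl[OF uV] in auto)
    finally have "finprod G (\<lambda>g. act g (u g \<otimes> inv (v g))) S = \<one>"
      using eq cl[OF vV] cl[OF dV] by simp
    then have "\<forall>g\<in>S. u g \<otimes> inv (v g) = \<one>"
      using independent_overD[OF assms(1) dV] by simp
    then have "u g = v g" if "g \<in> S" for g
      using that uV vV VG by (metis inv_equality inv_inv Pi_mem inv_closed)
    then show "u = v" using u v by (intro PiE_ext)
  qed
  then have "card (translate_sum V S) = card (S \<rightarrow>\<^sub>E V)"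
    unfolding translate_sum_def by (rule card_image)
  then show ?thesis using assms(4) by (simp add: card_PiE)
qed

text \<open>
  An edge \<open>g\<close>, \<open>l\<inverse> g\<close> inside \<open>S\<close> contributes \<open>g V\<close> to the intersection of \<open>V\<^sub>S\<close> with \<open>l V\<^sub>S\<close>.
\<close>

lemma translate_sum_edges:
  assumes "l \<in> letters" "subgroup V G" "S \<subseteq> carrier F" "finite S"
  shows "translate_sum V (edges S l) \<subseteq> overlap (translate_sum V S) l"
proof
  fix y assume "y \<in> translate_sum V (edges S l)"
  then obtain v where v: "v \<in> edges S l \<rightarrow>\<^sub>E V" and y: "y = finprod G (\<lambda>g. act g (v g)) (edges S l)"
    by (auto simp: translate_sum_def)
  have VG: "x \<in> carrier G" if "x \<in> V" for x using that assms(2) subgroup.mem_carrier by metis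
  have vl: "ival l \<in> carrier F" using val_closed[OF assms(1)] by simp
  have gE: "g \<in> carrier F" "g \<in> S" "ival l \<bullet> g \<in> S" "v g \<in> V" if "g \<in> edges S l" for g
    using that assms(3) v by (auto simp: edges_def)
  have cl: "(\<lambda>g. act g (v g)) \<in> edges S l \<rightarrow> carrier G"
    using gE VG by (intro Pi_I act_closed) auto
  note sub = subgroup_translate_sum[OF assms(2,3)]
  have "y \<in> translate_sum V S"
    unfolding y using sub(2)[OF assms(4)] gE by (intro subgroup_finprod_closed[OF sub(1)]) blast
  moreover have "act (ival l) y = finprod G (\<lambda>g. act (ival l) (act g (v g))) (edges S l)"
    unfolding y by (rule act_finprod[OF vl cl])
  moreover have "act (ival l) (act g (v g)) \<in> translate_sum V S" if "g \<in> edges S l" for g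
  proof -
    have "act (ival l) (act g (v g)) = act (ival l \<bullet> g) (v g)"
      using gE[OF that] VG vl by (simp add: act_comp)
    then show ?thesis using sub(2)[OF assms(4) gE(3)[OF that]] gE(4)[OF that] by auto
  qed
  ultimately show "y \<in> overlap (translate_sum V S) l"
    using subgroup_finprod_closed[OF sub(1), of "edges S l"] by (simp add: overlap_def)
qed

text \<open>
  Here \<open>surplus\<close> is the bound from below on \<open>\<chi>\<close> that the minimality of a generating set provides. Let
  \<open>h = l w\<close> be a new vertex next to \<open>w \<in> S\<close>, and suppose that a relation over \<open>S \<union> {h}\<close> has a nontrivial
  component at \<open>h\<close>. Then the corresponding vector \<open>d\<close> of \<open>h V\<close> lies in \<open>V\<^sub>S \<inter> l V\<^sub>S\<close>. It does not come
  from the edges inside \<open>S\<close>, because these and \<open>h\<close> all belong to \<open>l S\<close>, over which the sum is direct as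
  it is over \<open>S\<close>. So the intersection is larger than the edges account for, and counting
  contradicts the bound.
\<close>

lemma independent_over_connected_set:
  assumes V: "subgroup V G" "finite V"
    and surplus: "\<And>U. \<lbrakk>subgroup U G; finite U; V \<subseteq> U\<rbrakk> \<Longrightarrow>
      card V * (\<Prod>x\<in>X. card (overlap U (x, True))) \<le> card U"
    and "connected_set S"
  shows "independent_over V S"
  using assms(4)
proof (induction rule: connected_set.induct)
  case root
  have VG: "x \<in> carrier G" if "x \<in> V" for x using that V(1) subgroup.mem_carrier by metis
  show ?case unfolding independent_over_def
  proof (intro ballI impI)
    fix v g assume "v \<in> {\<one>\<^bsub>F\<^esub>} \<rightarrow> V" "finprod G (\<lambda>g. act g (v g)) {\<one>\<^bsub>F\<^esub>} = \<one>" "g \<in> {\<one>\<^bsub>F\<^esub>}"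
    then show "v g = \<one>" using VG act_one by (auto simp: Pi_iff)
  qed
next
  case (grow S w l)
  let ?h = "val l \<bullet> w"
  have VG: "x \<in> carrier G" if "x \<in> V" for x using that V(1) subgroup.mem_carrier by metis
  have finS: "finite S" and SF: "S \<subseteq> carrier F" and oneS: "\<one>\<^bsub>F\<^esub> \<in> S"
    using grow(1) connected_set_finite connected_set_closed connected_set_one by auto
  have vlF: "val l \<in> carrier F" using val_closed[OF grow(3)] .
  have wF: "w \<in> carrier F" using grow(2) SF by blast
  have hF: "?h \<in> carrier F" using vlF wF by simp
  let ?U = "translate_sum V S"
  note sub = subgroup_translate_sum[OF V(1) SF]
  have finU: "finite ?U" unfolding translate_sum_def using finS V(2) by (intro finite_imageI finite_PiE)
  have finov: "finite (overlap ?U t)" for t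
    using finU overlap_subset by (rule finite_subset[rotated])
  have edges_card: "card V ^ card (edges S t) = card (translate_sum V (edges S t))" for t
  proof -
    have fe: "finite (edges S t)" "edges S t \<subseteq> S" using finS by (auto simp: edges_def)
    have "independent_over V (edges S t)"
      using independent_over_subset[OF grow.IH fe(2) finS SF V(1)] .
    then show ?thesis using card_translate_sum_independent[of V "edges S t"] fe SF V(1) by auto
  qed
  have ovcard: "card V ^ card (edges S t) \<le> card (overlap ?U t)" if t: "t \<in> letters" for t
    unfolding edges_card using translate_sum_edges[OF t V(1) SF finS] by (intro card_mono finov)
  show ?case unfolding independent_over_def
  proof (intro ballI impI)
    fix v g
    assume v: "v \<in> insert ?h S \<rightarrow> V" and one: "finprod G (\<lambda>g. act g (v g)) (insert ?h S) = \<one>"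
      and g: "g \<in> insert ?h S"
    have cl: "act g (v g) \<in> carrier G" if "g \<in> insert ?h S" for g
      using that v VG hF SF by (intro act_closed) auto
    have vhG: "v ?h \<in> carrier G" using v VG by blast
    have split: "act ?h (v ?h) \<otimes> finprod G (\<lambda>g. act g (v g)) S = \<one>"
      using one finS grow(4) cl by (subst (asm) finprod_insert) auto
    have "v ?h = \<one>"
    proof (rule ccontr)
      assume nontriv: "v ?h \<noteq> \<one>"
      let ?d = "act ?h (v ?h)"
      have clS: "(\<lambda>g. act g (v g)) \<in> S \<rightarrow> carrier G" using cl by blast
      have "finprod G (\<lambda>g. act g (v g)) S \<in> ?U"
        using sub(2)[OF finS] v by (intro subgroup_finprod_closed[OF sub(1)]) blast
      moreover have "?d = inv (finprod G (\<lambda>g. act g (v g)) S)"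
        using split cl[of ?h] clS by (metis finprod_closed insertI1 inv_equality)
      ultimately have dU: "?d \<in> ?U" using sub(1) by (simp add: subgroup.m_inv_closed)
      have "act (ival l) ?d = act w (v ?h)"
        using vlF wF vhG by (simp add: act_comp act_inv_act act_closed)
      then have "act (ival l) ?d \<in> ?U" using sub(2)[OF finS grow(2)] v by auto
      then have dO: "?d \<in> overlap ?U l" using dU by (simp add: overlap_def)
      have "?d \<notin> translate_sum V (edges S l)"
      proof
        assume "?d \<in> translate_sum V (edges S l)"
        then obtain u where u: "u \<in> edges S l \<rightarrow>\<^sub>E V" "?d = finprod G (\<lambda>g. act g (u g)) (edges S l)"
          by (auto simp: translate_sum_def)
        let ?T = "insert ?h (edges S l)"
        have hE: "?h \<notin> edges S l" using grow(4) by (simp add: edges_def)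
        have T: "?T \<subseteq> (\<lambda>g. val l \<bullet> g) ` S"
        proof -
          have "g = val l \<bullet> (ival l \<bullet> g)" if "g \<in> edges S l" for g
            using that SF vlF by (auto simp: edges_def F.m_assoc [symmetric])
          then show ?thesis using grow(2) by (auto simp: edges_def)
        qed
        have ind: "independent_over V ?T"
          using independent_over_translate[OF grow.IH SF vlF V(1)]
          by (rule independent_over_subset[OF _ T]) (use finS SF vlF V(1) in auto)
        let ?u = "\<lambda>g. if g = ?h then inv (v ?h) else u g"
        have uV: "?u \<in> ?T \<rightarrow> V" using u(1) v V(1) by (auto simp: subgroup.m_inv_closed)
        have TF: "?T \<subseteq> carrier F" using hF SF by (auto simp: edges_def)
        have clT: "act g (?u g) \<in> carrier G" if "g \<in> ?T" for g
          using that uV VG TF by (intro act_closed) blast+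
        have clE: "(\<lambda>g. act g (?u g)) \<in> edges S l \<rightarrow> carrier G"
          and clh: "act ?h (?u ?h) \<in> carrier G" using clT by blast+
        have "finprod G (\<lambda>g. act g (?u g)) ?T
          = act ?h (?u ?h) \<otimes> finprod G (\<lambda>g. act g (?u g)) (edges S l)"
          using finS hE clE clh by (intro finprod_insert) (simp_all add: edges_def)
        also have "finprod G (\<lambda>g. act g (?u g)) (edges S l) = ?d"
          unfolding u(2)
        proof (rule finprod_cong')
          show "(\<lambda>g. act g (u g)) \<in> edges S l \<rightarrow> carrier G"
            using u(1) VG TF by (intro Pi_I act_closed) auto
        qed (use hE in auto)
        also have "act ?h (?u ?h) = inv ?d" using hF vhG by (simp add: act_inv)
        also have "inv ?d \<otimes> ?d = \<one>" using cl[of ?h] by simp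
        finally have "?u ?h = \<one>"
          by (rule independent_overD[OF ind uV]) simp
        then show False using nontriv vhG by simp
      qed
      then have strict: "card V ^ card (edges S l) < card (overlap ?U l)"
        unfolding edges_card using translate_sum_edges[OF grow(3) V(1) SF finS] dO
        by (intro psubset_card_mono finov) blast
      have UG: "?U \<subseteq> carrier G" using sub(1) subgroup.subset by blast
      have strict_T: "card V ^ card (edges S (fst l, True)) < card (overlap ?U (fst l, True))"
      proof (cases "snd l")
        case True
        then show ?thesis using strict by (metis prod.collapse)
      next
        case False
        then have "(fst l, True) = opposite l" by (simp add: opposite_def)
        then show ?thesis
          using strict card_edges_opposite[OF grow(3) SF] card_overlap_opposite[OF grow(3) UG] by simp
      qed
      have V0: "card V > 0" using V subgroup.one_closed by (metis card_gt_0_iff emptyE)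
      \<comment> \<open>The bound \<open>surplus\<close> for \<open>V\<^sub>S\<close>, whose cardinality is at most \<open>card V ^ card S\<close>, fails.\<close>
      have "card V ^ card S \<le> card V ^ Suc (\<Sum>x\<in>X. card (edges S (x, True)))"
        using connected_set_edge_count[OF grow(1)] V0 by (intro power_increasing) auto
      also have "\<dots> = card V * (\<Prod>x\<in>X. card V ^ card (edges S (x, True)))"
        by (simp add: power_sum)
      also have "\<dots> < card V * (\<Prod>x\<in>X. card (overlap ?U (x, True)))"
      proof -
        have "(\<Prod>x\<in>X. card V ^ card (edges S (x, True))) < (\<Prod>x\<in>X. card (overlap ?U (x, True)))"
          by (rule prod_strict_mono_nat[OF finite_X, where j = "fst l"])
            (use ovcard V0 grow(3) strict_T in auto)
        then show ?thesis using V0 by simp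
      qed
      also have "\<dots> \<le> card ?U"
      proof (rule surplus[OF sub(1) finU])
        show "V \<subseteq> ?U"
          using sub(2)[OF finS oneS] act_one VG by (metis image_subset_iff subsetI)
      qed
      also have "\<dots> \<le> card (S \<rightarrow>\<^sub>E V)"
        unfolding translate_sum_def using finS V(2) by (intro card_image_le finite_PiE)
      also have "\<dots> = card V ^ card S" using finS by (simp add: card_PiE)
      finally show False by simp
    qed
    moreover from this have "finprod G (\<lambda>g. act g (v g)) S = \<one>"
      using split hF cl by (simp add: act_unit Pi_iff)
    then have "\<forall>g\<in>S. v g = \<one>" using independent_overD[OF grow.IH, of v] v by blast
    ultimately show "v g = \<one>" using g by blast
  qed
qed

text \<open>
  A generating set \<open>B\<close> of least cardinality \<open>n\<close> works. For every finite subgroup \<open>U\<close> that contains \<open>B\<close>, the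
  theorem on generators together with the minimality of \<open>n\<close> gives \<open>\<chi>(U) \<ge> n\<close>. For the span \<open>V\<close> of \<open>B\<close>
  this implies \<open>dim V = n\<close>, so that \<open>B\<close> is linearly independent; for sums of translates of \<open>V\<close> it
  implies that these are direct.
\<close>

theorem free_basis_exists:
  assumes "finite S0" "S0 \<subseteq> carrier G" "act_span S0 = carrier G"
  obtains B where "B \<subseteq> carrier G" "finite B" "act_span B = carrier G"
    "\<And>T c g b. \<lbrakk>finite T; T \<subseteq> carrier F;
        finprod G (\<lambda>g. act g (finprod G (\<lambda>b. b [^] (c g b :: int)) B)) T = \<one>; g \<in> T; b \<in> B\<rbrakk> \<Longrightarrow>
      int p dvd c g b"
proof -
  have p0: "0 < p" using prime_p by (simp add: prime_gt_0_nat)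
  let ?P = "\<lambda>n. \<exists>B\<subseteq>carrier G. finite B \<and> card B = n \<and> act_span B = carrier G"
  define n where "n = (LEAST n. ?P n)"
  have "?P n" unfolding n_def using assms by (intro LeastI[of ?P "card S0"]) blast
  then obtain B where B: "B \<subseteq> carrier G" "finite B" "card B = n" "act_span B = carrier G" by blast
  have least: "n \<le> card B'" if "B' \<subseteq> carrier G" "finite B'" "act_span B' = carrier G" for B'
    unfolding n_def using that by (intro Least_le) blast
  let ?cyc = "\<lambda>b. range (\<lambda>i::int. b [^] i)"
  have cyc: "subgroup (?cyc b) G" if "b \<in> carrier G" for b
  proof (rule subgroupI)
    show "?cyc b \<subseteq> carrier G" using that by auto
    fix x y assume "x \<in> ?cyc b" "y \<in> ?cyc b"
    then obtain i j where ij: "x = b [^] (i::int)" "y = b [^] (j::int)" by auto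
    have "x \<otimes> y = b [^] (i + j)" "inv x = b [^] (- i)"
      using that by (simp_all add: ij int_pow_mult int_pow_neg)
    then show "x \<otimes> y \<in> ?cyc b" "inv x \<in> ?cyc b" by blast+
  qed auto
  define V where "V = subgroup_join B ?cyc"
  define comb where "comb = (\<lambda>c. finprod G (\<lambda>b. b [^] (c b :: int)) B)"
  have BG: "b \<in> carrier G" if "b \<in> B" for b using that B(1) by blast
  have V: "subgroup V G" unfolding V_def using cyc B(1) by (intro subgroup_subgroup_join) auto
  have VG: "V \<subseteq> carrier G" using V subgroup.subset by blast
  have comb_V: "comb c \<in> V" for c
    unfolding comb_def V_def subgroup_join_def
    by (intro CollectI exI[of _ "\<lambda>b. b [^] c b"]) auto
  have comb_mod: "comb c = comb (\<lambda>b\<in>B. c b mod int p)" for c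
    unfolding comb_def
  proof (rule finprod_cong')
    show "b [^] c b = b [^] (\<lambda>b\<in>B. c b mod int p) b" if "b \<in> B" for b
      using int_pow_mod_exponent[OF BG[OF that] exponent_p[OF BG[OF that]] p0, of "c b"] that
      by (simp only: restrict_apply')
  qed (use BG in auto)
  have V_eq: "V = comb ` (B \<rightarrow>\<^sub>E {0..<int p})"
  proof (intro equalityI subsetI)
    fix y assume "y \<in> V"
    then obtain r where r: "y = finprod G r B" "r \<in> (\<Pi> b\<in>B. ?cyc b)"
      unfolding V_def subgroup_join_def by blast
    then have "\<forall>b\<in>B. \<exists>i::int. r b = b [^] i" by auto
    then obtain c where c: "\<And>b. b \<in> B \<Longrightarrow> r b = b [^] (c b :: int)" by metis
    have "y = comb c" unfolding r(1) comb_def using c BG by (intro finprod_cong') auto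
    also have "\<dots> = comb (\<lambda>b\<in>B. c b mod int p)" by (rule comb_mod)
    finally show "y \<in> comb ` (B \<rightarrow>\<^sub>E {0..<int p})" using p0 by (intro image_eqI) auto
  qed (use comb_V in auto)
  have finPi: "finite (B \<rightarrow>\<^sub>E {0..<int p})" using B(2) by (intro finite_PiE) auto
  have card_Pi: "card (B \<rightarrow>\<^sub>E {0..<int p}) = p ^ n" using B(2,3) by (simp add: card_PiE)
  have finV: "finite V" unfolding V_eq using finPi by simp
  have BV: "B \<subseteq> V"
  proof
    fix b assume b: "b \<in> B"
    have "b = b [^] (1::int)" using BG[OF b] by simp
    then have "b \<in> ?cyc b" by blast
    then show "b \<in> V" unfolding V_def using subset_subgroup_join[OF B(2) b, of ?cyc] cyc BG by blast
  qed
  have surplus: "p ^ n * (\<Prod>x\<in>X. card (overlap U (x, True))) \<le> card U"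
    if U: "subgroup U G" "finite U" "B \<subseteq> U" for U
  proof -
    have UG: "U \<subseteq> carrier G" using U(1) subgroup.subset by blast
    obtain B' where B': "B' \<subseteq> U" "U \<subseteq> act_span B'"
      "p ^ card B' * (\<Prod>x\<in>X. card (overlap U (x, True))) \<le> card U"
      using few_generators[OF U(1,2)] by blast
    have B'G: "B' \<subseteq> carrier G" using B'(1) UG by blast
    have "carrier G \<subseteq> act_span B'"
      using act_span_mono_span[OF B'G, of B] B'(2) U(3) B(4) by blast
    then have "act_span B' = carrier G" using subgroup_act_span[OF B'G] subgroup.subset by blast
    then have "n \<le> card B'" using least B'G B'(1) U(2) finite_subset by blast
    then have "p ^ n \<le> p ^ card B'" using p0 by (intro power_increasing) auto
    then show ?thesis using B'(3) by (meson le_trans mult_le_mono1)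
  qed
  have "1 \<le> (\<Prod>x\<in>X. card (overlap V (x, True)))"
  proof -
    have "0 < card (overlap V (x, True))" if "x \<in> X" for x
    proof -
      have "\<one> \<in> overlap V (x, True)"
        using subgroup_overlap[OF _ V, of "(x, True)"] that subgroup.one_closed by blast
      moreover have "finite (overlap V (x, True))" using finV overlap_subset by (rule finite_subset[rotated])
      ultimately show ?thesis by (auto simp: card_gt_0_iff)
    qed
    then show ?thesis by (simp add: Suc_le_eq prod_pos)
  qed
  then have "p ^ n \<le> card V"
    using surplus[OF V finV BV] by (metis le_trans mult_le_mono2 mult_1_right)
  moreover have "card V \<le> p ^ n" unfolding V_eq using card_image_le[OF finPi] card_Pi by metis
  ultimately have cardV: "card V = p ^ n" by simp
  then have inj: "inj_on comb (B \<rightarrow>\<^sub>E {0..<int p})"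
    using V_eq card_Pi finPi by (intro eq_card_imp_inj_on) auto
  have comb_zero: "comb (\<lambda>_. 0) = \<one>" unfolding comb_def by simp
  have indep: "int p dvd c b" if "comb c = \<one>" "b \<in> B" for c b
  proof -
    have "comb (\<lambda>b\<in>B. c b mod int p) = \<one>"
      by (rule trans[OF comb_mod[of c, symmetric] that(1)])
    moreover have "comb (\<lambda>b\<in>B. 0 mod int p) = \<one>"
      by (rule trans[OF comb_mod[of "\<lambda>_. 0", symmetric] comb_zero])
    ultimately have "comb (\<lambda>b\<in>B. c b mod int p) = comb (\<lambda>b\<in>B. 0 mod int p)" by (simp only:)
    then have "(\<lambda>b\<in>B. c b mod int p) = (\<lambda>b\<in>B. 0 mod int p)"
      by (rule inj_onD[OF inj]) (use p0 in auto)
    then have "(\<lambda>b\<in>B. c b mod int p) b = (\<lambda>b\<in>B. 0 mod int p) b" by (simp only:)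
    then show ?thesis using that(2) by (simp add: dvd_eq_mod_eq_0)
  qed
  show ?thesis
  proof
    show "B \<subseteq> carrier G" "finite B" "act_span B = carrier G" using B by auto
    fix T c g b
    assume T: "finite T" "T \<subseteq> carrier F"
      and one: "finprod G (\<lambda>g. act g (finprod G (\<lambda>b. b [^] (c g b :: int)) B)) T = \<one>"
      and g: "g \<in> T" and b: "b \<in> B"
    obtain S where S: "connected_set S" "T \<subseteq> S" using finite_subset_connected_set[OF T] by blast
    have "independent_over V S"
    proof (rule independent_over_connected_set[OF V finV _ S(1)])
      fix U assume "subgroup U G" "finite U" "V \<subseteq> U"
      then show "card V * (\<Prod>x\<in>X. card (overlap U (x, True))) \<le> card U"
        using surplus[of U] BV cardV by simp
    qed
    then have "independent_over V T"
      using S connected_set_finite[OF S(1)] connected_set_closed[OF S(1)] V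
      by (intro independent_over_subset[of V S T])
    then have "comb (c g) = \<one>"
      using one g comb_V unfolding comb_def
      by (intro independent_overD[of V T "\<lambda>g. comb (c g)" g, unfolded comb_def]) auto
    then show "int p dvd c g b" using indep b by blast
  qed
qed

end


section \<open>Actions of free groups\<close>

definition acts_on :: "('f, 'h) monoid_scheme \<Rightarrow> ('f \<Rightarrow> 'q \<Rightarrow> 'q) \<Rightarrow> 'q set \<Rightarrow> bool"
  where "acts_on F \<alpha> Q \<longleftrightarrow> (\<forall>g\<in>carrier F. \<forall>q\<in>Q. \<alpha> g q \<in> Q) \<and> (\<forall>q\<in>Q. \<alpha> \<one>\<^bsub>F\<^esub> q = q) \<and>
    (\<forall>g\<in>carrier F. \<forall>h\<in>carrier F. \<forall>q\<in>Q. \<alpha> (g \<otimes>\<^bsub>F\<^esub> h) q = \<alpha> g (\<alpha> h q))"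

lemma acts_onD:
  assumes "acts_on F \<alpha> Q" "q \<in> Q"
  shows "g \<in> carrier F \<Longrightarrow> \<alpha> g q \<in> Q" "\<alpha> \<one>\<^bsub>F\<^esub> q = q"
    "\<lbrakk>g \<in> carrier F; h \<in> carrier F\<rbrakk> \<Longrightarrow> \<alpha> (g \<otimes>\<^bsub>F\<^esub> h) q = \<alpha> g (\<alpha> h q)"
  using assms by (auto simp: acts_on_def)

locale free_on = group F for F :: "('f, 'h) monoid_scheme" (structure) +
  fixes X :: "'f set"
  assumes basis_subset: "X \<subseteq> carrier F"
    and normal_form: "bij_betw (eval_word F) (reduced_words X) (carrier F)"
begin

lemma letter_value_closed: "fst l \<in> X \<Longrightarrow> letter_value F l \<in> carrier F"
  using basis_subset by (auto simp: letter_value_def)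

lemma eval_word_closed: "fst ` set w \<subseteq> X \<Longrightarrow> eval_word F w \<in> carrier F"
  by (induction w) (auto simp: letter_value_closed)

lemma words_exist:
  assumes "g \<in> carrier F"
  shows "\<exists>w. fst ` set w \<subseteq> X \<and> eval_word F w = g"
proof -
  have "g \<in> eval_word F ` reduced_words X" using assms normal_form by (simp add: bij_betw_def)
  then show ?thesis by (auto simp: reduced_words_def)
qed

lemma act_inv_cancel:
  assumes "acts_on F \<alpha> Q" "q \<in> Q" "g \<in> carrier F"
  shows "\<alpha> g (\<alpha> (inv g) q) = q" "\<alpha> (inv g) (\<alpha> g q) = q"
  using acts_onD(3)[OF assms(1,2), of g "inv g"] acts_onD(3)[OF assms(1,2), of "inv g" g]
    acts_onD(2)[OF assms(1,2)] assms(3) by simp_all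

text \<open>
  Equivariance under a letter passes to its inverse, and to products.
\<close>

lemma equivariant_if_on_basis:
  assumes \<alpha>: "acts_on F \<alpha> Q" and \<beta>: "acts_on F \<beta> R" and \<theta>: "\<And>q. q \<in> Q \<Longrightarrow> \<theta> q \<in> R"
    and basis: "\<And>x q. \<lbrakk>x \<in> X; q \<in> Q\<rbrakk> \<Longrightarrow> \<theta> (\<alpha> x q) = \<beta> x (\<theta> q)"
    and "g \<in> carrier F" "q \<in> Q"
  shows "\<theta> (\<alpha> g q) = \<beta> g (\<theta> q)"
proof -
  have letter: "\<theta> (\<alpha> (letter_value F l) q) = \<beta> (letter_value F l) (\<theta> q)" if l: "fst l \<in> X" and q: "q \<in> Q" for l q
  proof (cases "snd l")
    case True
    then show ?thesis using basis l q by (simp add: letter_value_def)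
  next
    case False
    have x: "fst l \<in> carrier F" using l basis_subset by blast
    let ?q = "\<alpha> (inv (fst l)) q"
    have q': "?q \<in> Q" using acts_onD(1)[OF \<alpha> q] x by simp
    have "\<theta> q = \<beta> (fst l) (\<theta> ?q)"
      using basis[OF l q'] act_inv_cancel(1)[OF \<alpha> q x] by simp
    then have "\<beta> (inv (fst l)) (\<theta> q) = \<theta> ?q"
      using act_inv_cancel(2)[OF \<beta> \<theta>[OF q'] x] by simp
    then show ?thesis using False by (simp add: letter_value_def)
  qed
  have "\<theta> (\<alpha> (eval_word F w) q) = \<beta> (eval_word F w) (\<theta> q)" if "fst ` set w \<subseteq> X" for w
    using that
  proof (induction w)
    case Nil
    show ?case
      using acts_onD(2)[OF \<alpha> \<open>q \<in> Q\<close>] acts_onD(2)[OF \<beta> \<theta>[OF \<open>q \<in> Q\<close>]] by simp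
  next
    case (Cons l w)
    have l: "letter_value F l \<in> carrier F" "fst l \<in> X" and w: "eval_word F w \<in> carrier F"
      using Cons.prems letter_value_closed eval_word_closed by auto
    have "\<theta> (\<alpha> (eval_word F (l # w)) q) = \<theta> (\<alpha> (letter_value F l) (\<alpha> (eval_word F w) q))"
      using acts_onD(3)[OF \<alpha> \<open>q \<in> Q\<close> l(1) w] by (simp only: eval_word_Cons)
    also have "\<dots> = \<beta> (letter_value F l) (\<theta> (\<alpha> (eval_word F w) q))"
      by (rule letter[OF l(2) acts_onD(1)[OF \<alpha> \<open>q \<in> Q\<close> w]])
    also have "\<theta> (\<alpha> (eval_word F w) q) = \<beta> (eval_word F w) (\<theta> q)"
      using Cons by simp
    also have "\<beta> (letter_value F l) \<dots> = \<beta> (eval_word F (l # w)) (\<theta> q)"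
      using acts_onD(3)[OF \<beta> \<theta>[OF \<open>q \<in> Q\<close>] l(1) w] by (simp only: eval_word_Cons)
    finally show ?case .
  qed
  then show ?thesis using words_exist[OF \<open>g \<in> carrier F\<close>] by blast
qed

text \<open>
  The universal property of a free group, for permutations of a set. An element acts through its
  normal form. That the action of a letter \<open>l\<close> is then composed correctly with the action of \<open>g\<close> is
  clear if \<open>l\<close> followed by the normal form of \<open>g\<close> is reduced; otherwise this normal form begins with
  the opposite of \<open>l\<close>, and the two permutations cancel.
\<close>

lemma extends_to_action:
  assumes \<sigma>: "\<And>x. x \<in> X \<Longrightarrow> bij_betw (\<sigma> x) Q Q"
  obtains \<alpha> where "acts_on F \<alpha> Q" "\<And>x q. \<lbrakk>x \<in> X; q \<in> Q\<rbrakk> \<Longrightarrow> \<alpha> x q = \<sigma> x q"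
proof -
  define \<tau> where "\<tau> = (\<lambda>l. if snd l then \<sigma> (fst l) else inv_into Q (\<sigma> (fst l)))"
  define nf where "nf = inv_into (reduced_words X) (eval_word F)"
  define \<alpha> where "\<alpha> = (\<lambda>g q. foldr \<tau> (nf g) q)"
  have \<tau>_closed: "\<tau> l q \<in> Q" if "fst l \<in> X" "q \<in> Q" for l q
    using bij_betw_apply[OF \<sigma>[OF that(1)] that(2)] bij_betw_apply[OF bij_betw_inv_into[OF \<sigma>[OF that(1)]] that(2)]
    by (simp add: \<tau>_def)
  have \<tau>_opposite: "\<tau> l (\<tau> (opposite l) q) = q" if "fst l \<in> X" "q \<in> Q" for l q
    using bij_betw_inv_into_left[OF \<sigma>[OF that(1)] that(2)] bij_betw_inv_into_right[OF \<sigma>[OF that(1)] that(2)]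
    by (simp add: \<tau>_def opposite_def)
  have nf: "nf g \<in> reduced_words X" "eval_word F (nf g) = g" if "g \<in> carrier F" for g
    using that normal_form unfolding nf_def by (auto simp: bij_betw_def inv_into_into f_inv_into_f)
  have nf_eval: "nf (eval_word F w) = w" if "w \<in> reduced_words X" for w
    using that normal_form unfolding nf_def by (simp add: bij_betw_def)
  have letters: "fst ` set w \<subseteq> X" if "w \<in> reduced_words X" for w
    using that by (simp add: reduced_words_def)
  have run_closed: "foldr \<tau> w q \<in> Q" if "fst ` set w \<subseteq> X" "q \<in> Q" for w q
    using that by (induction w) (auto intro: \<tau>_closed)
  have step: "\<alpha> (letter_value F l \<otimes> g) q = \<tau> l (\<alpha> g q)"
    if l: "fst l \<in> X" and g: "g \<in> carrier F" and q: "q \<in> Q" for l g q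
  proof (cases "\<exists>w. nf g = opposite l # w")
    case True
    then obtain w where w: "nf g = opposite l # w" by blast
    then have red: "w \<in> reduced_words X"
      using nf(1)[OF g] by (auto simp: reduced_words_def successively_Cons)
    have x: "fst l \<in> carrier F" using l basis_subset by blast
    have wF: "eval_word F w \<in> carrier F" using eval_word_closed letters red by blast
    have "letter_value F l \<otimes> g = letter_value F l \<otimes> (letter_value F (opposite l) \<otimes> eval_word F w)"
      using nf(2)[OF g] w by simp
    also have "\<dots> = eval_word F w"
      using x wF by (cases "snd l") (simp_all add: letter_value_def opposite_def m_assoc [symmetric])
    finally have "\<alpha> (letter_value F l \<otimes> g) q = foldr \<tau> w q"
      using nf_eval[OF red] by (simp add: \<alpha>_def)
    moreover have "\<alpha> g q = \<tau> (opposite l) (foldr \<tau> w q)" by (simp add: \<alpha>_def w)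
    ultimately show ?thesis
      using \<tau>_opposite[OF l run_closed[OF letters[OF red] q]] by simp
  next
    case False
    have "l # nf g \<in> reduced_words X"
    proof (cases "nf g")
      case Nil
      then show ?thesis using l by (simp add: reduced_words_def)
    next
      case (Cons l' w)
      then have "l' \<noteq> opposite l" using False by auto
      then have "\<not> (fst l = fst l' \<and> snd l \<noteq> snd l')" by (auto simp: opposite_def prod_eq_iff)
      then show ?thesis
        using nf(1)[OF g] l Cons by (auto simp: reduced_words_def successively_Cons split: prod.splits)
    qed
    then have "nf (letter_value F l \<otimes> g) = l # nf g"
      using nf_eval[of "l # nf g"] nf(2)[OF g] by simp
    then show ?thesis by (simp add: \<alpha>_def)
  qed
  have closed: "\<alpha> g q \<in> Q" if "g \<in> carrier F" "q \<in> Q" for g q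
    using that nf(1) letters run_closed by (simp add: \<alpha>_def)
  have word: "\<alpha> (eval_word F w \<otimes> h) q = foldr \<tau> w (\<alpha> h q)"
    if "fst ` set w \<subseteq> X" "h \<in> carrier F" "q \<in> Q" for w h q
    using that
  proof (induction w)
    case (Cons l w)
    then have "letter_value F l \<in> carrier F" "eval_word F w \<in> carrier F" "fst l \<in> X"
      using letter_value_closed eval_word_closed by auto
    then show ?case using Cons by (simp add: m_assoc step)
  qed simp
  have one: "\<alpha> \<one> q = q" for q
    using nf_eval[of "[]"] by (simp add: \<alpha>_def reduced_words_def)
  have "acts_on F \<alpha> Q"
    unfolding acts_on_def
  proof (intro conjI ballI)
    fix g h q assume "g \<in> carrier F" "h \<in> carrier F" "q \<in> Q"
    then show "\<alpha> (g \<otimes> h) q = \<alpha> g (\<alpha> h q)"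
      using word[of "nf g" h q] nf[of g] letters by (simp add: \<alpha>_def)
  qed (use closed one in auto)
  moreover have "\<alpha> x q = \<sigma> x q" if "x \<in> X" "q \<in> Q" for x q
    using step[of "(x, True)" \<one> q] that one basis_subset by (auto simp: letter_value_def \<tau>_def)
  ultimately show ?thesis using that by blast
qed

text \<open>
  Finitely many elements of \<open>F\<close> involve only finitely many basis elements. If \<open>x\<close> is another basis
  element, then \<open>F\<close> acts on the truth values such that \<open>x\<close> swaps them and all other basis elements
  fix them. The given elements act trivially and hence cannot generate \<open>x\<close>.
\<close>

lemma finite_basis:
  assumes "finite S" "S \<subseteq> carrier F" "generate F S = carrier F"
  shows "finite X"
proof -
  have "\<forall>s\<in>S. \<exists>w. fst ` set w \<subseteq> X \<and> eval_word F w = s" using words_exist assms(2) by blast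
  then obtain w where w: "\<And>s. s \<in> S \<Longrightarrow> fst ` set (w s) \<subseteq> X \<and> eval_word F (w s) = s" by metis
  define Y where "Y = (\<Union>s\<in>S. fst ` set (w s))"
  have "X \<subseteq> Y"
  proof
    fix x assume x: "x \<in> X"
    show "x \<in> Y"
    proof (rule ccontr)
      assume xY: "x \<notin> Y"
      have "bij_betw (if y = x then Not else id) UNIV UNIV" for y
        by (auto simp: bij_def inj_def surj_def)
      then obtain \<alpha> where \<alpha>: "acts_on F \<alpha> (UNIV :: bool set)"
        "\<And>y q. y \<in> X \<Longrightarrow> \<alpha> y q = (if y = x then Not else id) q"
        using extends_to_action[of "\<lambda>y. if y = x then Not else id" UNIV] by (metis UNIV_I)
      note \<alpha>D = acts_onD[OF \<alpha>(1) UNIV_I]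
      have trivial_inv: "\<alpha> (inv g) q = q" if "g \<in> carrier F" "\<And>q. \<alpha> g q = q" for g q
        using act_inv_cancel(2)[OF \<alpha>(1) UNIV_I that(1), of q] that(2) by simp
      have trivial_word: "\<alpha> (eval_word F v) q = q" if "fst ` set v \<subseteq> X - {x}" for v q
        using that
      proof (induction v arbitrary: q)
        case Nil
        then show ?case using \<alpha>D(2) by simp
      next
        case (Cons l v)
        have y: "fst l \<in> X" "fst l \<noteq> x" "fst l \<in> carrier F" using Cons.prems basis_subset by auto
        have "\<alpha> (fst l) q = q" for q using \<alpha>(2)[OF y(1)] y(2) by simp
        then have "\<alpha> (letter_value F l) q = q" for q
          using trivial_inv[OF y(3)] by (simp add: letter_value_def)
        moreover have "eval_word F v \<in> carrier F" using Cons.prems eval_word_closed by auto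
        ultimately show ?case using Cons \<alpha>D(3) letter_value_closed[OF y(1)] by simp
      qed
      have "\<alpha> g q = q" if "g \<in> generate F S" for g q
        using that
      proof (induction arbitrary: q rule: generate.induct)
        case one
        then show ?case by (rule \<alpha>D(2))
      next
        case (incl s)
        then have "fst ` set (w s) \<subseteq> X - {x}" using w xY by (auto simp: Y_def)
        then show ?case using trivial_word w[OF incl] by metis
      next
        case (inv s)
        then have "fst ` set (w s) \<subseteq> X - {x}" using w xY by (auto simp: Y_def)
        then have "\<alpha> s q = q" for q using trivial_word w[OF inv] by metis
        then show ?case using trivial_inv inv assms(2) by blast
      next
        case (eng g h)
        then show ?case using \<alpha>D(3) generate_in_carrier[OF assms(2)] by metis
      qed
      then have "\<alpha> x True = True" using x basis_subset assms(3) by blast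
      then show False using \<alpha>(2)[OF x] by simp
    qed
  qed
  moreover have "finite Y" using assms(1) by (simp add: Y_def)
  ultimately show ?thesis by (rule finite_subset)
qed

end

lemma free_groupE:
  assumes "free_group F"
  obtains X where "free_on F X"
  using assms unfolding free_group_def free_on_def free_on_axioms_def by blast


section \<open>The group algebra over the prime field\<close>

locale modular_group_algebra = group F for F :: "('f, 'h) monoid_scheme" (structure) +
  fixes p :: nat
  assumes prime_p: "prime p"
begin

abbreviation k :: "int ring" where "k \<equiv> residue_ring (int p)"
abbreviation kF :: "('f \<Rightarrow> int) ring" where "kF \<equiv> group_ring k F"
abbreviation M :: "('f \<Rightarrow> int, 'f set \<Rightarrow> 'f set \<Rightarrow> int) module"
  where "M \<equiv> completed_group_ring_module k F"
abbreviation supp :: "('f \<Rightarrow> int) \<Rightarrow> 'f set" where "supp a \<equiv> group_ring_support k F a"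
abbreviation \<N> :: "'f set set" where "\<N> \<equiv> finite_index_normals F"

lemma p_gt_1: "1 < int p"
  using prime_gt_1_nat[OF prime_p] by simp

lemma p_pos: "0 < int p"
  using p_gt_1 by linarith

lemma cring_k: "cring k"
  by (rule residues.cring, rule residues.intro, rule p_gt_1)

lemma carrier_k: "carrier k = {0..<int p}"
  by (auto simp: residue_ring_def)

lemma k_simps: "\<zero>\<^bsub>k\<^esub> = 0" "\<one>\<^bsub>k\<^esub> = 1" "x \<oplus>\<^bsub>k\<^esub> y = (x + y) mod int p" "x \<otimes>\<^bsub>k\<^esub> y = x * y mod int p"
  by (simp_all add: residue_ring_def)

lemma finsum_k:
  assumes "\<And>i. i \<in> A \<Longrightarrow> f i \<in> {0..<int p}"
  shows "finsum k f A = sum f A mod int p"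
proof -
  interpret k: cring k by (rule cring_k)
  show ?thesis using assms
  proof (induction A rule: infinite_finite_induct)
    case (infinite A)
    then show ?case by (simp add: k.add.finprod_infinite k_simps)
  next
    case empty
    then show ?case by (simp add: k_simps)
  next
    case (insert i A)
    have "f \<in> A \<rightarrow> carrier k" "f i \<in> carrier k"
      using insert.prems unfolding carrier_k by blast+
    then have "finsum k f (insert i A) = f i \<oplus>\<^bsub>k\<^esub> finsum k f A"
      using insert.hyps by (simp add: k.finsum_insert)
    then show ?case using insert by (simp add: k_simps mod_simps)
  qed
qed

lemma supp_eq: "supp a = {g \<in> carrier F. a g \<noteq> 0}"
  by (simp add: group_ring_support_def k_simps)

lemma carrier_kF: "carrier kF = {a \<in> carrier F \<rightarrow>\<^sub>E {0..<int p}. finite (supp a)}"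
  by (simp add: group_ring_def carrier_k)

lemma kF_range: "\<lbrakk>a \<in> carrier kF; g \<in> carrier F\<rbrakk> \<Longrightarrow> a g \<in> {0..<int p}"
  by (auto simp: carrier_kF)

lemma kF_finite_supp: "a \<in> carrier kF \<Longrightarrow> finite (supp a)"
  by (simp add: carrier_kF)

lemma kF_eqI:
  assumes "a \<in> carrier kF" "b \<in> carrier kF" "\<And>g. g \<in> carrier F \<Longrightarrow> [a g = b g] (mod int p)"
  shows "a = b"
proof (rule PiE_ext)
  show "a \<in> carrier F \<rightarrow>\<^sub>E {0..<int p}" "b \<in> carrier F \<rightarrow>\<^sub>E {0..<int p}"
    using assms(1,2) by (simp_all add: carrier_kF)
  fix g assume "g \<in> carrier F"
  then show "a g = b g"
    using assms(3) kF_range[OF assms(1)] kF_range[OF assms(2)] by (simp add: cong_def)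
qed

text \<open>
  The group algebra acts on arbitrary functions on \<open>F\<close>, and both its multiplication and its action on
  the completed group algebra are, modulo \<open>p\<close>, instances of this action. Hence associativity is
  needed only once, in the form of \<open>convolve_mult\<close>. The values are integers, without reduction, so
  that sums can be rearranged freely.
\<close>

definition convolve :: "('f \<Rightarrow> int) \<Rightarrow> ('f \<Rightarrow> int) \<Rightarrow> 'f \<Rightarrow> int"
  where "convolve a \<phi> x = (\<Sum>g\<in>supp a. a g * \<phi> (inv g \<otimes> x))"

lemma convolve_superset:
  assumes "finite T" "supp a \<subseteq> T" "T \<subseteq> carrier F"
  shows "convolve a \<phi> x = (\<Sum>g\<in>T. a g * \<phi> (inv g \<otimes> x))"
  unfolding convolve_def using assms by (intro sum.mono_neutral_left) (auto simp: supp_eq)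

lemma convolve_cong:
  assumes "\<And>y. y \<in> carrier F \<Longrightarrow> [\<phi> y = \<psi> y] (mod int p)" "x \<in> carrier F"
  shows "[convolve a \<phi> x = convolve a \<psi> x] (mod int p)"
  unfolding convolve_def using assms by (intro cong_sum cong_scalar_left) (auto simp: supp_eq)

lemma add_kF: "g \<in> carrier F \<Longrightarrow> (a \<oplus>\<^bsub>kF\<^esub> b) g = (a g + b g) mod int p"
  by (simp add: group_ring_def k_simps)

lemma mult_kF:
  assumes "a \<in> carrier kF" "b \<in> carrier kF" "x \<in> carrier F"
  shows "(a \<otimes>\<^bsub>kF\<^esub> b) x = convolve a b x mod int p"
proof -
  have "(a \<otimes>\<^bsub>kF\<^esub> b) x = finsum k (\<lambda>g. a g * b (inv g \<otimes> x) mod int p) (supp a)"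
    using assms(3) by (simp add: group_ring_def k_simps)
  also have "\<dots> = (\<Sum>g\<in>supp a. a g * b (inv g \<otimes> x) mod int p) mod int p"
    using p_pos by (intro finsum_k) auto
  finally show ?thesis by (simp add: convolve_def mod_sum_eq)
qed

lemma one_kF: "\<one>\<^bsub>kF\<^esub> = (\<lambda>x\<in>carrier F. if x = \<one> then 1 else 0)"
  unfolding group_ring_def k_simps by simp

lemma zero_kF: "\<zero>\<^bsub>kF\<^esub> = (\<lambda>x\<in>carrier F. 0)"
  by (simp add: group_ring_def k_simps)

definition single :: "int \<Rightarrow> 'f \<Rightarrow> 'f \<Rightarrow> int"
  where "single c g = (\<lambda>x\<in>carrier F. if x = g then c else 0)"

lemma supp_single: "supp (single c g) \<subseteq> {g}"
  by (auto simp: supp_eq single_def)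

lemma single_closed: "c \<in> {0..<int p} \<Longrightarrow> single c g \<in> carrier kF"
  using finite_subset[OF supp_single] p_pos by (auto simp: carrier_kF single_def)

lemma convolve_single: "g \<in> carrier F \<Longrightarrow> convolve (single c g) \<phi> x = c * \<phi> (inv g \<otimes> x)"
  using convolve_superset[of "{g}" "single c g"] supp_single by (simp add: single_def)

lemma one_kF_single: "\<one>\<^bsub>kF\<^esub> = single 1 \<one>"
  by (simp add: one_kF single_def)

lemma add_closed_kF:
  assumes "a \<in> carrier kF" "b \<in> carrier kF"
  shows "a \<oplus>\<^bsub>kF\<^esub> b \<in> carrier kF"
proof -
  have "supp (a \<oplus>\<^bsub>kF\<^esub> b) \<subseteq> supp a \<union> supp b"
    by (auto simp: supp_eq add_kF)
  then have "finite (supp (a \<oplus>\<^bsub>kF\<^esub> b))"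
    using assms kF_finite_supp by (meson finite_UnI finite_subset)
  moreover have "a \<oplus>\<^bsub>kF\<^esub> b \<in> carrier F \<rightarrow>\<^sub>E {0..<int p}"
    using p_pos by (auto simp: group_ring_def k_simps)
  ultimately show ?thesis by (simp add: carrier_kF)
qed

lemma supp_mult_kF:
  assumes "a \<in> carrier kF" "b \<in> carrier kF"
  shows "supp (a \<otimes>\<^bsub>kF\<^esub> b) \<subseteq> (\<lambda>(g, h). g \<otimes> h) ` (supp a \<times> supp b)"
proof
  fix x assume "x \<in> supp (a \<otimes>\<^bsub>kF\<^esub> b)"
  then have x: "x \<in> carrier F" "convolve a b x mod int p \<noteq> 0"
    using mult_kF[OF assms] by (auto simp: supp_eq)
  then have "convolve a b x \<noteq> 0" by auto
  then obtain g where g: "g \<in> supp a" "a g * b (inv g \<otimes> x) \<noteq> 0"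
    unfolding convolve_def by (meson sum.not_neutral_contains_not_neutral)
  then have "g \<in> carrier F" by (simp add: supp_eq)
  then have "x = g \<otimes> (inv g \<otimes> x)" "inv g \<otimes> x \<in> supp b"
    using g x(1) by (simp_all add: m_assoc [symmetric] supp_eq)
  then show "x \<in> (\<lambda>(g, h). g \<otimes> h) ` (supp a \<times> supp b)"
    using g(1) by (intro image_eqI[of _ _ "(g, inv g \<otimes> x)"]) auto
qed

lemma mult_closed_kF:
  assumes "a \<in> carrier kF" "b \<in> carrier kF"
  shows "a \<otimes>\<^bsub>kF\<^esub> b \<in> carrier kF"
proof -
  have "finite (supp (a \<otimes>\<^bsub>kF\<^esub> b))"
    using supp_mult_kF[OF assms] assms kF_finite_supp by (meson finite_SigmaI finite_imageI finite_subset)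
  moreover have "a \<otimes>\<^bsub>kF\<^esub> b \<in> carrier F \<rightarrow>\<^sub>E {0..<int p}"
  proof (rule PiE_I)
    show "(a \<otimes>\<^bsub>kF\<^esub> b) x \<in> {0..<int p}" if "x \<in> carrier F" for x
      using mult_kF[OF assms that] p_pos by simp
  qed (simp add: group_ring_def)
  ultimately show ?thesis by (simp add: carrier_kF)
qed

lemma convolve_add:
  assumes "a \<in> carrier kF" "b \<in> carrier kF" "x \<in> carrier F"
  shows "[convolve (a \<oplus>\<^bsub>kF\<^esub> b) \<phi> x = convolve a \<phi> x + convolve b \<phi> x] (mod int p)"
proof -
  let ?T = "supp a \<union> supp b"
  have fin: "finite ?T" "?T \<subseteq> carrier F" using assms kF_finite_supp by (auto simp: supp_eq)
  have "supp (a \<oplus>\<^bsub>kF\<^esub> b) \<subseteq> ?T" by (auto simp: supp_eq add_kF)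
  then have "convolve (a \<oplus>\<^bsub>kF\<^esub> b) \<phi> x = (\<Sum>g\<in>?T. (a \<oplus>\<^bsub>kF\<^esub> b) g * \<phi> (inv g \<otimes> x))"
    using fin by (intro convolve_superset)
  also have "[\<dots> = (\<Sum>g\<in>?T. (a g + b g) * \<phi> (inv g \<otimes> x))] (mod int p)"
    using fin by (intro cong_sum cong_scalar_right) (auto simp: add_kF cong_def subset_iff)
  also have "(\<Sum>g\<in>?T. (a g + b g) * \<phi> (inv g \<otimes> x)) = convolve a \<phi> x + convolve b \<phi> x"
    using fin convolve_superset[of ?T a] convolve_superset[of ?T b]
    by (simp add: distrib_right sum.distrib)
  finally show ?thesis .
qed

lemma convolve_mult:
  assumes "a \<in> carrier kF" "b \<in> carrier kF" "x \<in> carrier F"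
  shows "[convolve (a \<otimes>\<^bsub>kF\<^esub> b) \<phi> x = convolve a (convolve b \<phi>) x] (mod int p)"
proof -
  let ?T = "(\<lambda>(g, h). g \<otimes> h) ` (supp a \<times> supp b)"
  have T: "finite ?T" "?T \<subseteq> carrier F" using assms kF_finite_supp by (auto simp: supp_eq)
  have eq: "convolve (a \<otimes>\<^bsub>kF\<^esub> b) \<phi> x = (\<Sum>y\<in>?T. (a \<otimes>\<^bsub>kF\<^esub> b) y * \<phi> (inv y \<otimes> x))"
    using convolve_superset[OF T(1) supp_mult_kF[OF assms(1,2)] T(2)] .
  have 1: "[convolve (a \<otimes>\<^bsub>kF\<^esub> b) \<phi> x = (\<Sum>y\<in>?T. convolve a b y * \<phi> (inv y \<otimes> x))] (mod int p)"
    unfolding eq using T(2) mult_kF[OF assms(1,2)]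
    by (intro cong_sum cong_scalar_right) (auto simp: cong_def subset_iff simp del: split_paired_All)
  have "(\<Sum>y\<in>?T. convolve a b y * \<phi> (inv y \<otimes> x))
    = (\<Sum>g\<in>supp a. a g * (\<Sum>y\<in>?T. b (inv g \<otimes> y) * \<phi> (inv y \<otimes> x)))"
    unfolding convolve_def sum_distrib_right sum_distrib_left
    by (subst sum.swap) (simp add: mult.assoc)
  also have "\<dots> = convolve a (convolve b \<phi>) x"
    unfolding convolve_def[of a]
  proof (rule sum.cong[OF refl])
    fix g assume g: "g \<in> supp a"
    then have gF: "g \<in> carrier F" by (simp add: supp_eq)
    have "convolve b \<phi> (inv g \<otimes> x) = (\<Sum>h\<in>(\<lambda>y. inv g \<otimes> y) ` ?T. b h * \<phi> (inv h \<otimes> (inv g \<otimes> x)))"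
    proof (rule convolve_superset)
      show "finite ((\<lambda>y. inv g \<otimes> y) ` ?T)" using T(1) by simp
      show "(\<lambda>y. inv g \<otimes> y) ` ?T \<subseteq> carrier F" using T(2) gF by auto
      show "supp b \<subseteq> (\<lambda>y. inv g \<otimes> y) ` ?T"
      proof
        fix h assume h: "h \<in> supp b"
        then have "h \<in> carrier F" by (simp add: supp_eq)
        then have "h = inv g \<otimes> (g \<otimes> h)" using gF by (simp add: m_assoc [symmetric])
        moreover have "g \<otimes> h \<in> ?T" using g h by blast
        ultimately show "h \<in> (\<lambda>y. inv g \<otimes> y) ` ?T" by (rule image_eqI)
      qed
    qed
    also have "\<dots> = (\<Sum>y\<in>?T. b (inv g \<otimes> y) * \<phi> (inv (inv g \<otimes> y) \<otimes> (inv g \<otimes> x)))"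
      using T(2) gF by (subst sum.reindex) (auto simp: inj_on_def subset_iff simp del: split_paired_All)
    also have "\<dots> = (\<Sum>y\<in>?T. b (inv g \<otimes> y) * \<phi> (inv y \<otimes> x))"
    proof (rule sum.cong[OF refl])
      fix y assume "y \<in> ?T"
      then have "y \<in> carrier F" using T(2) by blast
      then have "inv (inv g \<otimes> y) \<otimes> (inv g \<otimes> x) = inv y \<otimes> x"
        using gF assms(3) by (simp add: inv_mult_group m_assoc) (simp add: m_assoc [symmetric])
      then show "b (inv g \<otimes> y) * \<phi> (inv (inv g \<otimes> y) \<otimes> (inv g \<otimes> x)) = b (inv g \<otimes> y) * \<phi> (inv y \<otimes> x)"
        by simp
    qed
    finally show "a g * (\<Sum>y\<in>?T. b (inv g \<otimes> y) * \<phi> (inv y \<otimes> x)) = a g * convolve b \<phi> (inv g \<otimes> x)"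
      by simp
  qed
  finally show ?thesis using 1 by simp
qed

lemma ring_kF: "ring kF"
proof (rule ringI)
  show "abelian_group kF"
  proof (rule abelian_groupI)
    show "\<zero>\<^bsub>kF\<^esub> \<in> carrier kF"
      using single_closed[of 0 undefined] p_pos by (simp add: zero_kF single_def)
    fix a b c assume a: "a \<in> carrier kF" and b: "b \<in> carrier kF" and c: "c \<in> carrier kF"
    show ab: "a \<oplus>\<^bsub>kF\<^esub> b \<in> carrier kF" using a b by (rule add_closed_kF)
    show "a \<oplus>\<^bsub>kF\<^esub> b \<oplus>\<^bsub>kF\<^esub> c = a \<oplus>\<^bsub>kF\<^esub> (b \<oplus>\<^bsub>kF\<^esub> c)"
      by (rule kF_eqI) (use a b c add_closed_kF in \<open>auto simp: add_kF cong_def mod_simps algebra_simps\<close>)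
    show "a \<oplus>\<^bsub>kF\<^esub> b = b \<oplus>\<^bsub>kF\<^esub> a"
      by (rule kF_eqI) (use a b add_closed_kF in \<open>auto simp: add_kF cong_def algebra_simps\<close>)
    show "\<zero>\<^bsub>kF\<^esub> \<oplus>\<^bsub>kF\<^esub> a = a"
      by (rule kF_eqI) (use a \<open>\<zero>\<^bsub>kF\<^esub> \<in> carrier kF\<close> add_closed_kF in \<open>auto simp: add_kF zero_kF cong_def\<close>)
    let ?n = "\<lambda>x\<in>carrier F. (- a x) mod int p"
    have "supp ?n \<subseteq> supp a" by (auto simp: supp_eq)
    then have n: "?n \<in> carrier kF"
      using kF_finite_supp[OF a] p_pos by (auto simp: carrier_kF intro: finite_subset)
    have "?n \<oplus>\<^bsub>kF\<^esub> a = \<zero>\<^bsub>kF\<^esub>"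
      by (rule kF_eqI) (use a n \<open>\<zero>\<^bsub>kF\<^esub> \<in> carrier kF\<close> add_closed_kF in \<open>auto simp: add_kF zero_kF cong_def mod_simps\<close>)
    then show "\<exists>y\<in>carrier kF. y \<oplus>\<^bsub>kF\<^esub> a = \<zero>\<^bsub>kF\<^esub>" using n by blast
  qed
  show "monoid kF"
  proof (rule monoidI)
    show one: "\<one>\<^bsub>kF\<^esub> \<in> carrier kF"
      unfolding one_kF_single using p_gt_1 by (intro single_closed) simp
    fix a b c assume a: "a \<in> carrier kF" and b: "b \<in> carrier kF" and c: "c \<in> carrier kF"
    show ab: "a \<otimes>\<^bsub>kF\<^esub> b \<in> carrier kF" using a b by (rule mult_closed_kF)
    have bc: "b \<otimes>\<^bsub>kF\<^esub> c \<in> carrier kF" using b c by (rule mult_closed_kF)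
    show "a \<otimes>\<^bsub>kF\<^esub> b \<otimes>\<^bsub>kF\<^esub> c = a \<otimes>\<^bsub>kF\<^esub> (b \<otimes>\<^bsub>kF\<^esub> c)"
    proof (rule kF_eqI)
      fix x assume x: "x \<in> carrier F"
      have "[(a \<otimes>\<^bsub>kF\<^esub> b \<otimes>\<^bsub>kF\<^esub> c) x = convolve (a \<otimes>\<^bsub>kF\<^esub> b) c x] (mod int p)"
        using mult_kF[OF ab c x] by (simp add: cong_def)
      also have "[convolve (a \<otimes>\<^bsub>kF\<^esub> b) c x = convolve a (convolve b c) x] (mod int p)"
        by (rule convolve_mult[OF a b x])
      also have "[convolve a (convolve b c) x = convolve a (b \<otimes>\<^bsub>kF\<^esub> c) x] (mod int p)"
        using mult_kF[OF b c] x by (intro convolve_cong) (simp_all add: cong_def)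
      also have "[convolve a (b \<otimes>\<^bsub>kF\<^esub> c) x = (a \<otimes>\<^bsub>kF\<^esub> (b \<otimes>\<^bsub>kF\<^esub> c)) x] (mod int p)"
        using mult_kF[OF a bc x] by (simp add: cong_def)
      finally show "[(a \<otimes>\<^bsub>kF\<^esub> b \<otimes>\<^bsub>kF\<^esub> c) x = (a \<otimes>\<^bsub>kF\<^esub> (b \<otimes>\<^bsub>kF\<^esub> c)) x] (mod int p)" .
    qed (use a b c ab bc mult_closed_kF in auto)
    show "\<one>\<^bsub>kF\<^esub> \<otimes>\<^bsub>kF\<^esub> a = a"
    proof (rule kF_eqI)
      show "[(\<one>\<^bsub>kF\<^esub> \<otimes>\<^bsub>kF\<^esub> a) x = a x] (mod int p)" if "x \<in> carrier F" for x
        using mult_kF[OF one a that] convolve_single[of \<one> 1 a x] that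
        by (simp add: one_kF_single cong_def)
    qed (use a one mult_closed_kF in auto)
    show "a \<otimes>\<^bsub>kF\<^esub> \<one>\<^bsub>kF\<^esub> = a"
    proof (rule kF_eqI)
      fix x assume x: "x \<in> carrier F"
      have "convolve a \<one>\<^bsub>kF\<^esub> x = (\<Sum>g\<in>supp a. if g = x then a g else 0)"
        unfolding convolve_def
      proof (rule sum.cong[OF refl])
        fix g assume "g \<in> supp a"
        then have g: "g \<in> carrier F" by (simp add: supp_eq)
        have "inv g \<otimes> x = \<one> \<longleftrightarrow> g = x"
          using g x by (metis inv_equality inv_inv inv_closed l_inv)
        then show "a g * \<one>\<^bsub>kF\<^esub> (inv g \<otimes> x) = (if g = x then a g else 0)"
          using g x by (simp add: one_kF)
      qed
      also have "\<dots> = a x" using kF_finite_supp[OF a] x by (simp add: supp_eq)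
      finally show "[(a \<otimes>\<^bsub>kF\<^esub> \<one>\<^bsub>kF\<^esub>) x = a x] (mod int p)"
        using mult_kF[OF a one x] by (simp add: cong_def)
    qed (use a one mult_closed_kF in auto)
  qed
  fix a b c assume a: "a \<in> carrier kF" and b: "b \<in> carrier kF" and c: "c \<in> carrier kF"
  show "(a \<oplus>\<^bsub>kF\<^esub> b) \<otimes>\<^bsub>kF\<^esub> c = a \<otimes>\<^bsub>kF\<^esub> c \<oplus>\<^bsub>kF\<^esub> b \<otimes>\<^bsub>kF\<^esub> c"
  proof (rule kF_eqI)
    fix x assume x: "x \<in> carrier F"
    show "[((a \<oplus>\<^bsub>kF\<^esub> b) \<otimes>\<^bsub>kF\<^esub> c) x = (a \<otimes>\<^bsub>kF\<^esub> c \<oplus>\<^bsub>kF\<^esub> b \<otimes>\<^bsub>kF\<^esub> c) x] (mod int p)"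
      using convolve_add[OF a b x, of c] mult_kF[OF add_closed_kF[OF a b] c x] mult_kF[OF a c x]
        mult_kF[OF b c x] x by (simp add: add_kF cong_def mod_simps)
  qed (use a b c mult_closed_kF add_closed_kF in auto)
  show "c \<otimes>\<^bsub>kF\<^esub> (a \<oplus>\<^bsub>kF\<^esub> b) = c \<otimes>\<^bsub>kF\<^esub> a \<oplus>\<^bsub>kF\<^esub> c \<otimes>\<^bsub>kF\<^esub> b"
  proof (rule kF_eqI)
    fix x assume x: "x \<in> carrier F"
    have "[convolve c (a \<oplus>\<^bsub>kF\<^esub> b) x = convolve c (\<lambda>g. a g + b g) x] (mod int p)"
      using x by (intro convolve_cong) (simp_all add: add_kF cong_def)
    also have "convolve c (\<lambda>g. a g + b g) x = convolve c a x + convolve c b x"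
      by (simp add: convolve_def distrib_left sum.distrib)
    finally show "[(c \<otimes>\<^bsub>kF\<^esub> (a \<oplus>\<^bsub>kF\<^esub> b)) x = (c \<otimes>\<^bsub>kF\<^esub> a \<oplus>\<^bsub>kF\<^esub> c \<otimes>\<^bsub>kF\<^esub> b) x] (mod int p)"
      using mult_kF[OF c add_closed_kF[OF a b] x] mult_kF[OF c a x] mult_kF[OF c b x] x
      by (simp add: add_kF cong_def mod_simps)
  qed (use a b c mult_closed_kF add_closed_kF in auto)
qed


section \<open>Coordinates on the completed group algebra\<close>

text \<open>
  An element of the completed group algebra is determined by the functions on \<open>F\<close> that its
  components induce; in these coordinates \<open>F\<close> acts by translation of functions, whatever the level.
\<close>

definition coord :: "('f set \<Rightarrow> 'f set \<Rightarrow> int) \<Rightarrow> 'f set \<Rightarrow> 'f \<Rightarrow> int"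
  where "coord y N h = y N (N #> h)"

lemma \<N>_normal: "N \<in> \<N> \<Longrightarrow> N \<lhd> F"
  by (simp add: finite_index_normals_def)

lemma \<N>_subgroup: "N \<in> \<N> \<Longrightarrow> subgroup N F"
  using \<N>_normal normal_imp_subgroup by blast

lemma \<N>_finite: "N \<in> \<N> \<Longrightarrow> finite (rcosets N)"
  by (simp add: finite_index_normals_def)

lemma \<N>_subset: "N \<in> \<N> \<Longrightarrow> N \<subseteq> carrier F"
  using \<N>_subgroup subgroup.subset by blast

lemma carrier_Mod: "carrier (F Mod N) = rcosets N"
  by (simp add: FactGroup_def)

lemma coset_in_rcosets: "\<lbrakk>N \<in> \<N>; h \<in> carrier F\<rbrakk> \<Longrightarrow> N #> h \<in> rcosets N"
  using rcosetsI \<N>_subset by blast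

lemma rcosetsE:
  assumes "C \<in> rcosets N"
  obtains h where "h \<in> carrier F" "C = N #> h"
  using assms by (auto simp: RCOSETS_def)

lemma carrier_M:
  "carrier M = {x \<in> \<Pi>\<^sub>E N\<in>\<N>. carrier (group_ring k (F Mod N)).
     \<forall>N\<in>\<N>. \<forall>N'\<in>\<N>. N \<subseteq> N' \<longrightarrow>
       group_ring_map k (F Mod N) (F Mod N') (\<lambda>C. N' <#> C) (x N) = x N'}"
  by (simp add: completed_group_ring_module_def completed_group_ring_def)

lemma M_range:
  assumes "y \<in> carrier M" "N \<in> \<N>" "C \<in> rcosets N"
  shows "y N C \<in> {0..<int p}"
proof -
  have "y N \<in> carrier (group_ring k (F Mod N))" using assms(1,2) by (auto simp: carrier_M)
  then show ?thesis using assms(3) by (auto simp: group_ring_def carrier_k carrier_Mod)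
qed

lemma coord_range: "\<lbrakk>y \<in> carrier M; N \<in> \<N>; h \<in> carrier F\<rbrakk> \<Longrightarrow> coord y N h \<in> {0..<int p}"
  unfolding coord_def by (intro M_range coset_in_rcosets)

lemma M_eqI:
  assumes "y \<in> carrier M" "z \<in> carrier M"
    and "\<And>N h. \<lbrakk>N \<in> \<N>; h \<in> carrier F\<rbrakk> \<Longrightarrow> [coord y N h = coord z N h] (mod int p)"
  shows "y = z"
proof (rule PiE_ext)
  show y: "y \<in> (\<Pi>\<^sub>E N\<in>\<N>. carrier (group_ring k (F Mod N)))"
    and z: "z \<in> (\<Pi>\<^sub>E N\<in>\<N>. carrier (group_ring k (F Mod N)))"
    using assms(1,2) by (simp_all add: carrier_M)
  fix N assume N: "N \<in> \<N>"
  show "y N = z N"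
  proof (rule PiE_ext)
    show "y N \<in> rcosets N \<rightarrow>\<^sub>E carrier k" "z N \<in> rcosets N \<rightarrow>\<^sub>E carrier k"
      using PiE_mem[OF y N] PiE_mem[OF z N] by (simp_all add: group_ring_def carrier_Mod)
    fix C assume C: "C \<in> rcosets N"
    then obtain h where h: "h \<in> carrier F" "C = N #> h" by (rule rcosetsE)
    show "y N C = z N C"
      using assms(3)[OF N h(1)] M_range[OF assms(1) N C] M_range[OF assms(2) N C]
      by (simp add: coord_def h(2) cong_def)
  qed
qed

lemma sum_support:
  assumes "finite A" "B \<subseteq> A" "\<And>i. i \<in> A - B \<Longrightarrow> f i = (0::int)"
  shows "sum f B = sum f A"
  using assms by (intro sum.mono_neutral_left) auto

lemma coord_compatible:
  assumes "y \<in> carrier M" "N' \<in> \<N>" "N \<in> \<N>" "N' \<subseteq> N" "h \<in> carrier F"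
  shows "coord y N h = (\<Sum>C | C \<in> rcosets N' \<and> N <#> C = N #> h. y N' C) mod int p"
proof -
  let ?S = "group_ring_support k (F Mod N') (y N')"
  have S: "?S = {C \<in> rcosets N'. y N' C \<noteq> 0}"
    by (simp add: group_ring_support_def carrier_Mod k_simps)
  have "y N = group_ring_map k (F Mod N') (F Mod N) (\<lambda>C. N <#> C) (y N')"
    using assms(1-4) by (simp add: carrier_M)
  then have "coord y N h = finsum k (y N') {C \<in> ?S. N <#> C = N #> h}"
    using coset_in_rcosets[OF assms(3,5)]
    by (simp add: coord_def group_ring_map_def carrier_Mod)
  also have "\<dots> = sum (y N') {C \<in> ?S. N <#> C = N #> h} mod int p"
    using M_range[OF assms(1,2)] by (intro finsum_k) (simp add: S)
  also have "sum (y N') {C \<in> ?S. N <#> C = N #> h} = sum (y N') {C \<in> rcosets N'. N <#> C = N #> h}"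
    using \<N>_finite[OF assms(2)] by (intro sum_support) (auto simp: S)
  finally show ?thesis by simp
qed

lemma coord_add:
  assumes "N \<in> \<N>" "h \<in> carrier F"
  shows "coord (y \<oplus>\<^bsub>M\<^esub> z) N h = (coord y N h + coord z N h) mod int p"
  using assms coset_in_rcosets[OF assms]
  by (simp add: coord_def completed_group_ring_module_def completed_group_ring_def group_ring_def
      carrier_Mod k_simps)

lemma coord_zero:
  assumes "N \<in> \<N>" "h \<in> carrier F"
  shows "coord \<zero>\<^bsub>M\<^esub> N h = 0"
  using assms coset_in_rcosets[OF assms]
  by (simp add: coord_def completed_group_ring_module_def completed_group_ring_def group_ring_def
      carrier_Mod k_simps)

lemma coord_smult:
  assumes a: "a \<in> carrier kF" and y: "y \<in> carrier M" and N: "N \<in> \<N>" and h: "h \<in> carrier F"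
  shows "coord (a \<odot>\<^bsub>M\<^esub> y) N h = convolve a (coord y N) h mod int p"
proof -
  interpret N: normal N F using \<N>_normal[OF N] .
  define b where "b = group_ring_map k F (F Mod N) (\<lambda>g. N #> g) a"
  have range_a: "a g \<in> {0..<int p}" if "g \<in> supp a" for g
    using kF_range[OF a] that by (auto simp: supp_eq)
  have b: "b D = (\<Sum>g | g \<in> supp a \<and> N #> g = D. a g) mod int p" if "D \<in> rcosets N" for D
  proof -
    have "finsum k a {g \<in> supp a. N #> g = D} = sum a {g \<in> supp a. N #> g = D} mod int p"
      using range_a by (intro finsum_k) blast
    then show ?thesis using that by (simp add: b_def group_ring_map_def carrier_Mod)
  qed
  have S: "group_ring_support k (F Mod N) b \<subseteq> rcosets N"
    by (auto simp: group_ring_support_def carrier_Mod)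
  have "coord (a \<odot>\<^bsub>M\<^esub> y) N h = (b \<otimes>\<^bsub>group_ring k (F Mod N)\<^esub> y N) (N #> h)"
    using N by (simp add: coord_def completed_group_ring_module_def completed_group_ring_def
        completion_map_def b_def)
  also have "\<dots> = finsum k (\<lambda>D. b D * y N (inv\<^bsub>F Mod N\<^esub> D <#> (N #> h)) mod int p)
      (group_ring_support k (F Mod N) b)"
    using coset_in_rcosets[OF N h] by (simp add: group_ring_def carrier_Mod k_simps)
  also have "\<dots> = (\<Sum>D\<in>group_ring_support k (F Mod N) b.
      b D * y N (inv\<^bsub>F Mod N\<^esub> D <#> (N #> h)) mod int p) mod int p"
    using p_pos by (intro finsum_k) simp
  also have "\<dots> = (\<Sum>D\<in>group_ring_support k (F Mod N) b.
      b D * y N (inv\<^bsub>F Mod N\<^esub> D <#> (N #> h))) mod int p"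
    by (rule mod_sum_eq)
  also have "(\<Sum>D\<in>group_ring_support k (F Mod N) b. b D * y N (inv\<^bsub>F Mod N\<^esub> D <#> (N #> h)))
    = (\<Sum>D\<in>rcosets N. b D * y N (inv\<^bsub>F Mod N\<^esub> D <#> (N #> h)))"
    using \<N>_finite[OF N] S
    by (intro sum_support) (auto simp: group_ring_support_def carrier_Mod k_simps)
  also have "\<dots> mod int p = (\<Sum>D\<in>rcosets N. (\<Sum>g | g \<in> supp a \<and> N #> g = D. a g)
      * y N (inv\<^bsub>F Mod N\<^esub> D <#> (N #> h))) mod int p"
    unfolding cong_def [symmetric]
    by (intro cong_sum cong_scalar_right) (simp add: b cong_def)
  also have "(\<Sum>D\<in>rcosets N. (\<Sum>g | g \<in> supp a \<and> N #> g = D. a g)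
      * y N (inv\<^bsub>F Mod N\<^esub> D <#> (N #> h)))
    = (\<Sum>D\<in>rcosets N. (\<Sum>g | g \<in> supp a \<and> N #> g = D. a g * coord y N (inv g \<otimes> h)))"
    unfolding sum_distrib_right
  proof (intro sum.cong refl)
    fix D g assume g: "g \<in> {g. g \<in> supp a \<and> N #> g = D}"
    then have gF: "g \<in> carrier F" by (simp add: supp_eq)
    have "inv\<^bsub>F Mod N\<^esub> D = N #> inv g"
      using g gF N.inv_FactGroup[of D] coset_in_rcosets[OF N gF] N.rcos_inv[OF gF]
      by (auto simp: carrier_Mod)
    then have "inv\<^bsub>F Mod N\<^esub> D <#> (N #> h) = N #> (inv g \<otimes> h)"
      using gF h by (simp add: N.rcos_sum)
    then show "a g * y N (inv\<^bsub>F Mod N\<^esub> D <#> (N #> h)) = a g * coord y N (inv g \<otimes> h)"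
      by (simp add: coord_def)
  qed
  also have "\<dots> = convolve a (coord y N) h"
    unfolding convolve_def using kF_finite_supp[OF a] \<N>_finite[OF N] coset_in_rcosets[OF N]
    by (intro sum.group) (auto simp: supp_eq)
  finally show ?thesis .
qed

end


section \<open>Acyclicity of the completed group algebra\<close>

locale modular_free_group_algebra = modular_group_algebra F p + free_on F X
  for F :: "('f, 'h) monoid_scheme" (structure) and p :: nat and X :: "'f set" +
  assumes finite_basis_X: "finite X"
begin

abbreviation translate_coset :: "'f \<Rightarrow> 'f set \<Rightarrow> 'f set"  (infixr "\<star>" 75)
  where "g \<star> C \<equiv> l_coset F g C"

lemma l_coset_r_coset:
  assumes "N \<lhd> F" "g \<in> carrier F" "h \<in> carrier F"
  shows "g \<star> (N #> h) = N #> (g \<otimes> h)"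
proof -
  interpret N: normal N F by (rule assms(1))
  have "g \<star> (N #> h) = g \<star> N #> h"
    using assms(2,3) N.subset by (simp add: rcos_assoc_lcos coset_assoc)
  also have "g \<star> N = N #> g" using N.coset_eq assms(2) by simp
  also have "N #> g #> h = N #> (g \<otimes> h)" using assms(2,3) N.subset by (simp add: coset_mult_assoc)
  finally show ?thesis .
qed

lemma acts_on_rcosets:
  assumes "N \<lhd> F"
  shows "acts_on F (\<lambda>g C. g \<star> C) (rcosets N)"
proof -
  interpret N: normal N F by (rule assms)
  show ?thesis
    unfolding acts_on_def
    by (auto elim!: rcosetsE simp: l_coset_r_coset[OF assms] m_assoc intro!: rcosetsI N.subset)
qed

text \<open>
  The coset of \<open>g\<close> is determined by the permutation of \<open>Q\<close> by which \<open>g\<close> acts.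
\<close>

lemma finite_index_kernel:
  assumes \<alpha>: "acts_on F \<alpha> Q" and Q: "finite Q"
  defines "N \<equiv> {n \<in> carrier F. \<forall>q\<in>Q. \<alpha> n q = q}"
  shows "N \<in> \<N>"
proof -
  note \<alpha>D = acts_onD[OF \<alpha>]
  have sub: "subgroup N F"
  proof (rule subgroupI)
    have "\<one> \<in> N" using \<alpha>D(2) by (simp add: N_def)
    then show "N \<noteq> {}" by blast
    fix a assume a: "a \<in> N"
    then show "inv a \<in> N" using act_inv_cancel(2)[OF \<alpha>] by (simp add: N_def) metis
    fix b assume "b \<in> N"
    then show "a \<otimes> b \<in> N" using a \<alpha>D by (simp add: N_def)
  qed (simp add: N_def)
  have "N \<lhd> F"
    unfolding normal_inv_iff
  proof (intro conjI ballI sub)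
    fix x n assume x: "x \<in> carrier F" and n: "n \<in> N"
    have "\<alpha> (x \<otimes> n \<otimes> inv x) q = q" if q: "q \<in> Q" for q
    proof -
      have q': "\<alpha> (inv x) q \<in> Q" using \<alpha>D(1)[OF q] x by simp
      have "\<alpha> (x \<otimes> n \<otimes> inv x) q = \<alpha> x (\<alpha> n (\<alpha> (inv x) q))"
        using \<alpha>D(3)[OF q] \<alpha>D(3)[OF q'] x n by (simp add: N_def)
      also have "\<dots> = q" using n q' act_inv_cancel(1)[OF \<alpha> q x] by (simp add: N_def)
      finally show ?thesis .
    qed
    then show "x \<otimes> n \<otimes> inv x \<in> N" using x n by (simp add: N_def)
  qed
  moreover have "finite (rcosets N)"
  proof -
    let ?r = "\<lambda>g. restrict (\<alpha> g) Q"
    have same: "N #> g = N #> h" if g: "g \<in> carrier F" and h: "h \<in> carrier F" and eq: "?r g = ?r h" for g h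
    proof -
      have "\<alpha> (h \<otimes> inv g) q = q" if q: "q \<in> Q" for q
      proof -
        have q': "\<alpha> (inv g) q \<in> Q" using \<alpha>D(1)[OF q] g by simp
        have "\<alpha> (h \<otimes> inv g) q = \<alpha> h (\<alpha> (inv g) q)" using \<alpha>D(3)[OF q] g h by simp
        also have "\<dots> = \<alpha> g (\<alpha> (inv g) q)" using fun_cong[OF eq, of "\<alpha> (inv g) q"] q' by simp
        finally show ?thesis using act_inv_cancel(1)[OF \<alpha> q g] by simp
      qed
      then have "h \<otimes> inv g \<in> N" using g h by (simp add: N_def)
      then have "h \<in> N #> g" using subgroup.rcos_module_rev[OF sub is_group g h] by simp
      then show ?thesis using repr_independence[OF _ g sub] by simp
    qed
    have "rcosets N = (\<lambda>y. N #> inv_into (carrier F) ?r y) ` ?r ` carrier F"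
    proof -
      have "N #> g = N #> inv_into (carrier F) ?r (?r g)" if "g \<in> carrier F" for g
      proof (rule same[OF that])
        show "inv_into (carrier F) ?r (?r g) \<in> carrier F" using that by (intro inv_into_into) blast
        show "?r g = ?r (inv_into (carrier F) ?r (?r g))"
          using that by (intro f_inv_into_f[symmetric]) blast
      qed
      then show ?thesis unfolding RCOSETS_def image_image by auto
    qed
    moreover have "?r ` carrier F \<subseteq> (Q \<rightarrow>\<^sub>E Q)" using \<alpha>D(1) by auto
    then have "finite (?r ` carrier F)" using Q by (meson finite_PiE finite_subset)
    ultimately show ?thesis by simp
  qed
  ultimately show ?thesis by (simp add: finite_index_normals_def)
qed

text \<open>
  The covering of the Cayley graph is \<open>Q\<close>: a vertex consists of a point of \<open>K\<close>, a coset of \<open>N\<close> and a sheet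
  \<open>t\<close> modulo \<open>p\<close>, and the letter \<open>x\<close> changes the sheet only on the edge (\<open>hit\<close>) at which the value of the
  cycle is to be computed. Since \<open>F\<close> is free, this defines an action, and all its orbit maps factor
  through \<open>F/N'\<close> for the kernel \<open>N'\<close>. For a coset \<open>C\<close> of \<open>N'\<close> and a base point \<open>r\<close> in \<open>K\<close>, let \<open>pos C r\<close> be
  the point to which \<open>C\<close> moves \<open>r\<close>, let \<open>f C r\<close> be the sheet reached from sheet 0, and let \<open>D x C r\<close> be
  the value at \<open>C\<close> of the cycle at level \<open>N'\<close>, untwisted along \<open>pos\<close>. Summation by parts of \<open>f\<close> against
  the cycle condition for \<open>D\<close> gives, modulo \<open>p\<close>, that the sum of \<open>D\<close> over all edges above the chosen
  one is zero. Each coset of \<open>N'\<close> moves exactly one \<open>r\<close> to \<open>r0\<close>, so by compatibility this sum is the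
  coordinate at level \<open>N\<close>.
\<close>

theorem coord_acyclic:
  assumes K: "finite K" and \<sigma>: "\<And>x. x \<in> X \<Longrightarrow> bij_betw (\<sigma> x) K K"
    and u: "\<And>x r. \<lbrakk>x \<in> X; r \<in> K\<rbrakk> \<Longrightarrow> u x r \<in> carrier M"
    and cycle: "\<And>r N h. \<lbrakk>r \<in> K; N \<in> \<N>; h \<in> carrier F\<rbrakk> \<Longrightarrow>
      [(\<Sum>x\<in>X. coord (u x r) N h) = (\<Sum>x\<in>X. coord (u x (\<sigma> x r)) N (x \<otimes> h))] (mod int p)"
    and x0: "x0 \<in> X" and r0: "r0 \<in> K" and N: "N \<in> \<N>" and h0: "h0 \<in> carrier F"
  shows "coord (u x0 r0) N h0 = 0"
proof -
  have XF: "x \<in> carrier F" if "x \<in> X" for x using that basis_subset by blast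
  interpret N: normal N F using \<N>_normal[OF N] .
  note cosN = acts_on_rcosets[OF N.normal_axioms]
  obtain \<beta> where \<beta>: "acts_on F \<beta> K" "\<And>x r. \<lbrakk>x \<in> X; r \<in> K\<rbrakk> \<Longrightarrow> \<beta> x r = \<sigma> x r"
    using extends_to_action[of \<sigma> K, OF \<sigma>] by blast
  define hit where "hit x r C \<longleftrightarrow> x = x0 \<and> r = r0 \<and> C = N #> h0" for x r C
  define Q where "Q = K \<times> (rcosets N) \<times> {0..<int p}"
  define \<tau> where "\<tau> = (\<lambda>x (r, C, t). (\<sigma> x r, x \<star> C, (t + of_bool (hit x (\<sigma> x r) (x \<star> C))) mod int p))"
  have finQ: "finite Q" using K \<N>_finite[OF N] by (simp add: Q_def)
  have "bij_betw (\<tau> x) Q Q" if x: "x \<in> X" for x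
  proof -
    have closed: "\<tau> x q \<in> Q" if "q \<in> Q" for q
      using that bij_betw_apply[OF \<sigma>[OF x]] acts_onD(1)[OF cosN _ XF[OF x]] p_pos
      by (auto simp: Q_def \<tau>_def)
    have "inj_on (\<tau> x) Q"
    proof (rule inj_onI)
      fix q q' assume q: "q \<in> Q" "q' \<in> Q" "\<tau> x q = \<tau> x q'"
      obtain r C t where q1: "q = (r, C, t)" by (cases q)
      obtain r' C' t' where q2: "q' = (r', C', t')" by (cases q')
      have "\<sigma> x r = \<sigma> x r'" and xC: "x \<star> C = x \<star> C'"
        and t: "(t + of_bool (hit x (\<sigma> x r) (x \<star> C))) mod int p
          = (t' + of_bool (hit x (\<sigma> x r') (x \<star> C'))) mod int p"
        using q(3) unfolding q1 q2 \<tau>_def prod.case prod.inject by blast+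
      then have "r = r'"
        using q(1,2) bij_betw_imp_inj_on[OF \<sigma>[OF x]] by (auto simp: q1 q2 Q_def dest: inj_onD)
      moreover have "C = C'"
      proof -
        have "inv x \<star> (x \<star> C) = C" "inv x \<star> (x \<star> C') = C'"
          using q(1,2) by (auto simp: q1 q2 Q_def intro!: act_inv_cancel(2)[OF cosN _ XF[OF x]])
        then show ?thesis using xC by metis
      qed
      moreover have "t = t'"
      proof -
        have "[t + of_bool (hit x (\<sigma> x r) (x \<star> C)) = t' + of_bool (hit x (\<sigma> x r) (x \<star> C))] (mod int p)"
          using t calculation by (simp add: cong_def)
        then have "[t = t'] (mod int p)" by (simp add: cong_add_rcancel)
        then show ?thesis using q(1,2) by (simp add: q1 q2 Q_def cong_def)
      qed
      ultimately show "q = q'" by (simp add: q1 q2)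
    qed
    moreover from this have "\<tau> x ` Q = Q" using closed by (intro endo_inj_surj[OF finQ]) auto
    ultimately show ?thesis unfolding bij_betw_def by blast
  qed
  then obtain \<alpha> where \<alpha>: "acts_on F \<alpha> Q" "\<And>x q. \<lbrakk>x \<in> X; q \<in> Q\<rbrakk> \<Longrightarrow> \<alpha> x q = \<tau> x q"
    using extends_to_action[of \<tau> Q] by blast
  note \<alpha>D = acts_onD[OF \<alpha>(1)]
  have fst_\<alpha>: "fst (\<alpha> g q) = \<beta> g (fst q)" if "g \<in> carrier F" "q \<in> Q" for g q
    using equivariant_if_on_basis[OF \<alpha>(1) \<beta>(1), of fst] that \<alpha>(2) \<beta>(2)
    by (auto simp: Q_def \<tau>_def)
  have coset_\<alpha>: "fst (snd (\<alpha> g q)) = g \<star> fst (snd q)" if "g \<in> carrier F" "q \<in> Q" for g q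
    using equivariant_if_on_basis[OF \<alpha>(1) cosN, of "\<lambda>q. fst (snd q)"] that \<alpha>(2)
    by (auto simp: Q_def \<tau>_def)
  define N' where "N' = {n \<in> carrier F. \<forall>q\<in>Q. \<alpha> n q = q}"
  have N': "N' \<in> \<N>" unfolding N'_def by (rule finite_index_kernel[OF \<alpha>(1) finQ])
  interpret N': normal N' F using \<N>_normal[OF N'] .
  note cosN' = acts_on_rcosets[OF N'.normal_axioms]
  have finN': "finite (rcosets N')" using \<N>_finite[OF N'] .
  have base: "(r, N, 0) \<in> Q" if "r \<in> K" for r
    using that p_pos N.subgroup_in_rcosets[OF is_group] by (simp add: Q_def)
  \<comment> \<open>An element of the kernel fixes the coset \<open>N\<close>, which is a component of a point of \<open>Q\<close>.\<close>
  have N'N: "N' \<subseteq> N"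
  proof
    fix n assume n: "n \<in> N'"
    have nF: "n \<in> carrier F" using n unfolding N'_def by blast
    have "\<alpha> n (r0, N, 0) = (r0, N, 0)" using n base[OF r0] unfolding N'_def by blast
    then have "n \<star> N = N" using coset_\<alpha>[OF nF base[OF r0]] by (metis fst_conv snd_conv)
    moreover have "n \<in> n \<star> N"
      using nF N.one_closed by (auto simp: l_coset_def intro!: bexI[of _ \<one>])
    ultimately show "n \<in> N" by simp
  qed
  define rep where "rep C = (SOME g. g \<in> C)" for C :: "'f set"
  have rep: "rep C \<in> carrier F" "C = N' #> rep C" if "C \<in> rcosets N'" for C
  proof -
    obtain h where h: "h \<in> carrier F" "C = N' #> h" using \<open>C \<in> rcosets N'\<close> by (rule rcosetsE)
    have "h \<in> C" using rcos_self[OF h(1) N'.subgroup_axioms] h(2) by simp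
    then have r: "rep C \<in> C" unfolding rep_def by (rule someI)
    show "rep C \<in> carrier F" using r h N'.subset by (auto simp: r_coset_def)
    show "C = N' #> rep C"
      using r h repr_independence[OF _ h(1) N'.subgroup_axioms] by simp
  qed
  have act_rep: "\<alpha> (rep (x \<star> C)) q = \<alpha> x (\<alpha> (rep C) q)"
    if C: "C \<in> rcosets N'" and x: "x \<in> carrier F" and q: "q \<in> Q" for C x q
  proof -
    have xC: "x \<star> C = N' #> (x \<otimes> rep C)"
      using l_coset_r_coset[OF N'.normal_axioms x rep(1)[OF C]] rep(2)[OF C] by simp
    have xC': "x \<star> C \<in> rcosets N'" using acts_onD(1)[OF cosN' C x] .
    have "rep (x \<star> C) \<in> N' #> (x \<otimes> rep C)"
      using rcos_self[OF rep(1)[OF xC'] N'.subgroup_axioms] rep(2)[OF xC'] xC by simp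
    then obtain n where n: "n \<in> N'" "rep (x \<star> C) = n \<otimes> (x \<otimes> rep C)" by (auto simp: r_coset_def)
    have nF: "n \<in> carrier F" and fix_n: "\<And>q. q \<in> Q \<Longrightarrow> \<alpha> n q = q" using n(1) unfolding N'_def by blast+
    have xr: "x \<otimes> rep C \<in> carrier F" using x rep(1)[OF C] by simp
    have "\<alpha> (rep (x \<star> C)) q = \<alpha> n (\<alpha> (x \<otimes> rep C) q)"
      unfolding n(2) by (rule \<alpha>D(3)[OF q nF xr])
    also have "\<dots> = \<alpha> (x \<otimes> rep C) q" by (rule fix_n[OF \<alpha>D(1)[OF q xr]])
    also have "\<dots> = \<alpha> x (\<alpha> (rep C) q)" by (rule \<alpha>D(3)[OF q x rep(1)[OF C]])
    finally show ?thesis .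
  qed
  define pos where "pos C r = \<beta> (rep C) r" for C r
  define f where "f C r = snd (snd (\<alpha> (rep C) (r, N, 0)))" for C r
  define D where "D x C r = u x (pos C r) N' C" for x C r
  define I where "I x C r \<longleftrightarrow> hit x (pos C r) (N <#> C)" for x C r
  have pos_K: "pos C r \<in> K" if "C \<in> rcosets N'" "r \<in> K" for C r
    unfolding pos_def using acts_onD(1)[OF \<beta>(1) that(2) rep(1)[OF that(1)]] .
  have pos_step: "pos (x \<star> C) r = \<sigma> x (pos C r)"
    if C: "C \<in> rcosets N'" and x: "x \<in> X" and k: "r \<in> K" for C x r
  proof -
    have "pos (x \<star> C) r = fst (\<alpha> (rep (x \<star> C)) (r, N, 0))"
      unfolding pos_def using fst_\<alpha>[OF rep(1) base[OF k]] acts_onD(1)[OF cosN' C XF[OF x]] by simp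
    also have "\<dots> = \<beta> x (\<beta> (rep C) r)"
      using act_rep[OF C XF[OF x] base[OF k]] fst_\<alpha> \<alpha>D(1)[OF base[OF k]] rep(1)[OF C] XF[OF x] base[OF k]
      by simp
    finally show ?thesis using \<beta>(2)[OF x pos_K[OF C k]] by (simp add: pos_def)
  qed
  have coset_C: "N <#> C = rep C \<star> N" if C: "C \<in> rcosets N'" for C
  proof -
    have "N <#> C = N <#> (N' #> rep C)" using rep(2)[OF C] by simp
    also have "\<dots> = N <#> N' #> rep C"
      using N.subset N'.subset rep(1)[OF C] by (simp add: setmult_rcos_assoc)
    also have "N <#> N' = N"
    proof
      show "N <#> N' \<subseteq> N" using N'N by (auto simp: set_mult_def)
      show "N \<subseteq> N <#> N'" 
      proof
        fix y assume y: "y \<in> N"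
        then have "y = y \<otimes> \<one>" using N.subset by auto
        then show "y \<in> N <#> N'" using y N'.one_closed unfolding set_mult_def by blast
      qed
    qed
    also have "N #> rep C = rep C \<star> N" using N.coset_eq rep(1)[OF C] by simp
    finally show ?thesis .
  qed
  \<comment> \<open>The coboundary of the sheet number is the indicator function of the chosen edge.\<close>
  have f_step: "[f (x \<star> C) r = f C r + of_bool (I x (x \<star> C) r)] (mod int p)"
    if C: "C \<in> rcosets N'" and x: "x \<in> X" and k: "r \<in> K" for C x r
  proof -
    have xC: "x \<star> C \<in> rcosets N'" using acts_onD(1)[OF cosN' C XF[OF x]] .
    let ?q = "\<alpha> (rep C) (r, N, 0)"
    have q: "?q \<in> Q" using \<alpha>D(1)[OF base[OF k] rep(1)[OF C]] .
    have q_eq: "?q = (pos C r, rep C \<star> N, f C r)"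
      using fst_\<alpha>[OF rep(1)[OF C] base[OF k]] coset_\<alpha>[OF rep(1)[OF C] base[OF k]]
      by (simp add: prod_eq_iff pos_def f_def)
    have q'_eq: "\<alpha> (rep (x \<star> C)) (r, N, 0) = \<tau> x ?q"
      using act_rep[OF C XF[OF x] base[OF k]] \<alpha>(2)[OF x q] by simp
    have "x \<star> (rep C \<star> N) = N <#> (x \<star> C)"
      using coset_\<alpha>[OF rep(1)[OF xC] base[OF k]] q'_eq coset_C[OF xC]
      by (simp add: q_eq \<tau>_def)
    then have "f (x \<star> C) r = (f C r + of_bool (I x (x \<star> C) r)) mod int p"
      unfolding f_def[of "x \<star> C"] q'_eq q_eq by (simp add: \<tau>_def I_def pos_step[OF C x k])
    then show ?thesis by (simp add: cong_def)
  qed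
  have flow: "[(\<Sum>x\<in>X. D x C r) = (\<Sum>x\<in>X. D x (x \<star> C) r)] (mod int p)"
    if C: "C \<in> rcosets N'" and k: "r \<in> K" for C r
  proof -
    have "(\<Sum>x\<in>X. D x C r) = (\<Sum>x\<in>X. coord (u x (pos C r)) N' (rep C))"
      using rep(2)[OF C] by (simp add: D_def coord_def)
    moreover have "(\<Sum>x\<in>X. D x (x \<star> C) r) = (\<Sum>x\<in>X. coord (u x (\<sigma> x (pos C r))) N' (x \<otimes> rep C))"
    proof (rule sum.cong[OF refl])
      fix x assume x: "x \<in> X"
      have "x \<star> C = N' #> (x \<otimes> rep C)"
        using l_coset_r_coset[OF N'.normal_axioms XF[OF x] rep(1)[OF C]] rep(2)[OF C] by simp
      then show "D x (x \<star> C) r = coord (u x (\<sigma> x (pos C r))) N' (x \<otimes> rep C)"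
        unfolding D_def coord_def pos_step[OF C x k] by simp
    qed
    ultimately show ?thesis using cycle[OF pos_K[OF C k] N' rep(1)[OF C]] by simp
  qed
  have shift: "(\<Sum>C\<in>rcosets N'. g (x \<star> C)) = sum g (rcosets N')" if x: "x \<in> X" for x and g :: "'f set \<Rightarrow> int"
  proof (rule sum.reindex_bij_betw)
    show "bij_betw (\<lambda>C. x \<star> C) (rcosets N') (rcosets N')"
      using acts_onD(1)[OF cosN'] act_inv_cancel[OF cosN' _ XF[OF x]] XF[OF x]
      by (intro bij_betwI[where g = "\<lambda>C. inv x \<star> C"]) auto
  qed
  have shift2: "(\<Sum>C\<in>rcosets N'. \<Sum>x\<in>X. g (x \<star> C) x) = (\<Sum>C\<in>rcosets N'. \<Sum>x\<in>X. g C x)"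
    for g :: "'f set \<Rightarrow> 'f \<Rightarrow> int"
  proof -
    have "(\<Sum>C\<in>rcosets N'. \<Sum>x\<in>X. g (x \<star> C) x) = (\<Sum>x\<in>X. \<Sum>C\<in>rcosets N'. g (x \<star> C) x)"
      by (rule sum.swap)
    also have "\<dots> = (\<Sum>x\<in>X. \<Sum>C\<in>rcosets N'. g C x)"
      by (rule sum.cong[OF refl], rule shift)
    also have "\<dots> = (\<Sum>C\<in>rcosets N'. \<Sum>x\<in>X. g C x)" by (rule sum.swap)
    finally show ?thesis .
  qed
  let ?S = "\<lambda>g. \<Sum>r\<in>K. \<Sum>C\<in>rcosets N'. \<Sum>x\<in>X. g r C x"
  \<comment> \<open>Summation by parts, with the cycle condition in the first step.\<close>
  have 1: "[?S (\<lambda>r C x. f C r * D x C r) = ?S (\<lambda>r C x. f C r * D x (x \<star> C) r)] (mod int p)"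
    unfolding sum_distrib_left [symmetric]
    by (intro cong_sum cong_scalar_left flow)
  have 2: "[?S (\<lambda>r C x. f C r * D x (x \<star> C) r)
      = ?S (\<lambda>r C x. (f (x \<star> C) r - of_bool (I x (x \<star> C) r)) * D x (x \<star> C) r)] (mod int p)"
  proof (intro cong_sum cong_scalar_right)
    fix r C x assume "r \<in> K" "C \<in> rcosets N'" "x \<in> X"
    then have "[f (x \<star> C) r - of_bool (I x (x \<star> C) r)
      = f C r + of_bool (I x (x \<star> C) r) - of_bool (I x (x \<star> C) r)] (mod int p)"
      by (intro cong_diff f_step cong_refl)
    then show "[f C r = f (x \<star> C) r - of_bool (I x (x \<star> C) r)] (mod int p)"
      by (simp add: cong_sym)
  qed
  have 3: "?S (\<lambda>r C x. (f (x \<star> C) r - of_bool (I x (x \<star> C) r)) * D x (x \<star> C) r)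
      = ?S (\<lambda>r C x. (f C r - of_bool (I x C r)) * D x C r)"
    by (intro sum.cong refl shift2)
  have "?S (\<lambda>r C x. (f C r - of_bool (I x C r)) * D x C r)
    = ?S (\<lambda>r C x. f C r * D x C r) - ?S (\<lambda>r C x. of_bool (I x C r) * D x C r)"
    by (simp add: left_diff_distrib sum_subtractf)
  then have zero: "[?S (\<lambda>r C x. of_bool (I x C r) * D x C r) = 0] (mod int p)"
    using cong_trans[OF 1 2] unfolding 3 by (simp add: cong_iff_dvd_diff dvd_diff_commute)
  have "?S (\<lambda>r C x. of_bool (I x C r) * D x C r)
    = (\<Sum>C\<in>rcosets N'. \<Sum>r\<in>K. \<Sum>x\<in>X. of_bool (I x C r) * D x C r)"
    by (rule sum.swap)
  also have "\<dots> = (\<Sum>C\<in>rcosets N'. if N <#> C = N #> h0 then u x0 r0 N' C else 0)"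
  proof (rule sum.cong[OF refl])
    fix C assume C: "C \<in> rcosets N'"
    let ?r = "\<beta> (inv (rep C)) r0"
    have r: "?r \<in> K" using acts_onD(1)[OF \<beta>(1) r0] rep(1)[OF C] by simp
    have pos_iff: "pos C r = r0 \<longleftrightarrow> r = ?r" if "r \<in> K" for r
      unfolding pos_def
      using act_inv_cancel[OF \<beta>(1) that rep(1)[OF C]] act_inv_cancel[OF \<beta>(1) r0 rep(1)[OF C]] by metis
    have "(\<Sum>x\<in>X. of_bool (I x C r) * D x C r)
      = (if r = ?r then (if N <#> C = N #> h0 then u x0 r0 N' C else 0) else 0)" if k: "r \<in> K" for r
    proof -
      have "(\<Sum>x\<in>X. of_bool (I x C r) * D x C r)
        = (\<Sum>x\<in>X. if x = x0 then of_bool (I x0 C r) * D x0 C r else 0)"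
        by (intro sum.cong refl) (auto simp: I_def hit_def)
      also have "\<dots> = of_bool (I x0 C r) * D x0 C r" using x0 finite_basis_X by simp
      finally show ?thesis using pos_iff[OF k] by (auto simp: I_def hit_def D_def)
    qed
    then have "(\<Sum>r\<in>K. \<Sum>x\<in>X. of_bool (I x C r) * D x C r)
      = (\<Sum>r\<in>K. if r = ?r then (if N <#> C = N #> h0 then u x0 r0 N' C else 0) else 0)"
      by (intro sum.cong refl)
    also have "\<dots> = (if N <#> C = N #> h0 then u x0 r0 N' C else 0)"
      using r K by simp
    finally show "(\<Sum>r\<in>K. \<Sum>x\<in>X. of_bool (I x C r) * D x C r)
      = (if N <#> C = N #> h0 then u x0 r0 N' C else 0)" .
  qed
  also have "\<dots> = (\<Sum>C | C \<in> rcosets N' \<and> N <#> C = N #> h0. u x0 r0 N' C)"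
    using finN' by (simp add: sum.inter_filter)
  finally have "coord (u x0 r0) N h0 = ?S (\<lambda>r C x. of_bool (I x C r) * D x C r) mod int p"
    using coord_compatible[OF u[OF x0 r0] N' N N'N h0] by simp
  then show ?thesis using zero by (simp add: cong_def)
qed

end


section \<open>Finitely generated submodules\<close>

text \<open>
  Every \<open>F\<close>-stable subgroup of \<open>W\<close> is a submodule, because the elements of the group algebra act by sums
  of powers of translates. This makes the results on acyclic actions applicable to \<open>W\<close>.
\<close>

locale submodule_of_completion = modular_free_group_algebra F p X
  for F :: "('f, 'h) monoid_scheme" (structure) and p :: nat and X :: "'f set" +
  fixes W :: "('f set \<Rightarrow> 'f set \<Rightarrow> int) set"
  assumes W_submodule: "submodule W kF M"
begin

abbreviation smult_M :: "('f \<Rightarrow> int) \<Rightarrow> ('f set \<Rightarrow> 'f set \<Rightarrow> int) \<Rightarrow> ('f set \<Rightarrow> 'f set \<Rightarrow> int)"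
    (infixl "\<cdot>" 70)
  where "a \<cdot> y \<equiv> a \<odot>\<^bsub>M\<^esub> y"

abbreviation MW :: "('f \<Rightarrow> int, 'f set \<Rightarrow> 'f set \<Rightarrow> int) module"
  where "MW \<equiv> M\<lparr>carrier := W\<rparr>"

definition G
  where "G = add_monoid MW"

lemma G_simps [simp]: "carrier G = W" "x \<otimes>\<^bsub>G\<^esub> y = x \<oplus>\<^bsub>M\<^esub> y" "\<one>\<^bsub>G\<^esub> = \<zero>\<^bsub>M\<^esub>"
  by (simp_all add: G_def)

definition act :: "'f \<Rightarrow> ('f set \<Rightarrow> 'f set \<Rightarrow> int) \<Rightarrow> ('f set \<Rightarrow> 'f set \<Rightarrow> int)"
  where "act g y = single 1 g \<cdot> y"

lemma W_subset: "y \<in> W \<Longrightarrow> y \<in> carrier M"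
  using subgroup.subset[OF submodule.axioms(1)[OF W_submodule]] by auto

lemma W_add: "\<lbrakk>y \<in> W; z \<in> W\<rbrakk> \<Longrightarrow> y \<oplus>\<^bsub>M\<^esub> z \<in> W"
  using subgroup.m_closed[OF submodule.axioms(1)[OF W_submodule]] by simp

lemma W_zero: "\<zero>\<^bsub>M\<^esub> \<in> W"
  using subgroup.one_closed[OF submodule.axioms(1)[OF W_submodule]] by simp

lemma W_smult: "\<lbrakk>a \<in> carrier kF; y \<in> W\<rbrakk> \<Longrightarrow> a \<cdot> y \<in> W"
  using submodule.smult_closed[OF W_submodule] .

lemma W_eqI:
  assumes "y \<in> W" "z \<in> W" "\<And>N h. \<lbrakk>N \<in> \<N>; h \<in> carrier F\<rbrakk> \<Longrightarrow> [coord y N h = coord z N h] (mod int p)"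
  shows "y = z"
  using assms W_subset by (intro M_eqI)

lemma single_one_closed: "single 1 g \<in> carrier kF"
  using p_gt_1 by (intro single_closed) simp

lemma act_W: "y \<in> W \<Longrightarrow> act g y \<in> W"
  unfolding act_def by (intro W_smult single_one_closed)

lemma coord_act:
  assumes "y \<in> W" "g \<in> carrier F" "N \<in> \<N>" "h \<in> carrier F"
  shows "coord (act g y) N h = coord y N (inv g \<otimes> h)"
proof -
  have "coord (act g y) N h = coord y N (inv g \<otimes> h) mod int p"
    unfolding act_def
    using coord_smult[OF single_one_closed W_subset[OF assms(1)] assms(3,4)] convolve_single[OF assms(2)]
    by simp
  then show ?thesis
    using coord_range[OF W_subset[OF assms(1)] assms(3), of "inv g \<otimes> h"] assms(2,4) by simp
qed

text \<open>
  Inverses in \<open>W\<close> come from the closure under multiplication by the scalar \<open>-1\<close>.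
\<close>

lemma coord_minus:
  assumes "y \<in> W" "N \<in> \<N>" "h \<in> carrier F"
  shows "[coord (single (int p - 1) \<one> \<cdot> y) N h = - coord y N h] (mod int p)"
proof -
  have "single (int p - 1) \<one> \<in> carrier kF" using p_gt_1 by (intro single_closed) simp
  then have "coord (single (int p - 1) \<one> \<cdot> y) N h = (int p - 1) * coord y N h mod int p"
    using coord_smult[OF _ W_subset[OF assms(1)] assms(2,3)] convolve_single[of \<one>] assms(3) by simp
  then have "[coord (single (int p - 1) \<one> \<cdot> y) N h = (int p - 1) * coord y N h] (mod int p)"
    by (simp add: cong_def)
  also have "[(int p - 1) * coord y N h = - coord y N h] (mod int p)"
    by (simp add: cong_iff_dvd_diff left_diff_distrib)
  finally show ?thesis .
qed

lemma comm_group_G: "comm_group G"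
proof (rule comm_groupI)
  fix x y z assume "x \<in> carrier G" and "y \<in> carrier G" and "z \<in> carrier G"
  then have x: "x \<in> W" and y: "y \<in> W" and z: "z \<in> W" by simp_all
  show "x \<otimes>\<^bsub>G\<^esub> y \<in> carrier G" using x y W_add by simp
  have "x \<oplus>\<^bsub>M\<^esub> y \<oplus>\<^bsub>M\<^esub> z = x \<oplus>\<^bsub>M\<^esub> (y \<oplus>\<^bsub>M\<^esub> z)"
    by (rule W_eqI) (use x y z W_add in \<open>simp_all add: coord_add cong_def mod_simps add.assoc\<close>)
  then show "x \<otimes>\<^bsub>G\<^esub> y \<otimes>\<^bsub>G\<^esub> z = x \<otimes>\<^bsub>G\<^esub> (y \<otimes>\<^bsub>G\<^esub> z)" by simp
  have "x \<oplus>\<^bsub>M\<^esub> y = y \<oplus>\<^bsub>M\<^esub> x"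
    by (rule W_eqI) (use x y W_add in \<open>simp_all add: coord_add add.commute\<close>)
  then show "x \<otimes>\<^bsub>G\<^esub> y = y \<otimes>\<^bsub>G\<^esub> x" by simp
  have "\<zero>\<^bsub>M\<^esub> \<oplus>\<^bsub>M\<^esub> x = x"
    by (rule W_eqI) (use x W_add W_zero in \<open>simp_all add: coord_add coord_zero cong_def\<close>)
  then show "\<one>\<^bsub>G\<^esub> \<otimes>\<^bsub>G\<^esub> x = x" by simp
  let ?m = "single (int p - 1) \<one> \<cdot> x"
  have m: "?m \<in> W" using p_gt_1 x by (intro W_smult single_closed) simp_all
  have "?m \<oplus>\<^bsub>M\<^esub> x = \<zero>\<^bsub>M\<^esub>"
  proof (rule W_eqI)
    fix N h assume N: "N \<in> \<N>" and h: "h \<in> carrier F"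
    have "[coord ?m N h + coord x N h = - coord x N h + coord x N h] (mod int p)"
      by (intro cong_add coord_minus x N h cong_refl)
    then show "[coord (?m \<oplus>\<^bsub>M\<^esub> x) N h = coord \<zero>\<^bsub>M\<^esub> N h] (mod int p)"
      using N h by (simp add: coord_add coord_zero cong_def)
  qed (use m x W_add W_zero in auto)
  then show "\<exists>y\<in>carrier G. y \<otimes>\<^bsub>G\<^esub> x = \<one>\<^bsub>G\<^esub>" using m by auto
qed (simp add: W_zero)

lemma coord_finprod:
  assumes "\<And>i. i \<in> A \<Longrightarrow> f i \<in> W" "N \<in> \<N>" "h \<in> carrier F"
  shows "coord (finprod G f A) N h = (\<Sum>i\<in>A. coord (f i) N h) mod int p"
proof -
  interpret G: comm_group G by (rule comm_group_G)
  show ?thesis using assms(1)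
  proof (induction A rule: infinite_finite_induct)
    case (insert i A)
    then have "f \<in> A \<rightarrow> carrier G" "f i \<in> carrier G" by auto
    then have "finprod G f (insert i A) = f i \<oplus>\<^bsub>M\<^esub> finprod G f A"
      using insert.hyps by (simp add: G.finprod_insert)
    then show ?case using insert assms(2,3) by (simp add: coord_add mod_simps)
  qed (simp_all add: coord_zero assms(2,3))
qed

lemma coord_int_pow:
  assumes "y \<in> W" "N \<in> \<N>" "h \<in> carrier F"
  shows "[coord (y [^]\<^bsub>G\<^esub> (c::int)) N h = c * coord y N h] (mod int p)"
proof -
  interpret G: comm_group G by (rule comm_group_G)
  have yG: "y \<in> carrier G" using assms(1) by simp
  have nat: "[coord (y [^]\<^bsub>G\<^esub> (n::nat)) N h = int n * coord y N h] (mod int p)" for n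
  proof (induction n)
    case 0
    then show ?case using assms by (simp add: coord_zero)
  next
    case (Suc n)
    have "coord (y [^]\<^bsub>G\<^esub> Suc n) N h = (coord (y [^]\<^bsub>G\<^esub> n) N h + coord y N h) mod int p"
      using assms(2,3) by (simp add: coord_add)
    moreover have "[coord (y [^]\<^bsub>G\<^esub> n) N h + coord y N h = int n * coord y N h + coord y N h] (mod int p)"
      using Suc by (intro cong_add cong_refl)
    ultimately show ?case by (simp add: cong_def distrib_right add.commute)
  qed
  show ?thesis
  proof (cases c rule: int_cases2)
    case (nonneg n)
    then show ?thesis using nat by (simp add: int_pow_int)
  next
    case (nonpos n)
    let ?z = "y [^]\<^bsub>G\<^esub> n"
    have "y [^]\<^bsub>G\<^esub> c \<oplus>\<^bsub>M\<^esub> ?z = \<zero>\<^bsub>M\<^esub>"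
      using G.l_inv[OF G.nat_pow_closed[OF yG, of n]] G.int_pow_neg_int[OF yG, of n] nonpos by simp
    then have "[coord (y [^]\<^bsub>G\<^esub> c) N h + coord ?z N h = 0] (mod int p)"
      using coord_add[OF assms(2,3), of "y [^]\<^bsub>G\<^esub> c" ?z] coord_zero[OF assms(2,3)] by (simp add: cong_def)
    then have "[coord (y [^]\<^bsub>G\<^esub> c) N h + int n * coord y N h = 0] (mod int p)"
      using nat[of n] by (meson cong_add cong_refl cong_sym cong_trans)
    then show ?thesis using nonpos by (simp add: cong_iff_dvd_diff)
  qed
qed

lemma acyclic_action_W: "acyclic_action G F p X act"
proof -
  interpret G: comm_group G by (rule comm_group_G)
  show ?thesis
  proof unfold_locales
    show "prime p" by (rule prime_p)
    show "X \<subseteq> carrier F" "finite X" by (rule basis_subset, rule finite_basis_X)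
    show "\<exists>w. fst ` set w \<subseteq> X \<and> eval_word F w = g" if "g \<in> carrier F" for g
      using words_exist[OF that] .
    fix x assume xG: "x \<in> carrier G"
    then have x: "x \<in> W" by simp
    show "x [^]\<^bsub>G\<^esub> p = \<one>\<^bsub>G\<^esub>"
    proof -
      have "x [^]\<^bsub>G\<^esub> int p = \<zero>\<^bsub>M\<^esub>"
      proof (rule W_eqI)
        show "x [^]\<^bsub>G\<^esub> int p \<in> W" using G.int_pow_closed[OF xG, of "int p"] by simp
        show "[coord (x [^]\<^bsub>G\<^esub> int p) N h = coord \<zero>\<^bsub>M\<^esub> N h] (mod int p)"
          if "N \<in> \<N>" "h \<in> carrier F" for N h
          using coord_int_pow[OF x that, of "int p"] that by (simp add: coord_zero cong_def)
      qed (rule W_zero)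
      then show ?thesis by (simp add: int_pow_int)
    qed
    show "act \<one> x = x"
      by (rule W_eqI) (use x act_W coord_act in simp_all)
    fix g assume g: "g \<in> carrier F"
    show "act g x \<in> carrier G" using act_W[OF x] by simp
    fix y assume "y \<in> carrier G"
    then have y: "y \<in> W" by simp
    have "act g (x \<oplus>\<^bsub>M\<^esub> y) = act g x \<oplus>\<^bsub>M\<^esub> act g y"
      by (rule W_eqI) (use x y g W_add act_W in \<open>simp_all add: coord_act coord_add\<close>)
    then show "act g (x \<otimes>\<^bsub>G\<^esub> y) = act g x \<otimes>\<^bsub>G\<^esub> act g y" by simp
  next
    fix g h x assume g: "g \<in> carrier F" and h: "h \<in> carrier F" and "x \<in> carrier G"
    then have x: "x \<in> W" by simp
    show "act (g \<otimes> h) x = act g (act h x)"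
      by (rule W_eqI) (use x g h act_W in \<open>simp_all add: coord_act inv_mult_group m_assoc\<close>)
  next
    fix K :: "('f \<times> bool \<Rightarrow> 'f set \<Rightarrow> 'f set \<Rightarrow> int) set" and \<sigma> u x r
    assume K: "finite K" and \<sigma>: "\<And>x. x \<in> X \<Longrightarrow> bij_betw (\<sigma> x) K K"
      and u: "\<And>x r. \<lbrakk>x \<in> X; r \<in> K\<rbrakk> \<Longrightarrow> u x r \<in> carrier G"
      and cycle: "\<And>r. r \<in> K \<Longrightarrow>
         finprod G (\<lambda>x. u x r) X = finprod G (\<lambda>x. act (inv x) (u x (\<sigma> x r))) X"
      and x: "x \<in> X" and r: "r \<in> K"
    have uW: "u x r \<in> W" if "x \<in> X" "r \<in> K" for x r using u[OF that] by simp
    have \<sigma>K: "\<sigma> x r \<in> K" if "x \<in> X" "r \<in> K" for x r using bij_betw_apply[OF \<sigma>] that by blast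
    have "u x r = \<zero>\<^bsub>M\<^esub>"
    proof (rule W_eqI)
      fix N h assume N: "N \<in> \<N>" and h: "h \<in> carrier F"
      have "coord (u x r) N h = 0"
      proof (rule coord_acyclic[OF K \<sigma> _ _ x r N h])
        show "u x r \<in> carrier M" if "x \<in> X" "r \<in> K" for x r using uW[OF that] by (rule W_subset)
        fix r N h assume r: "r \<in> K" and N: "N \<in> \<N>" and h: "h \<in> carrier F"
        have "coord (act (inv x) (u x (\<sigma> x r))) N h = coord (u x (\<sigma> x r)) N (x \<otimes> h)" if "x \<in> X" for x
          using coord_act[OF uW[OF that \<sigma>K[OF that r]] _ N h, of "inv x"] basis_subset that by auto
        then have "(\<Sum>x\<in>X. coord (act (inv x) (u x (\<sigma> x r))) N h) = (\<Sum>x\<in>X. coord (u x (\<sigma> x r)) N (x \<otimes> h))"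
          by (intro sum.cong refl)
        then show "[(\<Sum>x\<in>X. coord (u x r) N h) = (\<Sum>x\<in>X. coord (u x (\<sigma> x r)) N (x \<otimes> h))] (mod int p)"
          using arg_cong[OF cycle[OF r], of "\<lambda>y. coord y N h"]
            coord_finprod[of X "\<lambda>x. u x r", OF uW[OF _ r] N h]
            coord_finprod[of X "\<lambda>x. act (inv x) (u x (\<sigma> x r))", OF act_W[OF uW[OF _ \<sigma>K[OF _ r]]] N h]
          by (simp add: cong_def)
      qed
      then show "[coord (u x r) N h = coord \<zero>\<^bsub>M\<^esub> N h] (mod int p)" using N h by (simp add: coord_zero)
    qed (use uW x r W_zero in auto)
    then show "u x r = \<one>\<^bsub>G\<^esub>" by simp
  qed
qed

lemma left_module_W: "left_module kF MW"
proof -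
  interpret G: comm_group G by (rule comm_group_G)
  have ab: "abelian_group MW"
    unfolding abelian_group_def abelian_group_axioms_def abelian_monoid_def
    using G.comm_monoid_axioms comm_group_G unfolding G_def by blast
  interpret kF: ring kF by (rule ring_kF)
  interpret MW: abelian_group MW by (rule ab)
  show ?thesis
  proof (unfold_locales, simp_all)
    fix a y assume a: "a \<in> carrier kF" and y: "y \<in> W"
    show "a \<cdot> y \<in> W" using a y by (rule W_smult)
  next
    fix a b y assume a: "a \<in> carrier kF" and b: "b \<in> carrier kF" and y: "y \<in> W"
    note cs = coord_smult[OF _ W_subset]
    show "(a \<oplus>\<^bsub>kF\<^esub> b) \<cdot> y = a \<cdot> y \<oplus>\<^bsub>M\<^esub> b \<cdot> y"
    proof (rule W_eqI)
      fix N h assume N: "N \<in> \<N>" and h: "h \<in> carrier F"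
      show "[coord ((a \<oplus>\<^bsub>kF\<^esub> b) \<cdot> y) N h = coord (a \<cdot> y \<oplus>\<^bsub>M\<^esub> b \<cdot> y) N h] (mod int p)"
        using convolve_add[OF a b h, of "coord y N"] cs[OF add_closed_kF[OF a b] y N h] cs[OF a y N h] cs[OF b y N h] N h
        by (simp add: coord_add cong_def mod_simps)
    qed (use a b y W_smult W_add add_closed_kF in auto)
    show "(a \<otimes>\<^bsub>kF\<^esub> b) \<cdot> y = a \<cdot> (b \<cdot> y)"
    proof (rule W_eqI)
      fix N h assume N: "N \<in> \<N>" and h: "h \<in> carrier F"
      have "[convolve a (convolve b (coord y N)) h = convolve a (coord (b \<cdot> y) N) h] (mod int p)"
        using cs[OF b y N] h by (intro convolve_cong) (simp_all add: cong_def)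
      with convolve_mult[OF a b h, of "coord y N"]
      have "[convolve (a \<otimes>\<^bsub>kF\<^esub> b) (coord y N) h = convolve a (coord (b \<cdot> y) N) h] (mod int p)"
        by (rule cong_trans)
      then show "[coord ((a \<otimes>\<^bsub>kF\<^esub> b) \<cdot> y) N h = coord (a \<cdot> (b \<cdot> y)) N h] (mod int p)"
        using cs[OF mult_closed_kF[OF a b] y N h] cs[OF a W_smult[OF b y] N h] by (simp add: cong_def)
    qed (use a b y W_smult mult_closed_kF in auto)
  next
    fix a x y assume a: "a \<in> carrier kF" and x: "x \<in> W" and y: "y \<in> W"
    note cs = coord_smult[OF _ W_subset]
    show "a \<cdot> (x \<oplus>\<^bsub>M\<^esub> y) = a \<cdot> x \<oplus>\<^bsub>M\<^esub> a \<cdot> y"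
    proof (rule W_eqI)
      fix N h assume N: "N \<in> \<N>" and h: "h \<in> carrier F"
      have "[convolve a (coord (x \<oplus>\<^bsub>M\<^esub> y) N) h = convolve a (\<lambda>h. coord x N h + coord y N h) h] (mod int p)"
        using N h by (intro convolve_cong) (simp_all add: coord_add cong_def)
      also have "convolve a (\<lambda>h. coord x N h + coord y N h) h = convolve a (coord x N) h + convolve a (coord y N) h"
        by (simp add: convolve_def distrib_left sum.distrib)
      finally show "[coord (a \<cdot> (x \<oplus>\<^bsub>M\<^esub> y)) N h = coord (a \<cdot> x \<oplus>\<^bsub>M\<^esub> a \<cdot> y) N h] (mod int p)"
        using cs[OF a W_add[OF x y] N h] cs[OF a x N h] cs[OF a y N h] N h
        by (simp add: coord_add cong_def mod_simps)
    qed (use a x y W_smult W_add in auto)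
  next
    fix y assume y: "y \<in> W"
    have "act \<one> y = y" by (rule W_eqI) (use y act_W coord_act in simp_all)
    then show "\<one>\<^bsub>kF\<^esub> \<cdot> y = y" by (simp add: act_def one_kF_single)
  qed
qed

lemma smult_eq_finprod:
  assumes a: "a \<in> carrier kF" and y: "y \<in> W"
  shows "a \<cdot> y = finprod G (\<lambda>g. act g y [^]\<^bsub>G\<^esub> a g) (supp a)"
proof -
  interpret G: comm_group G by (rule comm_group_G)
  have pow: "act g y [^]\<^bsub>G\<^esub> a g \<in> W" for g
    using G.int_pow_closed[of "act g y" "a g"] act_W[OF y, of g] by simp
  show ?thesis
  proof (rule W_eqI)
    show "a \<cdot> y \<in> W" using a y by (rule W_smult)
    have "finprod G (\<lambda>g. act g y [^]\<^bsub>G\<^esub> a g) (supp a) \<in> carrier G"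
      using pow by (intro G.finprod_closed) simp
    then show "finprod G (\<lambda>g. act g y [^]\<^bsub>G\<^esub> a g) (supp a) \<in> W" by simp
    fix N h assume N: "N \<in> \<N>" and h: "h \<in> carrier F"
    have "[(\<Sum>g\<in>supp a. coord (act g y [^]\<^bsub>G\<^esub> a g) N h) = convolve a (coord y N) h] (mod int p)"
      unfolding convolve_def
    proof (rule cong_sum)
      fix g assume "g \<in> supp a"
      then have g: "g \<in> carrier F" by (simp add: supp_eq)
      show "[coord (act g y [^]\<^bsub>G\<^esub> a g) N h = a g * coord y N (inv g \<otimes> h)] (mod int p)"
        using coord_int_pow[OF act_W[OF y] N h, of g "a g"] coord_act[OF y g N h] by simp
    qed
    then show "[coord (a \<cdot> y) N h = coord (finprod G (\<lambda>g. act g y [^]\<^bsub>G\<^esub> a g) (supp a)) N h] (mod int p)"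
      using coord_smult[OF a W_subset[OF y] N h] coord_finprod[of "supp a", OF pow N h]
      by (simp add: cong_def)
  qed
qed

text \<open>
  Inverses are defined by a description that refers to the carrier, so those in \<open>W\<close> have to be
  compared with those in the whole completed group algebra.
\<close>

lemma inv_add_monoid_M:
  assumes "y \<in> W"
  shows "inv\<^bsub>add_monoid M\<^esub> y = inv\<^bsub>G\<^esub> y"
proof -
  interpret G: comm_group G by (rule comm_group_G)
  have i: "inv\<^bsub>G\<^esub> y \<in> W" "y \<oplus>\<^bsub>M\<^esub> inv\<^bsub>G\<^esub> y = \<zero>\<^bsub>M\<^esub>" "inv\<^bsub>G\<^esub> y \<oplus>\<^bsub>M\<^esub> y = \<zero>\<^bsub>M\<^esub>"
    using G.inv_closed[of y] G.r_inv[of y] G.l_inv[of y] assms by simp_all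
  show ?thesis
    unfolding m_inv_def[of "add_monoid M"]
  proof (rule the_equality)
    show "inv\<^bsub>G\<^esub> y \<in> carrier (add_monoid M) \<and> y \<otimes>\<^bsub>add_monoid M\<^esub> inv\<^bsub>G\<^esub> y = \<one>\<^bsub>add_monoid M\<^esub> \<and>
        inv\<^bsub>G\<^esub> y \<otimes>\<^bsub>add_monoid M\<^esub> y = \<one>\<^bsub>add_monoid M\<^esub>"
      using i W_subset by simp
    fix z assume "z \<in> carrier (add_monoid M) \<and> y \<otimes>\<^bsub>add_monoid M\<^esub> z = \<one>\<^bsub>add_monoid M\<^esub> \<and>
        z \<otimes>\<^bsub>add_monoid M\<^esub> y = \<one>\<^bsub>add_monoid M\<^esub>"
    then have z: "z \<in> carrier M" "y \<oplus>\<^bsub>M\<^esub> z = \<zero>\<^bsub>M\<^esub>" by simp_all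
    show "z = inv\<^bsub>G\<^esub> y"
    proof (rule M_eqI[OF z(1) W_subset[OF i(1)]])
      fix N h assume N: "N \<in> \<N>" and h: "h \<in> carrier F"
      have "[coord y N h + coord z N h = coord y N h + coord (inv\<^bsub>G\<^esub> y) N h] (mod int p)"
        using coord_add[OF N h, of y z] coord_add[OF N h, of y "inv\<^bsub>G\<^esub> y"] z(2) i(2) by (simp add: cong_def)
      then show "[coord z N h = coord (inv\<^bsub>G\<^esub> y) N h] (mod int p)" by (simp add: cong_add_lcancel)
    qed
  qed
qed

lemma submodule_M_if_closed:
  assumes H: "subgroup H G" and closed: "\<And>g y. \<lbrakk>g \<in> carrier F; y \<in> H\<rbrakk> \<Longrightarrow> act g y \<in> H"
  shows "submodule H kF M"
proof -
  interpret G: comm_group G by (rule comm_group_G)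
  have HW: "y \<in> W" if "y \<in> H" for y using subgroup.mem_carrier[OF H that] by simp
  show ?thesis
  proof (intro submodule.intro subgroup.intro submodule_axioms.intro)
    show "H \<subseteq> carrier (add_monoid M)" using HW W_subset by auto
    fix x y assume x: "x \<in> H" 
    show "inv\<^bsub>add_monoid M\<^esub> x \<in> H"
      using subgroup.m_inv_closed[OF H x] inv_add_monoid_M[OF HW[OF x]] by simp
    assume y: "y \<in> H"
    show "x \<otimes>\<^bsub>add_monoid M\<^esub> y \<in> H" using subgroup.m_closed[OF H x y] by simp
  next
    show "\<one>\<^bsub>add_monoid M\<^esub> \<in> H" using subgroup.one_closed[OF H] by simp
    fix a y assume a: "a \<in> carrier kF" and y: "y \<in> H"
    have "finprod G (\<lambda>g. act g y [^]\<^bsub>G\<^esub> a g) (supp a) \<in> H"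
      using closed y by (intro G.subgroup_finprod_closed[OF H] G.subgroup_int_pow_closed[OF H]) (auto simp: supp_eq)
    then show "a \<cdot> y \<in> H" using smult_eq_finprod[OF a HW[OF y]] by simp
  qed
qed

text \<open>
  The independence of the translates of \<open>B\<close> is a statement about products in \<open>W\<close>; after exchanging the
  order of summation in coordinates it says that the coefficients of a linear relation over the group
  algebra vanish, one group element at a time.
\<close>

theorem free_if_finitely_generated:
  assumes "finite S" and gen: "W = module_span kF M S" and SM: "S \<subseteq> carrier M"
  shows "free_left_module kF MW"
proof -
  interpret A: acyclic_action G F p X act by (rule acyclic_action_W)
  have S_W: "S \<subseteq> W" unfolding gen module_span_def by blast
  then have SG: "S \<subseteq> carrier G" by simp
  have "W \<subseteq> A.act_span S"
  proof -
    have "submodule (A.act_span S) kF M"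
      using A.subgroup_act_span[OF SG] A.act_in_act_span[OF SG] by (intro submodule_M_if_closed)
    then have "module_span kF M S \<subseteq> A.act_span S"
      unfolding module_span_def using A.act_span_superset[OF SG] by blast
    then show ?thesis by (rule subset_trans[OF equalityD1[OF gen]])
  qed
  then have span_S: "A.act_span S = carrier G"
    using subgroup.subset[OF A.subgroup_act_span[OF SG]] by auto
  obtain B where B: "B \<subseteq> carrier G" "finite B" "A.act_span B = carrier G"
    and indep: "\<And>T c g b. \<lbrakk>finite T; T \<subseteq> carrier F;
        finprod G (\<lambda>g. act g (finprod G (\<lambda>b. b [^]\<^bsub>G\<^esub> (c g b :: int)) B)) T = \<one>\<^bsub>G\<^esub>; g \<in> T; b \<in> B\<rbrakk> \<Longrightarrow>
      int p dvd c g b"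
    using A.free_basis_exists[OF assms(1) SG span_S] by blast
  have BW: "b \<in> W" if "b \<in> B" for b using that B(1) by auto
  have W_self: "submodule W kF MW"
    using W_smult A.subgroup_self by (intro submodule.intro submodule_axioms.intro) (simp_all add: G_def)
  have span_B: "module_span kF MW B = carrier MW"
  proof
    show "module_span kF MW B \<subseteq> carrier MW"
      using W_self BW unfolding module_span_def by auto
    have "W \<subseteq> H" if H: "submodule H kF MW" "B \<subseteq> H" for H
    proof -
      have "A.act_span B \<subseteq> H"
      proof (rule A.act_span_least[OF submodule.axioms(1)[OF H(1), folded G_def] H(2)])
        show "act g y \<in> H" if "y \<in> H" for g y
          using submodule.smult_closed[OF H(1) single_one_closed that] by (simp add: act_def)
      qed
      then show ?thesis using B(3) by simp
    qed
    then show "carrier MW \<subseteq> module_span kF MW B"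
      unfolding module_span_def by (simp add: le_Inf_iff)
  qed
  have coeffs: "c b = \<zero>\<^bsub>kF\<^esub>"
    if A: "finite A" "A \<subseteq> B" and c: "c \<in> A \<rightarrow> carrier kF"
      and zero: "(\<Oplus>\<^bsub>MW\<^esub>b\<in>A. c b \<odot>\<^bsub>MW\<^esub> b) = \<zero>\<^bsub>MW\<^esub>" and b: "b \<in> A" for A c b
  proof -
    define T where "T = (\<Union>b\<in>A. supp (c b))"
    have cb: "c b \<in> carrier kF" if "b \<in> A" for b using c that by blast
    have T: "finite T" "T \<subseteq> carrier F"
      using A(1) kF_finite_supp[OF cb] by (auto simp: T_def supp_eq)
    define d where "d g b = (if b \<in> A then c b g else 0)" for g b
    let ?inner = "\<lambda>g. finprod G (\<lambda>b. b [^]\<^bsub>G\<^esub> d g b) B"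
    have powW: "b [^]\<^bsub>G\<^esub> (i::int) \<in> W" if "b \<in> B" for b i
      using A.int_pow_closed[of b i] BW[OF that] by simp
    have innerW: "?inner g \<in> W" for g
    proof -
      have "?inner g \<in> carrier G" using powW by (intro A.finprod_closed) simp
      then show ?thesis by simp
    qed
    have zero_finprod: "finprod G (\<lambda>b. c b \<cdot> b) A = \<zero>\<^bsub>M\<^esub>"
      using zero by (simp add: finsum_def G_def)
    have "finprod G (\<lambda>g. act g (?inner g)) T = \<zero>\<^bsub>M\<^esub>"
    proof (rule W_eqI)
      have "finprod G (\<lambda>g. act g (?inner g)) T \<in> carrier G"
        using act_W[OF innerW] by (intro A.finprod_closed) simp
      then show "finprod G (\<lambda>g. act g (?inner g)) T \<in> W" by simp
      fix N h assume N: "N \<in> \<N>" and h: "h \<in> carrier F"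
      have "[coord (finprod G (\<lambda>g. act g (?inner g)) T) N h = (\<Sum>g\<in>T. coord (act g (?inner g)) N h)] (mod int p)"
        using coord_finprod[of T "\<lambda>g. act g (?inner g)", OF act_W[OF innerW] N h] by (simp add: cong_def)
      also have "[(\<Sum>g\<in>T. coord (act g (?inner g)) N h) = (\<Sum>g\<in>T. \<Sum>b\<in>B. d g b * coord b N (inv g \<otimes> h))] (mod int p)"
      proof (rule cong_sum)
        fix g assume "g \<in> T"
        then have g: "g \<in> carrier F" using T(2) by blast
        have gh: "inv g \<otimes> h \<in> carrier F" using g h by simp
        have "[coord (act g (?inner g)) N h = (\<Sum>b\<in>B. coord (b [^]\<^bsub>G\<^esub> d g b) N (inv g \<otimes> h))] (mod int p)"
          using coord_act[OF innerW g N h] coord_finprod[of B, OF powW N gh] by (simp add: cong_def)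
        also have "[(\<Sum>b\<in>B. coord (b [^]\<^bsub>G\<^esub> d g b) N (inv g \<otimes> h)) = (\<Sum>b\<in>B. d g b * coord b N (inv g \<otimes> h))] (mod int p)"
          by (intro cong_sum coord_int_pow BW N gh)
        finally show "[coord (act g (?inner g)) N h = (\<Sum>b\<in>B. d g b * coord b N (inv g \<otimes> h))] (mod int p)" .
      qed
      also have "(\<Sum>g\<in>T. \<Sum>b\<in>B. d g b * coord b N (inv g \<otimes> h)) = (\<Sum>b\<in>A. convolve (c b) (coord b N) h)"
      proof -
        have "(\<Sum>g\<in>T. \<Sum>b\<in>B. d g b * coord b N (inv g \<otimes> h)) = (\<Sum>b\<in>B. \<Sum>g\<in>T. d g b * coord b N (inv g \<otimes> h))"
          by (rule sum.swap)
        also have "\<dots> = (\<Sum>b\<in>A. \<Sum>g\<in>T. d g b * coord b N (inv g \<otimes> h))"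
          using A(2) B(2) by (intro sum.mono_neutral_right) (auto simp: d_def)
        also have "\<dots> = (\<Sum>b\<in>A. convolve (c b) (coord b N) h)"
        proof (rule sum.cong[OF refl])
          fix b assume b: "b \<in> A"
          have "supp (c b) \<subseteq> T" using b by (auto simp: T_def)
          then show "(\<Sum>g\<in>T. d g b * coord b N (inv g \<otimes> h)) = convolve (c b) (coord b N) h"
            using convolve_superset[OF T(1) _ T(2), of "c b"] b by (simp add: d_def)
        qed
        finally show ?thesis .
      qed
      also have "[(\<Sum>b\<in>A. convolve (c b) (coord b N) h) = (\<Sum>b\<in>A. coord (c b \<cdot> b) N h)] (mod int p)"
      proof (rule cong_sum)
        fix b assume b: "b \<in> A"
        then have "b \<in> W" using A(2) BW by blast
        then show "[convolve (c b) (coord b N) h = coord (c b \<cdot> b) N h] (mod int p)"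
          using coord_smult[OF cb[OF b] W_subset N h] by (simp add: cong_def)
      qed
      also have "[(\<Sum>b\<in>A. coord (c b \<cdot> b) N h) = coord (finprod G (\<lambda>b. c b \<cdot> b) A) N h] (mod int p)"
      proof -
        have "c b \<cdot> b \<in> W" if "b \<in> A" for b using W_smult[OF cb[OF that]] BW A(2) that by blast
        then show ?thesis using coord_finprod[of A "\<lambda>b. c b \<cdot> b", OF _ N h] by (simp add: cong_def)
      qed
      finally show "[coord (finprod G (\<lambda>g. act g (?inner g)) T) N h = coord \<zero>\<^bsub>M\<^esub> N h] (mod int p)"
        using zero_finprod by simp
    qed (rule W_zero)
    then have one: "finprod G (\<lambda>g. act g (?inner g)) T = \<one>\<^bsub>G\<^esub>" by simp
    have bB: "b \<in> B" using b A(2) by blast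
    show ?thesis
    proof (rule kF_eqI[OF cb[OF b]])
      show "\<zero>\<^bsub>kF\<^esub> \<in> carrier kF" using ring.ring_simprules(2)[OF ring_kF] .
      fix g assume g: "g \<in> carrier F"
      show "[c b g = \<zero>\<^bsub>kF\<^esub> g] (mod int p)"
      proof (cases "g \<in> T")
        case True
        have "int p dvd d g b" by (rule indep[OF T one True bB])
        then show ?thesis using b g by (simp add: d_def zero_kF cong_0_iff)
      next
        case False
        then have "c b g = 0" using b g by (auto simp: T_def supp_eq)
        then show ?thesis using g by (simp add: zero_kF)
      qed
    qed
  qed
  have "module_basis kF MW B"
    unfolding module_basis_def
  proof (intro conjI allI impI ballI span_B)
    show "B \<subseteq> carrier MW" using B(1) by simp
    show "c b = \<zero>\<^bsub>kF\<^esub>"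
      if "finite A \<and> A \<subseteq> B \<and> c \<in> A \<rightarrow> carrier kF \<and> (\<Oplus>\<^bsub>MW\<^esub>b\<in>A. c b \<odot>\<^bsub>MW\<^esub> b) = \<zero>\<^bsub>MW\<^esub>" "b \<in> A" for A c b
      using that coeffs by blast
  qed
  then show ?thesis unfolding free_left_module_def using left_module_W by blast
qed

end

theorem corollary5p5:
  fixes p :: nat
    and F :: "('a, 'b) monoid_scheme"
    and W :: "('a set \<Rightarrow> 'a set \<Rightarrow> int) set"
  assumes "prime p"
    and "free_group F"
    and "finitely_generated_group F"
    and "finitely_generated_submodule (group_ring (residue_ring (int p)) F)
           (completed_group_ring_module (residue_ring (int p)) F) W"
  shows "free_left_module (group_ring (residue_ring (int p)) F)
           ((completed_group_ring_module (residue_ring (int p)) F)\<lparr>carrier := W\<rparr>)"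
proof -
  obtain X where X: "free_on F X" using assms(2) by (rule free_groupE)
  interpret free_on F X by (rule X)
  obtain T where "finite T" "T \<subseteq> carrier F" "generate F T = carrier F"
    using assms(3) unfolding finitely_generated_group_def by blast
  then have "finite X" by (rule finite_basis)
  moreover obtain S where S: "submodule W (group_ring (residue_ring (int p)) F)
        (completed_group_ring_module (residue_ring (int p)) F)"
      "S \<subseteq> carrier (completed_group_ring_module (residue_ring (int p)) F)" "finite S"
      "W = module_span (group_ring (residue_ring (int p)) F)
        (completed_group_ring_module (residue_ring (int p)) F) S"
    using assms(4) unfolding finitely_generated_submodule_def by blast
  ultimately have "submodule_of_completion F p X W"
    using assms(1) X free_on.axioms(1)[OF X]
    by (intro submodule_of_completion.intro modular_free_group_algebra.intro modular_group_algebra.intro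
        modular_group_algebra_axioms.intro modular_free_group_algebra_axioms.intro
        submodule_of_completion_axioms.intro)
  then interpret submodule_of_completion F p X W .
  show ?thesis using S(3,4,2) by (rule free_if_finitely_generated)
qed

end
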